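(* There exists an isomorphism of superalgebras $\psi:\mathrm{U}(\mathfrak{Lgl}_{M|N})\to\mathrm{U}_{\mathbb{A}}/(q-1)\mathrm{U}_{\mathbb{A}}$ such that (writing elements of $\mathrm{U}_{\mathbb{A}}$ for their images in the quotient) $$E_{ij}^{(0)}\mapsto(-1)^{|i||j|}\gamma_{ij}^{(0)},\qquad E_{ji}^{(0)}\mapsto-(-1)^{|i||j|}\widetilde\gamma_{ji}^{(0)}\qquad\text{for }1\le i\le j\le M+N,$$ $$E_{ij}^{(-r)}\mapsto(-1)^{|i||j|}\gamma_{ij}^{(r)},\qquad E_{ij}^{(r)}\mapsto-(-1)^{|i||j|}\widetilde\gamma_{ij}^{(r)}\qquad\text{for }i,j\in I,\ r>0.$$
   Context: Notation. $M,N\ge0$ are integers, $I=\{1,\dots,M+N\}$, and $|i|=\bar0$ for $i\le M$, $|i|=\bar1$ for $i>M$. $V=\mathbb{C}^{M|N}$ has basis $v_i$ of parity $|i|$, and $E_{ij}\in\operatorname{End}(V)$ are the matrix units, of parity $|i|+|j|$. Tensor products of superalgebras carry the multiplication $(a_1\otimes b_1)(a_2\otimes b_2)=(-1)^{|a_2||b_1|}a_1a_2\otimes b_1b_2$, and $[a,b]=ab-(-1)^{|a||b|}ba$. $\mathrm{U}(\mathfrak{Lgl}_{M|N})$ is the universal enveloping superalgebra of $\mathfrak{gl}_{M|N}\otimes\mathbb{C}[x,x^{-1}]$: the associative superalgebra over $\mathbb{C}$ generated by $E_{ij}^{(r)}$ ($=E_{ij}\otimes x^r$; $i,j\in I$,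 $r\in\mathbb{Z}$) of parity $|i|+|j|$ with relations $[E_{ij}^{(r)},E_{kl}^{(s)}]=\delta_{jk}E_{il}^{(r+s)}-(-1)^{(|i|+|j|)(|k|+|l|)}\delta_{il}E_{kj}^{(r+s)}$. Let $q$ be an indeterminate, $q_i=q^{(-1)^{|i|}}$, and $$\Re_q(u,v)=\sum_{i,j\in I}\big(uq_i^{\delta_{ij}}-vq_i^{-\delta_{ij}}\big)E_{ii}\otimes E_{jj}+u\sum_{i>j}(q_j-q_j^{-1})E_{ij}\otimes E_{ji}+v\sum_{i<j}(q_j-q_j^{-1})E_{ij}\otimes E_{ji}.$$ $\mathrm{U}_q(\mathfrak{Lgl}_{M|N})$ is the associative superalgebra over $\mathbb{C}(q)$ generated by $T_{ij}^{(r)},\widetilde T_{ij}^{(r)}$ ($i,j\in I$, $r\ge0$) of parity $|i|+|j|$, with relations $T_{ji}^{(0)}=\widetilde T_{ij}^{(0)}=0$ for $i<j$; $T_{ii}^{(0)}\widetilde T_{ii}^{(0)}=\widetilde T_{ii}^{(0)}T_{ii}^{(0)}=1$; and $$\Re_q^{12}(u,v)T^1(u)T^2(v)=T^2(v)T^1(u)\Re_q^{12}(u,v),\quad \Re_q^{12}(u,v)\widetilde T^1(u)\widetilde T^2(v)=\widetilde T^2(v)\widetilde T^1(u)\Re_q^{12}(u,v),$$ $$\Re_q^{12}(u,v)\widetilde T^1(u)T^2(v)=T^2(v)\widetilde T^1(u)\Re_q^{12}(u,v),$$ where $T(u)=\sum_{i,j}E_{ij}\otimes T_{ij}(u)$,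 $T_{ij}(u)=\sum_{r\ge0}T_{ij}^{(r)}u^r$, $\widetilde T(u)=\sum_{i,j}E_{ij}\otimes\widetilde T_{ij}(u)$, $\widetilde T_{ij}(u)=\sum_{r\ge0}\widetilde T_{ij}^{(r)}u^{-r}$, and $X^1=\sum E_{ij}\otimes1\otimes X_{ij}$, $X^2=\sum1\otimes E_{ij}\otimes X_{ij}$. $\mathbb{A}=\{f/g:f,g\in\mathbb{C}[q],\ g(1)\ne0\}$. $\mathrm{U}_{\mathbb{A}}$ is the $\mathbb{A}$-sub-superalgebra of $\mathrm{U}_q(\mathfrak{Lgl}_{M|N})$ generated by $\gamma_{ij}^{(r)},\widetilde\gamma_{ij}^{(r)}$ ($i,j\in I,r\ge0$), where $\gamma_{ii}^{(0)}=\frac{T_{ii}^{(0)}-1}{q-1}$, $\widetilde\gamma_{ii}^{(0)}=\frac{\widetilde T_{ii}^{(0)}-1}{q-1}$, and otherwise $\gamma_{ij}^{(r)}=\frac{T_{ij}^{(r)}}{q-q^{-1}}$, $\widetilde\gamma_{ij}^{(r)}=\frac{\widetilde T_{ij}^{(r)}}{q-q^{-1}}$. *)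

theory Defs
  imports
    "HOL-Library.Poly_Mapping"
    "HOL-Library.Groups_Big_Fun"
    "HOL-Library.Z2"
    "HOL-Computational_Algebra.Polynomial_Factorial"
    "HOL-Algebra.Module"
    "HOL-Algebra.QuotRing"
begin

text \<open>
  Parities are elements of \<^typ>\<open>bit\<close> (the field with two elements). A superalgebra over a field is a
  (noncommutative) ring with a scalar multiplication and, for each parity, the set of
  homogeneous elements of that parity.
\<close>

record ('k, 'a) superalgebra = "('k, 'a) module" +
  homog :: "bit \<Rightarrow> 'a set"

definition ksign :: "bit \<Rightarrow> 'a::{one,uminus}"
  where "ksign p = (if p = 0 then 1 else - 1)"

definition superalgebra_hom ::
    "('k, 'a) superalgebra \<Rightarrow> ('k, 'b) superalgebra \<Rightarrow> ('a \<Rightarrow> 'b) set"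
  where "superalgebra_hom A B =
    {f \<in> ring_hom A B.
       (\<forall>c. \<forall>x\<in>carrier A. f (c \<odot>\<^bsub>A\<^esub> x) = c \<odot>\<^bsub>B\<^esub> f x) \<and>
       (\<forall>p. \<forall>x\<in>homog A p. f x \<in> homog B p)}"

definition superalgebra_iso ::
    "('k, 'a) superalgebra \<Rightarrow> ('k, 'b) superalgebra \<Rightarrow> ('a \<Rightarrow> 'b) set"
  where "superalgebra_iso A B = {f \<in> superalgebra_hom A B. bij_betw f (carrier A) (carrier B)}"

definition quot_superalgebra ::
    "('k, 'a) superalgebra \<Rightarrow> 'a set \<Rightarrow> ('k, 'a set) superalgebra"
  where "quot_superalgebra A J =
    \<lparr>carrier = carrier (A Quot J), mult = mult (A Quot J), one = one (A Quot J),
     zero = zero (A Quot J), add = add (A Quot J),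
     smult = (\<lambda>c X. \<Union>x\<in>X. J +>\<^bsub>A\<^esub> (c \<odot>\<^bsub>A\<^esub> x)),
     homog = (\<lambda>p. (\<lambda>x. J +>\<^bsub>A\<^esub> x) ` homog A p)\<rparr>"

text \<open>\<open>K\<close> is meant to be a subring of the ground field; zero and negatives come from scalars.\<close>

inductive_set gen_subalgebra :: "('k, 'a) superalgebra \<Rightarrow> 'k set \<Rightarrow> 'a set \<Rightarrow> 'a set"
  for A :: "('k, 'a) superalgebra" and K :: "'k set" and S :: "'a set"
  where
    one: "\<one>\<^bsub>A\<^esub> \<in> gen_subalgebra A K S"
  | gen: "x \<in> S \<Longrightarrow> x \<in> gen_subalgebra A K S"
  | add: "x \<in> gen_subalgebra A K S \<Longrightarrow> y \<in> gen_subalgebra A K S \<Longrightarrow>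
            x \<oplus>\<^bsub>A\<^esub> y \<in> gen_subalgebra A K S"
  | mult: "x \<in> gen_subalgebra A K S \<Longrightarrow> y \<in> gen_subalgebra A K S \<Longrightarrow>
            x \<otimes>\<^bsub>A\<^esub> y \<in> gen_subalgebra A K S"
  | smult: "c \<in> K \<Longrightarrow> x \<in> gen_subalgebra A K S \<Longrightarrow> c \<odot>\<^bsub>A\<^esub> x \<in> gen_subalgebra A K S"

definition sub_superalgebra :: "('k, 'a) superalgebra \<Rightarrow> 'a set \<Rightarrow> ('k, 'a) superalgebra"
  where "sub_superalgebra A S = A\<lparr>carrier := S, homog := (\<lambda>p. homog A p \<inter> S)\<rparr>"

definition restrict_scalars ::
    "('l \<Rightarrow> 'k) \<Rightarrow> ('k, 'a) superalgebra \<Rightarrow> ('l, 'a) superalgebra"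
  where "restrict_scalars h A =
    \<lparr>carrier = carrier A, mult = mult A, one = one A, zero = zero A, add = add A,
     smult = (\<lambda>c x. h c \<odot>\<^bsub>A\<^esub> x), homog = homog A\<rparr>"

text \<open>
  The free algebra is the monoid algebra of the monoid of words, written additively as required
  by \<^theory>\<open>HOL-Library.Poly_Mapping\<close>.
\<close>

datatype 'g word = Word (letters: "'g list")

instantiation word :: (type) monoid_add
begin
definition zero_word_def: "0 = Word []"
definition plus_word_def: "v + w = Word (letters v @ letters w)"
instance by standard (simp_all add: zero_word_def plus_word_def)
end

type_synonym ('k, 'g) free_alg = "'g word \<Rightarrow>\<^sub>0 'k"

definition word_parity :: "('g \<Rightarrow> bit) \<Rightarrow> 'g word \<Rightarrow> bit"
  where "word_parity par w = sum_list (map par (letters w))"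

definition fgen :: "'g \<Rightarrow> ('k::field, 'g) free_alg"
  where "fgen g = Poly_Mapping.single (Word [g]) 1"

definition fscalar :: "'k \<Rightarrow> ('k::field, 'g) free_alg"
  where "fscalar c = Poly_Mapping.single 0 c"

definition free_superalgebra ::
    "'g set \<Rightarrow> ('g \<Rightarrow> bit) \<Rightarrow> ('k::field, ('k, 'g) free_alg) superalgebra"
  where "free_superalgebra G par =
    \<lparr>carrier = {x. \<forall>w\<in>Poly_Mapping.keys x. set (letters w) \<subseteq> G},
     mult = (*), one = 1, zero = 0, add = (+),
     smult = (\<lambda>c x. fscalar c * x),
     homog = (\<lambda>p. {x. \<forall>w\<in>Poly_Mapping.keys x. set (letters w) \<subseteq> G \<and> word_parity par w = p})\<rparr>"

definition rel_ideal ::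
    "'g set \<Rightarrow> ('g \<Rightarrow> bit) \<Rightarrow> ('k::field, 'g) free_alg set \<Rightarrow> ('k, 'g) free_alg set"
  where "rel_ideal G par Rels = genideal (free_superalgebra G par) Rels"

definition presented_superalgebra ::
    "'g set \<Rightarrow> ('g \<Rightarrow> bit) \<Rightarrow> ('k::field, 'g) free_alg set \<Rightarrow>
       ('k, ('k, 'g) free_alg set) superalgebra"
  where "presented_superalgebra G par Rels =
    quot_superalgebra (free_superalgebra G par) (rel_ideal G par Rels)"

definition presented_gen ::
    "'g set \<Rightarrow> ('g \<Rightarrow> bit) \<Rightarrow> ('k::field, 'g) free_alg set \<Rightarrow> 'g \<Rightarrow> ('k, 'g) free_alg set"
  where "presented_gen G par Rels g =
    rel_ideal G par Rels +>\<^bsub>free_superalgebra G par\<^esub> fgen g"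

text \<open>
  The following facts show that \<^const>\<open>genideal\<close>, an intersection of two-sided ideals, is taken
  in an actual ring.
\<close>

lemma carrier_free_superalgebra_one: "1 \<in> carrier (free_superalgebra G par)"
  by (simp add: free_superalgebra_def zero_word_def)

lemma carrier_free_superalgebra_scalar: "fscalar c \<in> carrier (free_superalgebra G par)"
  by (simp add: free_superalgebra_def fscalar_def zero_word_def)

lemma carrier_free_superalgebra_gen: "g \<in> G \<Longrightarrow> fgen g \<in> carrier (free_superalgebra G par)"
  by (simp add: free_superalgebra_def fgen_def)

lemma carrier_free_superalgebra_add:
  "x \<in> carrier (free_superalgebra G par) \<Longrightarrow> y \<in> carrier (free_superalgebra G par) \<Longrightarrow>
   x + y \<in> carrier (free_superalgebra G par)"
  using Poly_Mapping.keys_add[of x y] by (auto simp: free_superalgebra_def)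

lemma carrier_free_superalgebra_uminus:
  "x \<in> carrier (free_superalgebra G par) \<Longrightarrow> - x \<in> carrier (free_superalgebra G par)"
  by (simp add: free_superalgebra_def)

lemma carrier_free_superalgebra_mult:
  "x \<in> carrier (free_superalgebra G par) \<Longrightarrow> y \<in> carrier (free_superalgebra G par) \<Longrightarrow>
   x * y \<in> carrier (free_superalgebra G par)"
  using Poly_Mapping.keys_mult[of x y] by (fastforce simp: free_superalgebra_def plus_word_def)

lemma ring_free_superalgebra: "ring (free_superalgebra G par)" (is "ring ?F")
proof (rule ringI)
  show "abelian_group ?F"
  proof (rule abelian_groupI)
    fix x y assume "x \<in> carrier ?F" "y \<in> carrier ?F"
    then show "x \<oplus>\<^bsub>?F\<^esub> y \<in> carrier ?F"
      using carrier_free_superalgebra_add[of x G par y] by (simp add: free_superalgebra_def)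
  next
    fix x assume "x \<in> carrier ?F"
    then show "\<exists>y\<in>carrier ?F. y \<oplus>\<^bsub>?F\<^esub> x = \<zero>\<^bsub>?F\<^esub>"
      using carrier_free_superalgebra_uminus[of x G par]
      by (intro bexI[of _ "- x"]) (auto simp: free_superalgebra_def)
  qed (auto simp: free_superalgebra_def add_ac)
  show "monoid ?F"
  proof (rule monoidI)
    fix x y assume "x \<in> carrier ?F" "y \<in> carrier ?F"
    then show "x \<otimes>\<^bsub>?F\<^esub> y \<in> carrier ?F"
      using carrier_free_superalgebra_mult[of x G par y] by (simp add: free_superalgebra_def)
  next
    show "\<one>\<^bsub>?F\<^esub> \<in> carrier ?F"
      using carrier_free_superalgebra_one[of G par] by (simp add: free_superalgebra_def)
  qed (auto simp: free_superalgebra_def mult.assoc)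
qed (auto simp: free_superalgebra_def algebra_simps)

definition idx :: "nat \<Rightarrow> nat \<Rightarrow> nat set"
  where "idx M N = {1..M + N}"

definition ipar :: "nat \<Rightarrow> nat \<Rightarrow> bit"
  where "ipar M i = (if i \<le> M then 0 else 1)"

text \<open>The generator \<open>LE i j r\<close> stands for \<open>E\<^sub>i\<^sub>j \<otimes> x\<^sup>r\<close>.\<close>

datatype loop_gen = LE nat nat int

fun loop_par :: "nat \<Rightarrow> loop_gen \<Rightarrow> bit"
  where "loop_par M (LE i j r) = ipar M i + ipar M j"

definition loop_gens :: "nat \<Rightarrow> nat \<Rightarrow> loop_gen set"
  where "loop_gens M N = {LE i j r | i j r. i \<in> idx M N \<and> j \<in> idx M N}"

definition loop_rel ::
    "nat \<Rightarrow> nat \<Rightarrow> nat \<Rightarrow> int \<Rightarrow> nat \<Rightarrow> nat \<Rightarrow> int \<Rightarrow> (complex, loop_gen) free_alg"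
  where "loop_rel M i j r k l s =
    (let e = ksign ((ipar M i + ipar M j) * (ipar M k + ipar M l)) in
      (fgen (LE i j r) * fgen (LE k l s) - e * fgen (LE k l s) * fgen (LE i j r))
      - ((if j = k then fgen (LE i l (r + s)) else 0)
         - e * (if i = l then fgen (LE k j (r + s)) else 0)))"

definition loop_rels :: "nat \<Rightarrow> nat \<Rightarrow> (complex, loop_gen) free_alg set"
  where "loop_rels M N = {loop_rel M i j r k l s | i j r k l s.
    i \<in> idx M N \<and> j \<in> idx M N \<and> k \<in> idx M N \<and> l \<in> idx M N}"

definition U_loop ::
    "nat \<Rightarrow> nat \<Rightarrow> (complex, (complex, loop_gen) free_alg set) superalgebra"
  where "U_loop M N = presented_superalgebra (loop_gens M N) (loop_par M) (loop_rels M N)"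

definition loop_E ::
    "nat \<Rightarrow> nat \<Rightarrow> nat \<Rightarrow> nat \<Rightarrow> int \<Rightarrow> (complex, loop_gen) free_alg set"
  where "loop_E M N i j r =
    presented_gen (loop_gens M N) (loop_par M) (loop_rels M N) (LE i j r)"

type_synonym ratfun = "complex poly fract"

definition qvar :: ratfun
  where "qvar = to_fract [:0, 1:]"

definition qi :: "nat \<Rightarrow> nat \<Rightarrow> ratfun"
  where "qi M i = (if ipar M i = 0 then qvar else inverse qvar)"

datatype qloop_gen = QT nat nat nat | QTt nat nat nat

fun qloop_par :: "nat \<Rightarrow> qloop_gen \<Rightarrow> bit"
  where
    "qloop_par M (QT i j r) = ipar M i + ipar M j"
  | "qloop_par M (QTt i j r) = ipar M i + ipar M j"

definition qloop_gens :: "nat \<Rightarrow> nat \<Rightarrow> qloop_gen set"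
  where "qloop_gens M N =
    {QT i j r | i j r. i \<in> idx M N \<and> j \<in> idx M N} \<union>
    {QTt i j r | i j r. i \<in> idx M N \<and> j \<in> idx M N}"

type_synonym qfree = "(ratfun, qloop_gen) free_alg"

text \<open>
  A value \<open>X\<close> of type \<open>bimat\<close> is the formal series
  \<open>\<Sum> E\<^sub>i\<^sub>j \<otimes> E\<^sub>k\<^sub>l \<otimes> X i j k l a b u\<^sup>a v\<^sup>b\<close> over \<open>i\<close>, \<open>j\<close>, \<open>k\<close>, \<open>l\<close> in the index set and integers \<open>a\<close>, \<open>b\<close>.
\<close>

type_synonym bimat = "nat \<Rightarrow> nat \<Rightarrow> nat \<Rightarrow> nat \<Rightarrow> int \<Rightarrow> int \<Rightarrow> qfree"

text \<open>The linear map \<open>x \<mapsto> (-1)\<^sup>p\<^sup>|\<^sup>x\<^sup>| x\<close>.\<close>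

definition twist :: "nat \<Rightarrow> bit \<Rightarrow> qfree \<Rightarrow> qfree"
  where "twist M p x = Poly_Mapping.mapp (\<lambda>w c. ksign (p * word_parity (qloop_par M) w) * c) x"

text \<open>
  The superalgebra multiplication:
  the product of \<open>E\<^sub>i\<^sub>m \<otimes> E\<^sub>k\<^sub>n \<otimes> x\<close> and \<open>E\<^sub>m\<^sub>j \<otimes> E\<^sub>n\<^sub>l \<otimes> y\<close> is \<open>E\<^sub>i\<^sub>j \<otimes> E\<^sub>k\<^sub>l \<otimes> x y\<close> times the sign obtained
  from moving \<open>E\<^sub>m\<^sub>j\<close> to the left past \<open>E\<^sub>k\<^sub>n\<close> and \<open>x\<close>, and \<open>E\<^sub>n\<^sub>l\<close> past \<open>x\<close>. In the products
  used below, only finitely many summands of \<^const>\<open>Sum_any\<close> are nonzero.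
\<close>

definition bimat_mult :: "nat \<Rightarrow> nat \<Rightarrow> bimat \<Rightarrow> bimat \<Rightarrow> bimat"
  where "bimat_mult M N X Y i j k l a b =
    (\<Sum>m\<in>idx M N. \<Sum>n\<in>idx M N. Sum_any (\<lambda>(c, d).
       ksign ((ipar M m + ipar M j) * (ipar M k + ipar M n)) *
       twist M (ipar M m + ipar M j + ipar M n + ipar M l) (X i m k n c d) *
       Y m j n l (a - c) (b - d)))"

definition R_mat :: "nat \<Rightarrow> bimat"
  where "R_mat M i j k l a b = fscalar
    (if i = j \<and> k = l then
       (if a = 1 \<and> b = 0 then (if i = k then qi M i else 1)
        else if a = 0 \<and> b = 1 then - (if i = k then inverse (qi M i) else 1)
        else 0)
     else if k = j \<and> l = i \<and> i > j \<and> a = 1 \<and> b = 0 then qi M j - inverse (qi M j)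
     else if k = j \<and> l = i \<and> i < j \<and> a = 0 \<and> b = 1 then qi M j - inverse (qi M j)
     else 0)"

definition T_series :: "nat \<Rightarrow> nat \<Rightarrow> int \<Rightarrow> qfree"
  where "T_series i j a = (if a \<ge> 0 then fgen (QT i j (nat a)) else 0)"

definition Tt_series :: "nat \<Rightarrow> nat \<Rightarrow> int \<Rightarrow> qfree"
  where "Tt_series i j a = (if a \<le> 0 then fgen (QTt i j (nat (- a))) else 0)"

text \<open>\<open>X\<^sup>1(u)\<close> and \<open>X\<^sup>2(v)\<close> for a matrix \<open>X\<close> of series in one variable.\<close>

definition leg1 :: "(nat \<Rightarrow> nat \<Rightarrow> int \<Rightarrow> qfree) \<Rightarrow> bimat"
  where "leg1 X i j k l a b = (if k = l \<and> b = 0 then X i j a else 0)"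

definition leg2 :: "(nat \<Rightarrow> nat \<Rightarrow> int \<Rightarrow> qfree) \<Rightarrow> bimat"
  where "leg2 X i j k l a b = (if i = j \<and> a = 0 then X k l b else 0)"

text \<open>
  The coefficients of \<open>R(u,v) X\<^sup>1(u) Y\<^sup>2(v) - Y\<^sup>2(v) X\<^sup>1(u) R(u,v)\<close>.
\<close>

definition RTT_rels ::
    "nat \<Rightarrow> nat \<Rightarrow> (nat \<Rightarrow> nat \<Rightarrow> int \<Rightarrow> qfree) \<Rightarrow> (nat \<Rightarrow> nat \<Rightarrow> int \<Rightarrow> qfree) \<Rightarrow> qfree set"
  where "RTT_rels M N X Y =
    {bimat_mult M N (bimat_mult M N (R_mat M) (leg1 X)) (leg2 Y) i j k l a b
     - bimat_mult M N (bimat_mult M N (leg2 Y) (leg1 X)) (R_mat M) i j k l a b | i j k l a b.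
     i \<in> idx M N \<and> j \<in> idx M N \<and> k \<in> idx M N \<and> l \<in> idx M N}"

definition qloop_rels :: "nat \<Rightarrow> nat \<Rightarrow> qfree set"
  where "qloop_rels M N =
    {fgen (QT j i 0) | i j. i \<in> idx M N \<and> j \<in> idx M N \<and> i < j} \<union>
    {fgen (QTt i j 0) | i j. i \<in> idx M N \<and> j \<in> idx M N \<and> i < j} \<union>
    {fgen (QT i i 0) * fgen (QTt i i 0) - 1 | i. i \<in> idx M N} \<union>
    {fgen (QTt i i 0) * fgen (QT i i 0) - 1 | i. i \<in> idx M N} \<union>
    RTT_rels M N T_series T_series \<union>
    RTT_rels M N Tt_series Tt_series \<union>
    RTT_rels M N Tt_series T_series"

definition Uq_loop :: "nat \<Rightarrow> nat \<Rightarrow> (ratfun, qfree set) superalgebra"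
  where "Uq_loop M N = presented_superalgebra (qloop_gens M N) (qloop_par M) (qloop_rels M N)"

definition T_el :: "nat \<Rightarrow> nat \<Rightarrow> nat \<Rightarrow> nat \<Rightarrow> nat \<Rightarrow> qfree set"
  where "T_el M N i j r =
    presented_gen (qloop_gens M N) (qloop_par M) (qloop_rels M N) (QT i j r)"

definition Tt_el :: "nat \<Rightarrow> nat \<Rightarrow> nat \<Rightarrow> nat \<Rightarrow> nat \<Rightarrow> qfree set"
  where "Tt_el M N i j r =
    presented_gen (qloop_gens M N) (qloop_par M) (qloop_rels M N) (QTt i j r)"

definition A_loc :: "ratfun set"
  where "A_loc = {to_fract f / to_fract g | f g. poly g 1 \<noteq> 0}"

definition gamma :: "nat \<Rightarrow> nat \<Rightarrow> nat \<Rightarrow> nat \<Rightarrow> nat \<Rightarrow> qfree set"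
  where "gamma M N i j r =
    (if i = j \<and> r = 0
     then inverse (qvar - 1) \<odot>\<^bsub>Uq_loop M N\<^esub>
            (T_el M N i i 0 \<ominus>\<^bsub>Uq_loop M N\<^esub> \<one>\<^bsub>Uq_loop M N\<^esub>)
     else inverse (qvar - inverse qvar) \<odot>\<^bsub>Uq_loop M N\<^esub> T_el M N i j r)"

definition gammat :: "nat \<Rightarrow> nat \<Rightarrow> nat \<Rightarrow> nat \<Rightarrow> nat \<Rightarrow> qfree set"
  where "gammat M N i j r =
    (if i = j \<and> r = 0
     then inverse (qvar - 1) \<odot>\<^bsub>Uq_loop M N\<^esub>
            (Tt_el M N i i 0 \<ominus>\<^bsub>Uq_loop M N\<^esub> \<one>\<^bsub>Uq_loop M N\<^esub>)
     else inverse (qvar - inverse qvar) \<odot>\<^bsub>Uq_loop M N\<^esub> Tt_el M N i j r)"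

text \<open>
  The scalar multiplication of \<open>U_A\<close> and of its quotient is that of the ambient algebra; it is
  meaningful only for scalars in \<^const>\<open>A_loc\<close>.
\<close>

definition U_A :: "nat \<Rightarrow> nat \<Rightarrow> (ratfun, qfree set) superalgebra"
  where "U_A M N = sub_superalgebra (Uq_loop M N)
    (gen_subalgebra (Uq_loop M N) A_loc
      ({gamma M N i j r | i j r. i \<in> idx M N \<and> j \<in> idx M N} \<union>
       {gammat M N i j r | i j r. i \<in> idx M N \<and> j \<in> idx M N}))"

definition q1_ideal :: "nat \<Rightarrow> nat \<Rightarrow> qfree set set"
  where "q1_ideal M N = (\<lambda>x. (qvar - 1) \<odot>\<^bsub>U_A M N\<^esub> x) ` carrier (U_A M N)"

text \<open>
  The quotient of \<open>U_A\<close> by \<open>(q - 1) U_A\<close> is an algebra over \<^const>\<open>A_loc\<close> modulo \<open>q - 1\<close>; that field is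
  the field of complex numbers, embedded as the constant polynomials.
\<close>

definition U_spec :: "nat \<Rightarrow> nat \<Rightarrow> (complex, qfree set set) superalgebra"
  where "U_spec M N =
    restrict_scalars (\<lambda>c. to_fract [:c:]) (quot_superalgebra (U_A M N) (q1_ideal M N))"

definition spec_class :: "nat \<Rightarrow> nat \<Rightarrow> qfree set \<Rightarrow> qfree set set"
  where "spec_class M N x = q1_ideal M N +>\<^bsub>U_A M N\<^esub> x"

end

theory Submission
  imports Defs "HOL-Library.Multiset" "HOL-Algebra.Subrings" "HOL-Computational_Algebra.Formal_Power_Series"
begin

text \<open>
  Writing \<open>T(u) = 1 + (q - 1) x(u)\<close> and expanding the RTT relations to second order in \<open>q - 1\<close>, the
  images of \<open>x(u)\<close> modulo \<open>q - 1\<close> satisfy a two-term recursion in the Fourier modes which forces the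
  loop algebra relations; this gives a surjective homomorphism from the enveloping algebra to the
  quotient. For injectivity, the quantum loop algebra acts on tensor powers of the vector
  representation on \<open>\<complex>(q)\<^sup>M\<^sup>|\<^sup>N[x, x\<^sup>-\<^sup>1]\<close> (evaluation of the Perk--Schultz \<open>L\<close>-operator), this action
  preserves the lattice of \<open>\<bbbA>\<close>-valued functions, and at \<open>q = 1\<close> it becomes the classical action on
  tensor powers. The latter are jointly faithful: on a tensor power with one extra trivial summand, the
  operators of a PBW monomial with \<open>n\<close> factors are separated by matrix coefficients in the \<open>n\<close>-th power
  that annihilate all shorter monomials.
\<close>

text \<open>Injectivity uses no basis of the quantum algebra. If the lift of a classical element
  \<open>x\<close> lies in \<open>(q - 1)\<close> times the lattice, it acts on
  \<open>A\<close>-valued functions by \<open>(q - 1)\<close> times an operator preserving them. Its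
  value at \<open>q = 1\<close> is the classical action of \<open>x\<close>, which therefore
  vanishes in every tensor power. Three points shape the proof. At second order the RTT relations
  give only differences of brackets with neighbouring modes \<open>(a - 1, b)\<close> and
  \<open>(a, b - 1)\<close>; each series runs in one direction, so such a chain reaches a mode that
  is zero and all defects on it vanish. The Yang-Baxter identity is proved for ordinary operators in
  commuting tensor slots; multiplying row \<open>i\<close> by the \<open>|i|\<close>-th power of the
  total parity operator restores the super signs. Finally, diagonal generators of degree 0 are
  divided by \<open>q - 1\<close>, all others by \<open>q - 1/q\<close>; the ratio of these is 2 at
  \<open>q = 1\<close>, whence the factors 1 and 2 in the limits. Quotients are handled through
  representatives in free algebras and congruence modulo preimages of ideals.\<close>

definition feval :: "('k \<Rightarrow> 'b::ring_1) \<Rightarrow> ('g \<Rightarrow> 'b) \<Rightarrow> ('k::field, 'g) free_alg \<Rightarrow> 'b"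
  where "feval h \<phi> x =
    (\<Sum>w\<in>Poly_Mapping.keys x. h (Poly_Mapping.lookup x w) * prod_list (map \<phi> (letters w)))"

text \<open>The case \<open>single\<close> keeps \<open>w\<close> among the keys of
  \<open>x\<close>, so support conditions on \<open>x\<close> survive the induction.\<close>

lemma free_alg_induct [case_names zero single add]:
  fixes x :: "('k::field, 'g) free_alg"
  assumes "P 0" "\<And>w c. w \<in> Poly_Mapping.keys x \<Longrightarrow> P (Poly_Mapping.single w c)"
    "\<And>y z. P y \<Longrightarrow> P z \<Longrightarrow> P (y + z)"
  shows "P x"
proof -
  have eq: "x = (\<Sum>w\<in>Poly_Mapping.keys x. Poly_Mapping.single w (Poly_Mapping.lookup x w))"
    by (rule poly_mapping_eqI)
      (simp add: lookup_sum lookup_single when_def sum.delta in_keys_iff)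
  have "P (\<Sum>w\<in>W. Poly_Mapping.single w (Poly_Mapping.lookup x w))"
    if "finite W" "W \<subseteq> Poly_Mapping.keys x" for W
    using that
  proof (induction W rule: finite_induct)
    case (insert w W)
    then show ?case using assms(2,3) by simp
  qed (simp add: assms(1))
  then show ?thesis using eq finite_keys by (metis order_refl)
qed

section \<open>Evaluation homomorphisms from free algebras with central scalars\<close>

lemma letters_zero [simp]: "letters 0 = []"
  by (simp add: zero_word_def)

text \<open>Centrality of \<open>h\<close> makes \<open>feval\<close> multiplicative although the
  target is noncommutative. The instances are \<open>fscalar\<close>, the complex constants inside
  the free algebra over the rational functions, and the multiplication operators
  \<open>sc\<close>.\<close>

locale central_scalars =
  fixes h :: "'k::field \<Rightarrow> 'b::ring_1"
  assumes h_add: "h (a + b) = h a + h b"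
    and h_mult: "h (a * b) = h a * h b"
    and h_one: "h 1 = 1"
    and h_comm: "h a * y = y * h a"
begin

lemma h_zero: "h 0 = 0"
  using h_add[of 0 0] by simp

lemma h_minus: "h (- a) = - h a"
  using h_add[of a "- a"] h_zero by (simp add: eq_neg_iff_add_eq_0 add.commute)

lemma h_diff: "h (a - b) = h a - h b"
  using h_add[of a "- b"] h_minus by simp

lemma feval_superset:
  assumes "finite A" "Poly_Mapping.keys x \<subseteq> A"
  shows "feval h \<phi> x = (\<Sum>w\<in>A. h (Poly_Mapping.lookup x w) * prod_list (map \<phi> (letters w)))"
  unfolding feval_def
  by (rule sum.mono_neutral_left) (use assms in \<open>auto simp: in_keys_iff h_zero\<close>)

lemma feval_zero [simp]: "feval h \<phi> 0 = 0"
  by (simp add: feval_def)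

lemma feval_add: "feval h \<phi> (x + y) = feval h \<phi> x + feval h \<phi> y"
proof -
  let ?A = "Poly_Mapping.keys x \<union> Poly_Mapping.keys y"
  have "Poly_Mapping.keys (x + y) \<subseteq> ?A" using Poly_Mapping.keys_add .
  then show ?thesis
    by (simp add: feval_superset[of ?A] lookup_add h_add distrib_right sum.distrib)
qed

lemma feval_single: "feval h \<phi> (Poly_Mapping.single w c) = h c * prod_list (map \<phi> (letters w))"
  by (simp add: feval_superset[of "{w}"])

lemma feval_mult: "feval h \<phi> (x * y) = feval h \<phi> x * feval h \<phi> y"
proof (induction x rule: free_alg_induct)
  case (single v c)
  show ?case
  proof (induction y rule: free_alg_induct)
    case (single w d)
    let ?v = "prod_list (map \<phi> (letters v))" and ?w = "prod_list (map \<phi> (letters w))"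
    have "h (c * d) * (?v * ?w) = h c * ?v * (h d * ?w)"
      using h_comm[of d ?v] by (simp add: h_mult mult.assoc) (simp flip: mult.assoc)
    then show ?case
      by (simp add: mult_single feval_single plus_word_def)
  qed (simp_all add: feval_add distrib_left)
qed (simp_all add: feval_add distrib_right)

lemma feval_uminus: "feval h \<phi> (- x) = - feval h \<phi> x"
  using feval_add[of \<phi> x "- x"] by (simp add: eq_neg_iff_add_eq_0 add.commute)

lemma feval_diff: "feval h \<phi> (x - y) = feval h \<phi> x - feval h \<phi> y"
  using feval_add[of \<phi> x "- y"] feval_uminus by simp

lemma feval_one: "feval h \<phi> 1 = 1"
  using feval_single[of \<phi> 0 1] by (simp add: h_one)

lemma feval_fgen: "feval h \<phi> (fgen g) = \<phi> g"
  by (simp add: fgen_def feval_single h_one)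

lemma feval_fscalar: "feval h \<phi> (fscalar c) = h c"
  by (simp add: fscalar_def feval_single zero_word_def)

end

lemma fscalar_comm: "fscalar c * x = x * (fscalar c :: ('k::field, 'g) free_alg)"
proof (induction x rule: free_alg_induct)
  case (single w d)
  show ?case unfolding fscalar_def mult_single by (simp only: add_0_left add_0_right mult.commute[of c d])
next
  case (add y z)
  show ?case unfolding distrib_left distrib_right add.IH ..
qed simp

lemma fscalar_add: "fscalar (a + b) = fscalar a + (fscalar b :: ('k::field, 'g) free_alg)"
  by (simp add: fscalar_def single_add)

lemma fscalar_mult: "fscalar (a * b) = fscalar a * (fscalar b :: ('k::field, 'g) free_alg)"
  by (simp add: fscalar_def mult_single)

lemma fscalar_one: "fscalar 1 = (1 :: ('k::field, 'g) free_alg)"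
  by (simp add: fscalar_def)

lemma central_scalars_fscalar: "central_scalars fscalar"
  by standard (auto simp: fscalar_add fscalar_mult fscalar_one intro: fscalar_comm)

interpretation fs: central_scalars fscalar
  by (rule central_scalars_fscalar)

lemma fscalar_ksign: "fscalar (ksign p) = ksign p"
  by (simp add: ksign_def fscalar_one fs.h_minus)

lemma ksign_simps [simp]:
  "ksign 0 = 1" "ksign 1 = - 1"
  by (simp_all add: ksign_def)

lemma ksign_add: "ksign (p + q) = ksign p * (ksign q :: 'a::ring_1)"
  by (cases p; cases q) simp_all

lemma ksign_sq [simp]: "ksign p * ksign p = (1 :: 'a::ring_1)"
  by (cases p) simp_all

lemma ksign_comm: "ksign p * x = x * (ksign p :: 'a::ring_1)"
  by (cases p) simp_all

lemma carrier_free_induct [consumes 1, case_names zero one gen scalar add mult]: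
  assumes "x \<in> carrier (free_superalgebra G par)"
    "P 0" "P 1" "\<And>g. g \<in> G \<Longrightarrow> P (fgen g)" "\<And>c. P (fscalar c)"
    "\<And>y z. P y \<Longrightarrow> P z \<Longrightarrow> P (y + z)" "\<And>y z. P y \<Longrightarrow> P z \<Longrightarrow> P (y * z)"
  shows "P (x :: ('k::field, 'g) free_alg)"
proof (induction x rule: free_alg_induct)
  case (single w c)
  then have w: "set (letters w) \<subseteq> G"
    using assms(1) by (auto simp: free_superalgebra_def)
  have "P (Poly_Mapping.single (Word u) 1)" if "set u \<subseteq> G" for u
    using that
  proof (induction u)
    case Nil
    show ?case using assms(3) by (simp flip: zero_word_def)
  next
    case (Cons g u)
    have "Poly_Mapping.single (Word (g # u)) 1 = fgen g * Poly_Mapping.single (Word u) (1::'k)"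
      by (simp add: fgen_def mult_single plus_word_def)
    with Cons assms(4,7) show ?case by simp
  qed
  from this[OF w] have "P (fscalar c * Poly_Mapping.single w 1)"
    using assms(5,7) by simp
  then show ?case by (simp add: fscalar_def mult_single)
next
  case zero
  show ?case by (rule assms(2))
next
  case (add y z)
  then show ?case by (rule assms(6))
qed

text \<open>Superalgebras are built as fresh records; the ring axioms of a quotient or subring reach
  them only through the five fields that these axioms mention.\<close>

lemma ring_cong:
  assumes "ring R" and eq: "carrier S = carrier R" "mult S = mult R" "add S = add R"
    "one S = one R" "zero S = zero R"
  shows "ring S"
proof -
  interpret R: ring R by fact
  have linv: "\<exists>y\<in>carrier R. y \<oplus>\<^bsub>R\<^esub> x = \<zero>\<^bsub>R\<^esub>" if "x \<in> carrier R" for x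
    using R.l_neg[OF that] R.a_inv_closed[OF that] by (rule bexI)
  show ?thesis
  proof (rule ringI)
    show "abelian_group S"
      by (rule abelian_groupI, unfold eq)
        (assumption | rule R.add.m_closed R.zero_closed R.a_assoc R.a_comm R.l_zero linv)+
    show "monoid S"
      by (rule monoidI, unfold eq)
        (assumption | rule R.m_assoc R.m_closed R.one_closed R.l_one R.r_one)+
  qed (unfold eq, (assumption | rule R.l_distr R.r_distr)+)
qed

section \<open>Presented superalgebras: the relation ideal and its cosets\<close>

locale presentation =
  fixes G :: "'g set" and par :: "'g \<Rightarrow> bit" and Rels :: "('k::field, 'g) free_alg set"
  assumes Rels_carrier: "Rels \<subseteq> carrier (free_superalgebra G par)"
begin

abbreviation F where "F \<equiv> free_superalgebra G par :: ('k, ('k, 'g) free_alg) superalgebra"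
abbreviation J where "J \<equiv> rel_ideal G par Rels"
abbreviation cls where "cls x \<equiv> J +>\<^bsub>F\<^esub> x"
abbreviation P where "P \<equiv> presented_superalgebra G par Rels"

sublocale F: ring F
  by (rule ring_free_superalgebra)

lemma F_simps [simp]:
  "mult F = (*)" "one F = 1" "zero F = 0" "add F = (+)" "smult F c x = fscalar c * x"
  by (simp_all add: free_superalgebra_def)

sublocale J: ideal J F
  unfolding rel_ideal_def by (rule F.genideal_ideal[OF Rels_carrier])

lemma a_inv_F: "x \<in> carrier F \<Longrightarrow> \<ominus>\<^bsub>F\<^esub> x = - x"
  using F.minus_equality[of "- x" x] carrier_free_superalgebra_uminus[of x G par] by simp

lemma a_minus_F: "x \<in> carrier F \<Longrightarrow> y \<in> carrier F \<Longrightarrow> x \<ominus>\<^bsub>F\<^esub> y = x - y"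
  by (simp add: a_minus_def a_inv_F)

lemma carrier_closed:
  "0 \<in> carrier F" "1 \<in> carrier F" "fscalar c \<in> carrier F" "g \<in> G \<Longrightarrow> fgen g \<in> carrier F"
  "x \<in> carrier F \<Longrightarrow> y \<in> carrier F \<Longrightarrow> x + y \<in> carrier F"
  "x \<in> carrier F \<Longrightarrow> y \<in> carrier F \<Longrightarrow> x - y \<in> carrier F"
  "x \<in> carrier F \<Longrightarrow> y \<in> carrier F \<Longrightarrow> x * y \<in> carrier F"
  "x \<in> carrier F \<Longrightarrow> - x \<in> carrier F"
  using F.zero_closed F.one_closed carrier_free_superalgebra_scalar[of c G par]
    carrier_free_superalgebra_gen[of g G par] F.a_closed[of x y] F.m_closed[of x y]
    F.a_inv_closed[of x] a_inv_F[of x] F.minus_closed[of x y] a_minus_F[of x y]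
  by simp_all

lemma J_carrier: "x \<in> J \<Longrightarrow> x \<in> carrier F"
  by (rule J.Icarr)

lemma J_rels: "x \<in> Rels \<Longrightarrow> x \<in> J"
  unfolding rel_ideal_def using F.genideal_self[OF Rels_carrier] by blast

lemma J_zero: "0 \<in> J"
  using J.zero_closed by simp

lemma J_add: "x \<in> J \<Longrightarrow> y \<in> J \<Longrightarrow> x + y \<in> J"
  using J.a_closed[of x y] by simp

lemma J_lmult: "x \<in> J \<Longrightarrow> y \<in> carrier F \<Longrightarrow> y * x \<in> J"
  using J.I_l_closed[of x y] by simp

lemma J_rmult: "x \<in> J \<Longrightarrow> y \<in> carrier F \<Longrightarrow> x * y \<in> J"
  using J.I_r_closed[of x y] by simp

lemma J_scalar: "x \<in> J \<Longrightarrow> fscalar c * x \<in> J"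
  by (rule J_lmult[OF _ carrier_closed(3)])

text \<open>The zeros of an evaluation form an ideal, so it suffices to test the relations.
  Representations of presented algebras enter in this form, without a map on cosets.\<close>

lemma J_kernel:
  assumes "central_scalars h" "\<And>x. x \<in> Rels \<Longrightarrow> feval h \<phi> x = 0" "x \<in> J"
  shows "feval h \<phi> x = 0"
proof -
  interpret central_scalars h by fact
  have "ideal {x \<in> carrier F. feval h \<phi> x = 0} F" (is "ideal ?K F")
  proof (rule idealI)
    show "subgroup ?K (add_monoid F)"
    proof (rule F.add.subgroupI)
      show "?K \<noteq> {}"
        using carrier_closed(1) feval_zero by blast
    qed (auto simp: a_inv_F feval_add feval_uminus carrier_closed simp flip: a_inv_def)
  qed (auto simp: feval_mult carrier_closed intro: F.ring_axioms)
  then have "J \<subseteq> ?K"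
    unfolding rel_ideal_def using assms(2) Rels_carrier by (intro F.genideal_minimal) auto
  then show ?thesis using assms(3) by blast
qed

lemma cls_eq: "x \<in> carrier F \<Longrightarrow> y \<in> carrier F \<Longrightarrow> cls x = cls y \<longleftrightarrow> x - y \<in> J"
  using F.quotient_eq_iff_same_a_r_cos[OF J.is_ideal, of x y] by (simp add: a_minus_F)

lemma cls_self: "x \<in> carrier F \<Longrightarrow> x \<in> cls x"
  by (rule J.a_rcos_self)

lemma cls_carrier: "y \<in> cls x \<Longrightarrow> x \<in> carrier F \<Longrightarrow> y \<in> carrier F"
  using J_carrier carrier_closed(5) by (auto simp: a_r_coset_def r_coset_def)

lemma cls_memD: "y \<in> cls x \<Longrightarrow> x \<in> carrier F \<Longrightarrow> cls y = cls x"
  using cls_carrier[of y x] by (auto simp: cls_eq) (auto simp: a_r_coset_def r_coset_def)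

lemma P_simps:
  "carrier P = cls ` carrier F"
  "x \<in> carrier F \<Longrightarrow> y \<in> carrier F \<Longrightarrow> mult P (cls x) (cls y) = cls (x * y)"
  "x \<in> carrier F \<Longrightarrow> y \<in> carrier F \<Longrightarrow> add P (cls x) (cls y) = cls (x + y)"
  "one P = cls 1" "zero P = cls 0"
  "homog P p = cls ` homog F p"
proof -
  show "carrier P = cls ` carrier F"
    by (auto simp: presented_superalgebra_def quot_superalgebra_def FactRing_def A_RCOSETS_def')
  show "mult P (cls x) (cls y) = cls (x * y)" if "x \<in> carrier F" "y \<in> carrier F"
    using J.rcoset_mult_add[OF that]
    by (simp add: presented_superalgebra_def quot_superalgebra_def FactRing_simps)
  show "add P (cls x) (cls y) = cls (x + y)" if "x \<in> carrier F" "y \<in> carrier F"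
    using J.a_rcos_sum[OF that]
    by (simp add: presented_superalgebra_def quot_superalgebra_def FactRing_simps)
  show "one P = cls 1" "homog P p = cls ` homog F p"
    by (simp_all add: presented_superalgebra_def quot_superalgebra_def FactRing_simps)
  show "zero P = cls 0"
    using F.a_rcos_zero[OF J.is_ideal J_zero]
    by (simp add: presented_superalgebra_def quot_superalgebra_def FactRing_simps)
qed

text \<open>The scalar multiple of a coset is a union over all its members; they all give the same
  coset because the ideal is stable under scalars.\<close>

lemma P_smult:
  assumes "x \<in> carrier F"
  shows "smult P c (cls x) = cls (fscalar c * x)"
proof -
  have "cls (fscalar c * y) = cls (fscalar c * x)" if "y \<in> cls x" for y
    using cls_memD[OF that assms] cls_carrier[OF that assms] assms
    by (simp add: cls_eq carrier_closed J_scalar flip: right_diff_distrib)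
  then have "(\<Union>y\<in>cls x. cls (fscalar c * y)) = cls (fscalar c * x)"
    using cls_self[OF assms] by blast
  then show ?thesis
    by (simp add: presented_superalgebra_def quot_superalgebra_def)
qed

lemma ring_P: "ring P"
  by (rule ring_cong[OF J.quotient_is_ring])
    (simp_all add: presented_superalgebra_def quot_superalgebra_def)

lemma a_inv_P: "x \<in> carrier F \<Longrightarrow> \<ominus>\<^bsub>P\<^esub> (cls x) = cls (- x)"
  using ring.is_abelian_group[OF ring_P, THEN abelian_group.minus_equality, of "cls (- x)" "cls x"]
  by (simp add: P_simps carrier_closed)

lemma a_minus_P:
  "x \<in> carrier F \<Longrightarrow> y \<in> carrier F \<Longrightarrow> cls x \<ominus>\<^bsub>P\<^esub> cls y = cls (x - y)"
  by (simp add: a_minus_def a_inv_P P_simps carrier_closed)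

end

section \<open>The RTT relations in coefficients\<close>

text \<open>
  \<open>RTT M h X Y i j k l a b\<close> is the coefficient of \<open>E\<^sub>i\<^sub>j \<otimes> E\<^sub>k\<^sub>l u\<^sup>a v\<^sup>b\<close> in
  \<open>R(u,v) X\<^sup>1(u) Y\<^sup>2(v) - Y\<^sup>2(v) X\<^sup>1(u) R(u,v)\<close>, for series with coefficients in any algebra.
\<close>

definition qc :: "nat \<Rightarrow> nat \<Rightarrow> ratfun"
  where "qc M k = qi M k - inverse (qi M k)"

definition RTT :: "nat \<Rightarrow> (ratfun \<Rightarrow> 'b::ring_1) \<Rightarrow> (nat \<Rightarrow> nat \<Rightarrow> int \<Rightarrow> 'b) \<Rightarrow>
    (nat \<Rightarrow> nat \<Rightarrow> int \<Rightarrow> 'b) \<Rightarrow> nat \<Rightarrow> nat \<Rightarrow> nat \<Rightarrow> nat \<Rightarrow> int \<Rightarrow> int \<Rightarrow> 'b"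
  where "RTT M h X Y i j k l a b =
    ksign ((ipar M i + ipar M j) * (ipar M k + ipar M l)) *
      (h (if i = k then qi M i else 1) * (X i j (a - 1) * Y k l b)
       - h (if i = k then inverse (qi M i) else 1) * (X i j a * Y k l (b - 1)))
    + (if i = k then 0 else ksign ((ipar M k + ipar M j) * (ipar M k + ipar M l)) *
        (h (qc M k) * (if k < i then X k j (a - 1) * Y i l b else X k j a * Y i l (b - 1))))
    - (h (if j = l then qi M j else 1) * (Y k l b * X i j (a - 1))
       - h (if j = l then inverse (qi M j) else 1) * (Y k l (b - 1) * X i j a))
    - (if j = l then 0 else ksign ((ipar M l + ipar M j) * (ipar M k + ipar M j)) *
        (h (qc M j) * (if j < l then Y k j b * X i l (a - 1) else Y k j (b - 1) * X i l a)))"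

lemma lookup_twist:
  "Poly_Mapping.lookup (twist M p x) w
    = ksign (p * word_parity (qloop_par M) w) * Poly_Mapping.lookup x w"
  by (simp add: twist_def lookup_mapp when_def in_keys_iff)

lemma lookup_fscalar_mult: "Poly_Mapping.lookup (fscalar c * x) w = c * Poly_Mapping.lookup x w"
  unfolding fscalar_def by (simp flip: mult_map_scale_conv_mult add: map.rep_eq when_def)

lemma twist_0 [simp]: "twist M p 0 = 0" "twist M 0 x = x"
  by (rule poly_mapping_eqI, simp add: lookup_twist)+

lemma twist_fscalar_mult: "twist M p (fscalar c * x) = fscalar c * twist M p x"
  by (rule poly_mapping_eqI) (simp add: lookup_twist lookup_fscalar_mult)

lemma twist_uminus: "twist M p (- x) = - twist M p x"
  by (rule poly_mapping_eqI) (simp add: lookup_twist)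

lemma twist_ksign_mult: "twist M p (ksign r * x) = ksign r * twist M p x"
  by (cases r) (simp_all add: twist_uminus)

lemma twist_fscalar: "twist M p (fscalar c) = fscalar c"
  by (rule poly_mapping_eqI)
    (simp add: lookup_twist fscalar_def lookup_single when_def word_parity_def)

lemma twist_fgen:
  "twist M p (fgen g) = ksign (p * qloop_par M g) * fgen g"
  by (rule poly_mapping_eqI, cases "p * qloop_par M g")
    (auto simp: lookup_twist fgen_def lookup_single when_def word_parity_def)

lemma Sum_any_2:
  fixes f :: "'a \<Rightarrow> 'b::comm_monoid_add"
  assumes "x \<noteq> y" "\<And>z. z \<noteq> x \<Longrightarrow> z \<noteq> y \<Longrightarrow> f z = 0"
  shows "Sum_any f = f x + f y"
  by (subst Sum_any.expand_superset[of "{x, y}"]) (use assms in auto)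

lemma Sum_any_1:
  fixes f :: "'a \<Rightarrow> 'b::comm_monoid_add"
  assumes "\<And>z. z \<noteq> x \<Longrightarrow> f z = 0"
  shows "Sum_any f = f x"
  by (subst Sum_any.expand_superset[of "{x}"]) (use assms in auto)

lemma sum_sum_delta:
  assumes "finite I" "x \<in> I" "y \<in> I" "\<And>m n. m \<in> I \<Longrightarrow> n \<in> I \<Longrightarrow> (m, n) \<noteq> (x, y) \<Longrightarrow> f m n = 0"
  shows "(\<Sum>m\<in>I. \<Sum>n\<in>I. f m n) = (f x y :: 'a::comm_monoid_add)"
proof -
  have "(\<Sum>m\<in>I. \<Sum>n\<in>I. f m n) = (\<Sum>z\<in>I\<times>I. case z of (m, n) \<Rightarrow> f m n)"
    by (simp add: sum.cartesian_product)
  also have "\<dots> = (\<Sum>z\<in>{(x, y)}. case z of (m, n) \<Rightarrow> f m n)"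
    by (rule sum.mono_neutral_right) (use assms in auto)
  finally show ?thesis by simp
qed

lemma sum_sum_delta2:
  assumes "finite I" "x \<in> I" "y \<in> I" "x' \<in> I" "y' \<in> I" "(x, y) \<noteq> (x', y')"
    "\<And>m n. m \<in> I \<Longrightarrow> n \<in> I \<Longrightarrow> (m, n) \<noteq> (x, y) \<Longrightarrow> (m, n) \<noteq> (x', y') \<Longrightarrow> f m n = 0"
  shows "(\<Sum>m\<in>I. \<Sum>n\<in>I. f m n) = f x y + (f x' y' :: 'a::comm_monoid_add)"
proof -
  have "(\<Sum>m\<in>I. \<Sum>n\<in>I. f m n) = (\<Sum>z\<in>I\<times>I. case z of (m, n) \<Rightarrow> f m n)"
    by (simp add: sum.cartesian_product)
  also have "\<dots> = (\<Sum>z\<in>{(x, y), (x', y')}. case z of (m, n) \<Rightarrow> f m n)"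
    by (rule sum.mono_neutral_right) (use assms in auto)
  finally show ?thesis using assms(6) by simp
qed

lemma finite_idx [simp]: "finite (idx M N)"
  by (simp add: idx_def)

lemma R_mat_twist: "twist M p (R_mat M i j k l a b) = R_mat M i j k l a b"
  by (simp add: R_mat_def twist_fscalar)

lemma R_mat_zero: "(a, b) \<noteq> (1, 0) \<Longrightarrow> (a, b) \<noteq> (0, 1) \<Longrightarrow> R_mat M i j k l a b = 0"
  by (auto simp: R_mat_def fs.h_zero)

lemma R_mat_zero_idx: "(m, n) \<noteq> (i, k) \<Longrightarrow> (m, n) \<noteq> (k, i) \<Longrightarrow> R_mat M i m k n a b = 0"
  by (auto simp: R_mat_def fs.h_zero)

lemma R_mat_eval:
  "R_mat M i i k k 1 0 = fscalar (if i = k then qi M i else 1)"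
  "R_mat M i i k k 0 1 = - fscalar (if i = k then inverse (qi M i) else 1)"
  "i \<noteq> k \<Longrightarrow> R_mat M i k k i 1 0 = (if k < i then fscalar (qc M k) else 0)"
  "i \<noteq> k \<Longrightarrow> R_mat M i k k i 0 1 = (if i < k then fscalar (qc M k) else 0)"
  by (auto simp: R_mat_def qc_def fs.h_zero fs.h_minus)

text \<open>The coefficients of \<open>R(u,v) X\<^sup>1(u)\<close>. A row of \<open>R\<close> meets
  only a diagonal and a transposition entry, which gives the two summands; \<open>v\<close> comes
  from \<open>R\<close> alone, so its exponent \<open>d\<close> is 0 or 1.\<close>

definition R_leg1 :: "nat \<Rightarrow> (nat \<Rightarrow> nat \<Rightarrow> int \<Rightarrow> qfree) \<Rightarrow> bimat" where
  "R_leg1 M X i j k n a d =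
    (if n = k \<and> d = 0 then fscalar (if i = k then qi M i else 1) * X i j (a - 1)
     else if n = k \<and> d = 1 then - fscalar (if i = k then inverse (qi M i) else 1) * X i j a else 0)
    + (if i \<noteq> k \<and> n = i then ksign ((ipar M k + ipar M j) * (ipar M k + ipar M i)) *
        (if k < i \<and> d = 0 then fscalar (qc M k) * X k j (a - 1)
         else if i < k \<and> d = 1 then fscalar (qc M k) * X k j a else 0) else 0)"

lemma bimat_mult_R_leg1:
  assumes "i \<in> idx M N" "k \<in> idx M N" "n \<in> idx M N"
  shows "bimat_mult M N (R_mat M) (leg1 X) i j k n a (d::int) = R_leg1 M X i j k n a d"
proof -
  have *: "Sum_any (\<lambda>(c', d'). ksign s * twist M p (R_mat M i m' k n' c' d')
        * leg1 X m' j n' n (a - c') (d - d'))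
      = ksign s * (R_mat M i m' k n' 1 0 * leg1 X m' j n' n (a - 1) d
        + R_mat M i m' k n' 0 1 * leg1 X m' j n' n a (d - 1))" for s p m' n'
  proof -
    let ?f = "\<lambda>(c', d'). ksign s * twist M p (R_mat M i m' k n' c' d')
        * leg1 X m' j n' n (a - c') (d - d')"
    have "?f z = 0" if "z \<noteq> (1, 0)" "z \<noteq> (0, 1)" for z
      using that by (cases z) (simp add: R_mat_twist R_mat_zero)
    then show ?thesis
      by (subst Sum_any_2[of "(1, 0)" "(0, 1)"]) (auto simp: R_mat_twist distrib_left mult.assoc)
  qed
  let ?f = "\<lambda>m' n'. ksign ((ipar M m' + ipar M j) * (ipar M k + ipar M n')) *
      (R_mat M i m' k n' 1 0 * leg1 X m' j n' n (a - 1) d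
        + R_mat M i m' k n' 0 1 * leg1 X m' j n' n a (d - 1))"
  have z: "?f m' n' = 0" if "(m', n') \<noteq> (i, k)" "(m', n') \<noteq> (k, i)" for m' n'
    using R_mat_zero_idx[OF that] by simp
  show ?thesis
  proof (cases "i = k")
    case True
    have "bimat_mult M N (R_mat M) (leg1 X) i j k n a d = ?f i k"
      unfolding bimat_mult_def *
      by (rule sum_sum_delta) (use assms True z in \<open>simp_all only: finite_idx not_False_eq_True\<close>)
    also have "\<dots> = R_leg1 M X i j k n a d"
      unfolding R_mat_eval R_leg1_def leg1_def using True by simp
    finally show ?thesis .
  next
    case False
    have "bimat_mult M N (R_mat M) (leg1 X) i j k n a d = ?f i k + ?f k i"
      unfolding bimat_mult_def *
      by (rule sum_sum_delta2) (use assms False z in \<open>auto simp only: finite_idx\<close>)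
    also have "\<dots> = R_leg1 M X i j k n a d"
      unfolding R_mat_eval R_mat_eval(3,4)[OF False] R_leg1_def leg1_def using False by auto
    finally show ?thesis .
  qed
qed

lemma bimat_mult_leg2_leg1:
  assumes "i \<in> idx M N" "n \<in> idx M N"
    "\<And>p k n d. twist M p (Y k n d) = ksign (p * (ipar M k + ipar M n)) * Y k n d"
  shows "bimat_mult M N (leg2 Y) (leg1 X) i m k n a b = Y k n b * X i m a"
proof -
  have *: "Sum_any (\<lambda>(c', d'). ksign s * twist M p (leg2 Y i m' k n' c' d')
        * leg1 X m' m n' n (a - c') (b - d'))
      = ksign s * (twist M p (leg2 Y i m' k n' 0 b) * leg1 X m' m n' n a 0)" for s p m' n'
  proof -
    let ?f = "\<lambda>(c', d'). ksign s * twist M p (leg2 Y i m' k n' c' d')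
        * leg1 X m' m n' n (a - c') (b - d')"
    have "?f z = 0" if "z \<noteq> (0, b)" for z
      using that by (cases z) (auto simp: leg1_def leg2_def)
    then show ?thesis
      by (subst Sum_any_1[of "(0, b)"]) (auto simp: mult.assoc)
  qed
  show ?thesis unfolding bimat_mult_def *
    by (subst sum_sum_delta[of _ i n]) (use assms in \<open>auto simp: leg1_def leg2_def\<close>)
qed

text \<open>The sparsity of \<open>R\<close> leaves at most two intermediate index pairs on each
  side, and the exponents in \<open>R\<close> leave two pairs of modes. The hypotheses on
  \<open>twist\<close> say that the entry at \<open>i\<close>, \<open>j\<close> is homogeneous of
  parity \<open>|i| + |j|\<close>, which determines all signs.\<close>

lemma RTT_rel_eq:
  assumes idx: "i \<in> idx M N" "j \<in> idx M N" "k \<in> idx M N" "l \<in> idx M N"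
    and tX: "\<And>p i j a. twist M p (X i j a) = ksign (p * (ipar M i + ipar M j)) * X i j a"
    and tY: "\<And>p i j a. twist M p (Y i j a) = ksign (p * (ipar M i + ipar M j)) * Y i j a"
  shows "bimat_mult M N (bimat_mult M N (R_mat M) (leg1 X)) (leg2 Y) i j k l a b
     - bimat_mult M N (bimat_mult M N (leg2 Y) (leg1 X)) (R_mat M) i j k l a b
     = RTT M fscalar X Y i j k l a b"
proof -
  have zero: "R_leg1 M X i m k n c d = 0" if "d \<noteq> 0" "d \<noteq> 1" for m n c d
    using that by (simp add: R_leg1_def)
  have L: "bimat_mult M N (bimat_mult M N (R_mat M) (leg1 X)) (leg2 Y) i j k l a b
     = (\<Sum>m\<in>idx M N. \<Sum>n\<in>idx M N. ksign ((ipar M m + ipar M j) * (ipar M k + ipar M n)) *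
        (twist M (ipar M m + ipar M j + ipar M n + ipar M l) (R_leg1 M X i m k n a 0) * leg2 Y m j n l 0 b
        + twist M (ipar M m + ipar M j + ipar M n + ipar M l) (R_leg1 M X i m k n a 1) * leg2 Y m j n l 0 (b - 1)))"
    (is "_ = (\<Sum>m\<in>_. \<Sum>n\<in>_. ?L m n)")
    unfolding bimat_mult_def[of M N "bimat_mult M N (R_mat M) (leg1 X)"]
  proof (intro sum.cong refl, goal_cases)
    case (1 m n)
    let ?f = "\<lambda>(c, d). ksign ((ipar M m + ipar M j) * (ipar M k + ipar M n)) *
        twist M (ipar M m + ipar M j + ipar M n + ipar M l) (bimat_mult M N (R_mat M) (leg1 X) i m k n c d)
        * leg2 Y m j n l (a - c) (b - d)"
    have "?f z = 0" if "z \<noteq> (a, 0)" "z \<noteq> (a, 1)" for z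
    proof (cases z)
      case (Pair c d)
      have "R_leg1 M X i m k n c d = 0 \<or> leg2 Y m j n l (a - c) (b - d) = 0"
        using that zero[of d m n c] unfolding Pair leg2_def by auto
      then show ?thesis unfolding Pair prod.case bimat_mult_R_leg1[OF idx(1,3) 1(2)] by auto
    qed
    then have *: "Sum_any ?f = ?f (a, 0) + ?f (a, 1)" by (intro Sum_any_2) simp_all
    show ?case
      unfolding * unfolding prod.case bimat_mult_R_leg1[OF idx(1,3) 1(2)] by (simp only: distrib_left[of "ksign c" for c] mult.assoc diff_self diff_0_right)
  qed
  have R: "bimat_mult M N (bimat_mult M N (leg2 Y) (leg1 X)) (R_mat M) i j k l a b
     = (\<Sum>m\<in>idx M N. \<Sum>n\<in>idx M N. ksign ((ipar M m + ipar M j) * (ipar M k + ipar M n)) *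
        (twist M (ipar M m + ipar M j + ipar M n + ipar M l) (Y k n b * X i m (a - 1)) * R_mat M m j n l 1 0
        + twist M (ipar M m + ipar M j + ipar M n + ipar M l) (Y k n (b - 1) * X i m a) * R_mat M m j n l 0 1))"
    (is "_ = (\<Sum>m\<in>_. \<Sum>n\<in>_. ?R m n)")
    unfolding bimat_mult_def[of M N "bimat_mult M N (leg2 Y) (leg1 X)"]
  proof (intro sum.cong refl, goal_cases)
    case (1 m n)
    let ?f = "\<lambda>(c, d). ksign ((ipar M m + ipar M j) * (ipar M k + ipar M n)) *
        twist M (ipar M m + ipar M j + ipar M n + ipar M l) (bimat_mult M N (leg2 Y) (leg1 X) i m k n c d)
        * R_mat M m j n l (a - c) (b - d)"
    have "?f z = 0" if "z \<noteq> (a - 1, b)" "z \<noteq> (a, b - 1)" for z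
    proof (cases z)
      case (Pair c d)
      have "R_mat M m j n l (a - c) (b - d) = 0"
        using that unfolding Pair by (intro R_mat_zero) auto
      then show ?thesis unfolding Pair prod.case by simp
    qed
    then have *: "Sum_any ?f = ?f (a - 1, b) + ?f (a, b - 1)" by (intro Sum_any_2) simp_all
    show ?case
      unfolding * unfolding prod.case bimat_mult_leg2_leg1[OF idx(1) 1(2) tY]
      by (simp only: distrib_left[of "ksign c" for c] mult.assoc diff_self diff_diff_eq2 add_diff_cancel_left')
  qed
  have fsX: "x * (fscalar c * y) = fscalar c * (x * y)" for c and x y :: qfree
    by (metis fscalar_comm mult.assoc)
  have L': "(\<Sum>m\<in>idx M N. \<Sum>n\<in>idx M N. ?L m n) = (if i = k then ?L j k else ?L j k + ?L j i)"
  proof -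
    have z: "?L m n = 0" if "(m, n) \<noteq> (j, k)" "(m, n) \<noteq> (j, i)" for m n
    proof (cases "m = j")
      case True
      then have "R_leg1 M X i m k n a d = 0" for d
        using that by (auto simp: R_leg1_def)
      then show ?thesis by simp
    qed (simp add: leg2_def)
    show ?thesis
    proof (cases "i = k")
      case True
      have "(\<Sum>m\<in>idx M N. \<Sum>n\<in>idx M N. ?L m n) = ?L j k"
        by (rule sum_sum_delta) (use idx True z in \<open>simp_all only: finite_idx not_False_eq_True\<close>)
      then show ?thesis using True by simp
    next
      case False
      have "(\<Sum>m\<in>idx M N. \<Sum>n\<in>idx M N. ?L m n) = ?L j k + ?L j i"
        by (rule sum_sum_delta2) (use idx False z in \<open>auto simp only: finite_idx\<close>)
      then show ?thesis using False by simp
    qed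
  qed
  have R': "(\<Sum>m\<in>idx M N. \<Sum>n\<in>idx M N. ?R m n) = (if j = l then ?R j l else ?R j l + ?R l j)"
  proof -
    have z: "?R m n = 0" if "(m, n) \<noteq> (j, l)" "(m, n) \<noteq> (l, j)" for m n
    proof -
      have "R_mat M m j n l c d = 0" for c d
        using R_mat_zero_idx[of j l m n] that by (auto simp: R_mat_def fs.h_zero)
      then show ?thesis by simp
    qed
    show ?thesis
    proof (cases "j = l")
      case True
      have "(\<Sum>m\<in>idx M N. \<Sum>n\<in>idx M N. ?R m n) = ?R j l"
        by (rule sum_sum_delta) (use idx True z in \<open>simp_all only: finite_idx not_False_eq_True\<close>)
      then show ?thesis using True by simp
    next
      case False
      have "(\<Sum>m\<in>idx M N. \<Sum>n\<in>idx M N. ?R m n) = ?R j l + ?R l j"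
        by (rule sum_sum_delta2) (use idx False z in \<open>auto simp only: finite_idx\<close>)
      then show ?thesis using False by simp
    qed
  qed
  have dbl: "x + x = 0" for x :: bit
    by (cases x) simp_all
  have par1: "ipar M l + ipar M j + ipar M j + ipar M l = 0"
    by (cases "ipar M l"; cases "ipar M j"; simp)
  have tw: "twist M p (fscalar c * X i' j' a') = ksign (p * (ipar M i' + ipar M j')) * (fscalar c * X i' j' a')"
    for p c i' j' a'
    unfolding twist_fscalar_mult tX by (simp only: fsX)
  have tw': "twist M p (- fscalar c * X i' j' a') = - (ksign (p * (ipar M i' + ipar M j')) * (fscalar c * X i' j' a'))"
    for p c i' j' a'
    using tw[of p c i' j' a'] by (simp only: minus_mult_left[symmetric] twist_uminus)
  have com: "(ipar M k + ipar M l) * (ipar M i + ipar M j) = (ipar M i + ipar M j) * (ipar M k + ipar M l)"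
    by (rule mult.commute)
  have eL: "?L j k = ksign ((ipar M i + ipar M j) * (ipar M k + ipar M l)) *
      (fscalar (if i = k then qi M i else 1) * (X i j (a - 1) * Y k l b)
       - fscalar (if i = k then inverse (qi M i) else 1) * (X i j a * Y k l (b - 1)))"
  proof -
    have 1: "R_leg1 M X i j k k a 0 = fscalar (if i = k then qi M i else 1) * X i j (a - 1)"
      "R_leg1 M X i j k k a 1 = - fscalar (if i = k then inverse (qi M i) else 1) * X i j a"
      by (auto simp: R_leg1_def)
    show ?thesis
      unfolding 1 tw tw' leg2_def dbl add_0_left com
      by (simp only: refl simp_thms if_True mult_zero_left ksign_simps mult_1_left mult_minus_left
          diff_conv_add_uminus mult.assoc distrib_left[of "ksign c" for c] mult_minus_right)
  qed
  have eL2: "?L j i = ksign ((ipar M k + ipar M j) * (ipar M k + ipar M l)) *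
        (fscalar (qc M k) * (if k < i then X k j (a - 1) * Y i l b else X k j a * Y i l (b - 1)))"
    if "i \<noteq> k"
  proof -
    have 1: "R_leg1 M X i j k i a 0 = ksign ((ipar M k + ipar M j) * (ipar M k + ipar M i)) *
        (if k < i then fscalar (qc M k) * X k j (a - 1) else 0)"
      "R_leg1 M X i j k i a 1 = ksign ((ipar M k + ipar M j) * (ipar M k + ipar M i)) *
        (if k < i then 0 else fscalar (qc M k) * X k j a)"
      using that by (auto simp: R_leg1_def)
    have sg: "ksign ((ipar M k + ipar M j) * (ipar M k + ipar M i)) * (ksign ((ipar M i + ipar M l) * (ipar M k + ipar M j)) * x)
      = ksign ((ipar M k + ipar M j) * (ipar M k + ipar M l)) * x" for x :: qfree
      by (cases "ipar M i"; cases "ipar M j"; cases "ipar M k"; cases "ipar M l"; simp)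
    show ?thesis
    proof (cases "k < i")
      case True
      show ?thesis unfolding 1 twist_ksign_mult leg2_def dbl add_0_left if_P[OF True]
        by (simp only: refl simp_thms if_True if_False mult_zero_left mult_zero_right ksign_simps
            mult_1_left twist_0 add_0_left add_0_right mult.assoc sg tw)
    next
      case False
      show ?thesis unfolding 1 twist_ksign_mult leg2_def dbl add_0_left if_not_P[OF False]
        by (simp only: refl simp_thms if_True if_False mult_zero_left mult_zero_right ksign_simps
            mult_1_left twist_0 add_0_left add_0_right mult.assoc sg tw)
    qed
  qed
  have eR: "?R j l = fscalar (if j = l then qi M j else 1) * (Y k l b * X i j (a - 1))
       - fscalar (if j = l then inverse (qi M j) else 1) * (Y k l (b - 1) * X i j a)"
    unfolding R_mat_eval dbl by (simp only: fscalar_comm dbl add_0_left twist_0 mult_zero_left ksign_simps mult_1_left mult_minus_right diff_conv_add_uminus)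
  have eR2: "?R l j = ksign ((ipar M l + ipar M j) * (ipar M k + ipar M j)) *
        (fscalar (qc M j) * (if j < l then Y k j b * X i l (a - 1) else Y k j (b - 1) * X i l a))"
    if "j \<noteq> l"
  proof -
    have jl: "l \<noteq> j" using that by simp
    show ?thesis
      unfolding R_mat_eval(3,4)[OF jl] par1 using that
      by (simp add: fscalar_comm)
  qed
  have S1: "(if i = k then ?L j k else ?L j k + ?L j i) = ?L j k + (if i = k then 0 else ?L j i)"
    and S2: "(if j = l then ?R j l else ?R j l + ?R l j) = ?R j l + (if j = l then 0 else ?R l j)"
    by (simp_all only: if_distrib[of "\<lambda>x. _ + x"] add_0_right)
  have S: "(if i = k then 0 else ?L j i) = (if i = k then 0 else
        ksign ((ipar M k + ipar M j) * (ipar M k + ipar M l)) *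
        (fscalar (qc M k) * (if k < i then X k j (a - 1) * Y i l b else X k j a * Y i l (b - 1))))"
    "(if j = l then 0 else ?R l j) = (if j = l then 0 else
        ksign ((ipar M l + ipar M j) * (ipar M k + ipar M j)) *
        (fscalar (qc M j) * (if j < l then Y k j b * X i l (a - 1) else Y k j (b - 1) * X i l a)))"
    by (rule if_cong[OF refl refl eL2], assumption) (rule if_cong[OF refl refl eR2], assumption)
  show ?thesis
    unfolding L R L' R' unfolding S1 S2 unfolding S unfolding eL eR RTT_def by (rule diff_diff_eq[symmetric])
qed

lemmas free_closed = presentation.carrier_closed[OF presentation.intro[OF empty_subsetI]]

lemma ksign_carrier: "x \<in> carrier (free_superalgebra G par) \<Longrightarrow> ksign p * x \<in> carrier (free_superalgebra G par)"
  by (cases p) (simp_all add: free_closed)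

lemma if_in: "x \<in> S \<Longrightarrow> y \<in> S \<Longrightarrow> (if c then x else y) \<in> S"
  by simp

lemma RTT_carrier:
  fixes X :: "nat \<Rightarrow> nat \<Rightarrow> int \<Rightarrow> (ratfun, 'g) free_alg"
  assumes "\<And>i j a. i \<in> idx M N \<Longrightarrow> j \<in> idx M N \<Longrightarrow> X i j a \<in> carrier (free_superalgebra G par)"
    "\<And>i j a. i \<in> idx M N \<Longrightarrow> j \<in> idx M N \<Longrightarrow> Y i j a \<in> carrier (free_superalgebra G par)"
    "i \<in> idx M N" "j \<in> idx M N" "k \<in> idx M N" "l \<in> idx M N"
  shows "RTT M fscalar X Y i j k l a b \<in> carrier (free_superalgebra G par)"
  unfolding RTT_def by (intro free_closed(1,3,5-7) ksign_carrier if_in assms)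

lemma twist_T_series:
  "twist M p (T_series i j a) = ksign (p * (ipar M i + ipar M j)) * T_series i j a"
  "twist M p (Tt_series i j a) = ksign (p * (ipar M i + ipar M j)) * Tt_series i j a"
  by (simp_all add: T_series_def Tt_series_def twist_fgen)

lemma qloop_rels_eq:
  "qloop_rels M N =
    {fgen (QT j i 0) | i j. i \<in> idx M N \<and> j \<in> idx M N \<and> i < j} \<union>
    {fgen (QTt i j 0) | i j. i \<in> idx M N \<and> j \<in> idx M N \<and> i < j} \<union>
    {fgen (QT i i 0) * fgen (QTt i i 0) - 1 | i. i \<in> idx M N} \<union>
    {fgen (QTt i i 0) * fgen (QT i i 0) - 1 | i. i \<in> idx M N} \<union>
    {RTT M fscalar X Y i j k l a b | X Y i j k l a b.
      (X, Y) \<in> {(T_series, T_series), (Tt_series, Tt_series), (Tt_series, T_series)} \<and>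
      i \<in> idx M N \<and> j \<in> idx M N \<and> k \<in> idx M N \<and> l \<in> idx M N}"
proof -
  have *: "RTT_rels M N X Y = {RTT M fscalar X Y i j k l a b | i j k l a b.
      i \<in> idx M N \<and> j \<in> idx M N \<and> k \<in> idx M N \<and> l \<in> idx M N}"
    if "(X, Y) \<in> {(T_series, T_series), (Tt_series, Tt_series), (Tt_series, T_series)}" for X Y
  proof -
    have tw: "twist M p (X i j a) = ksign (p * (ipar M i + ipar M j)) * X i j a"
      "twist M p (Y i j a) = ksign (p * (ipar M i + ipar M j)) * Y i j a" for p i j a
      using that twist_T_series by auto
    show ?thesis
      unfolding RTT_rels_def
      by (intro Collect_cong ex_cong1 rev_conj_cong[OF refl]; elim conjE)
        (subst RTT_rel_eq[OF _ _ _ _ tw], assumption+, rule refl)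
  qed
  show ?thesis
    unfolding qloop_rels_def by (simp only: * insertI1 insertI2) blast
qed

lemma qloop_rels_carrier: "qloop_rels M N \<subseteq> carrier (free_superalgebra (qloop_gens M N) (qloop_par M))"
  by (auto simp: qloop_rels_eq T_series_def Tt_series_def qloop_gens_def intro!: free_closed RTT_carrier)

lemma loop_gens_iff [simp]: "LE i j r \<in> loop_gens M N \<longleftrightarrow> i \<in> idx M N \<and> j \<in> idx M N"
  by (simp add: loop_gens_def)

lemma qloop_gens_iff [simp]:
  "QT i j r \<in> qloop_gens M N \<longleftrightarrow> i \<in> idx M N \<and> j \<in> idx M N"
  "QTt i j r \<in> qloop_gens M N \<longleftrightarrow> i \<in> idx M N \<and> j \<in> idx M N"
  by (simp_all add: qloop_gens_def)

lemma loop_rels_carrier: "loop_rels M N \<subseteq> carrier (free_superalgebra (loop_gens M N) (loop_par M))"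
proof
  fix x assume "x \<in> loop_rels M N"
  then obtain i j r k l s where x: "x = loop_rel M i j r k l s"
    and idx: "i \<in> idx M N" "j \<in> idx M N" "k \<in> idx M N" "l \<in> idx M N"
    by (auto simp: loop_rels_def)
  show "x \<in> carrier (free_superalgebra (loop_gens M N) (loop_par M))"
    unfolding x loop_rel_def Let_def mult.assoc
    by (intro free_closed(1,4-7) ksign_carrier if_in) (simp_all add: idx)
qed

section \<open>The localization at \<open>q = 1\<close>\<close>

text \<open>The residue map of \<open>A_loc\<close> at \<open>q = 1\<close>. By
  \<open>evq_eq\<close> the value does not depend on the fraction chosen; outside
  \<open>A_loc\<close> it carries no meaning.\<close>

definition evq :: "ratfun \<Rightarrow> complex"
  where "evq c = (SOME v. \<exists>f g. poly g 1 \<noteq> 0 \<and> c = to_fract f / to_fract g \<and> v = poly f 1 / poly g 1)"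

lemma evq_eq:
  assumes "poly g 1 \<noteq> 0"
  shows "evq (to_fract f / to_fract g) = poly f 1 / poly g 1"
proof -
  let ?P = "\<lambda>v. \<exists>f' g'. poly g' 1 \<noteq> 0 \<and> to_fract f / to_fract g = to_fract f' / to_fract g' \<and> v = poly f' 1 / poly g' 1"
  have "v = poly f 1 / poly g 1" if "?P v" for v
  proof -
    obtain f' g' where *: "poly g' 1 \<noteq> 0" "to_fract f / to_fract g = to_fract f' / to_fract g'"
      "v = poly f' 1 / poly g' 1" using \<open>?P v\<close> by blast
    have "g \<noteq> 0" "g' \<noteq> 0" using assms *(1) by auto
    then have "to_fract (f * g') = to_fract (f' * g)"
      using *(2) by (simp add: field_simps)
    then have "poly (f * g') 1 = poly (f' * g) 1" by (simp only: to_fract_eq_iff)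
    then have "poly f 1 / poly g 1 = poly f' 1 / poly g' 1"
      using assms *(1) by (simp add: frac_eq_eq)
    then show ?thesis using *(3) by simp
  qed
  moreover have "?P (poly f 1 / poly g 1)"
    by (intro exI[of _ f] exI[of _ g] conjI assms refl)
  ultimately show ?thesis unfolding evq_def by (intro some_equality)
qed

lemma A_locE:
  assumes "c \<in> A_loc"
  obtains f g where "poly g 1 \<noteq> 0" "g \<noteq> 0" "c = to_fract f / to_fract g" "evq c = poly f 1 / poly g 1"
proof -
  obtain f g where "poly g 1 \<noteq> 0" "c = to_fract f / to_fract g"
    using assms by (auto simp: A_loc_def)
  moreover from this(1) have "g \<noteq> 0" by auto
  ultimately show ?thesis using that[of g f] evq_eq[of g f] by simp
qed

lemma A_locI: "poly g 1 \<noteq> 0 \<Longrightarrow> to_fract f / to_fract g \<in> A_loc"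
  by (auto simp: A_loc_def)

lemma evq_add:
  assumes "c \<in> A_loc" "d \<in> A_loc"
  shows "c + d \<in> A_loc" "evq (c + d) = evq c + evq d"
proof -
  obtain f g f' g' where *: "poly g 1 \<noteq> 0" "g \<noteq> 0" "c = to_fract f / to_fract g" "evq c = poly f 1 / poly g 1"
    "poly g' 1 \<noteq> 0" "g' \<noteq> 0" "d = to_fract f' / to_fract g'" "evq d = poly f' 1 / poly g' 1"
    using A_locE[OF assms(1)] A_locE[OF assms(2)] by metis
  have e: "c + d = to_fract (f * g' + f' * g) / to_fract (g * g')"
    using * by (simp add: field_simps)
  show "c + d \<in> A_loc" unfolding e by (rule A_locI) (use * in simp)
  show "evq (c + d) = evq c + evq d" unfolding e by (subst evq_eq) (use * in \<open>simp_all add: field_simps\<close>)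
qed

lemma evq_mult:
  assumes "c \<in> A_loc" "d \<in> A_loc"
  shows "c * d \<in> A_loc" "evq (c * d) = evq c * evq d"
proof -
  obtain f g f' g' where *: "poly g 1 \<noteq> 0" "g \<noteq> 0" "c = to_fract f / to_fract g" "evq c = poly f 1 / poly g 1"
    "poly g' 1 \<noteq> 0" "g' \<noteq> 0" "d = to_fract f' / to_fract g'" "evq d = poly f' 1 / poly g' 1"
    using A_locE[OF assms(1)] A_locE[OF assms(2)] by metis
  have e: "c * d = to_fract (f * f') / to_fract (g * g')"
    unfolding *(3,7) by (simp add: times_divide_times_eq)
  show "c * d \<in> A_loc" unfolding e by (rule A_locI) (use * in simp)
  show "evq (c * d) = evq c * evq d"
    unfolding e *(4,8) by (subst evq_eq) (use *(1,5) in \<open>simp_all add: times_divide_times_eq\<close>)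
qed

lemma evq_inverse:
  assumes "c \<in> A_loc" "evq c \<noteq> 0"
  shows "inverse c \<in> A_loc" "evq (inverse c) = inverse (evq c)"
proof -
  obtain f g where *: "poly g 1 \<noteq> 0" "g \<noteq> 0" "c = to_fract f / to_fract g" "evq c = poly f 1 / poly g 1"
    using A_locE[OF assms(1)] .
  have e: "inverse c = to_fract g / to_fract f" and f: "poly f 1 \<noteq> 0"
    using * assms(2) by simp_all
  show "inverse c \<in> A_loc" unfolding e by (rule A_locI) (rule f)
  show "evq (inverse c) = inverse (evq c)" unfolding e by (subst evq_eq) (use * f in simp_all)
qed

lemma evq_poly: "to_fract f \<in> A_loc" "evq (to_fract f) = poly f 1"
  using A_locI[of 1 f] evq_eq[of 1 f] by simp_all

lemma evq_const: "to_fract [:c:] \<in> A_loc" "evq (to_fract [:c:]) = c"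
  using evq_poly[of "[:c:]"] by simp_all

lemma evq_basic: "0 \<in> A_loc" "1 \<in> A_loc" "evq 0 = 0" "evq 1 = 1" "qvar \<in> A_loc" "evq qvar = 1"
  using evq_poly[of 0] evq_poly[of 1] evq_poly[of "[:0, 1:]"] by (simp_all add: qvar_def)

lemma evq_uminus: 
  assumes "c \<in> A_loc" shows "- c \<in> A_loc" "evq (- c) = - evq c"
  using evq_mult[OF evq_poly(1)[of "- 1"] assms] evq_poly(2)[of "- 1"] by simp_all

lemma evq_diff: 
  assumes "c \<in> A_loc" "d \<in> A_loc" shows "c - d \<in> A_loc" "evq (c - d) = evq c - evq d"
  using evq_add[OF assms(1) evq_uminus(1)[OF assms(2)]] evq_uminus(2)[OF assms(2)] by simp_all

definition eps :: ratfun
  where "eps = qvar - 1"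

lemma qvar_nz: "qvar \<noteq> 0"
  by (simp add: qvar_def)

lemma eps_nz: "eps \<noteq> 0"
proof
  assume "eps = 0"
  then have "to_fract [:0, 1:] = to_fract (1 :: complex poly)"
    by (simp add: eps_def qvar_def)
  then show False by (simp only: to_fract_eq_iff) (simp add: one_pCons)
qed

lemma evq_eps: "eps \<in> A_loc" "evq eps = 0"
  using evq_diff[of qvar 1] by (simp_all add: eps_def evq_basic)

text \<open>The numerator minus the value times the denominator vanishes at 1, hence is divisible by
  \<open>q - 1\<close>. This replaces scalars in \<open>A_loc\<close> by complex constants modulo
  \<open>q - 1\<close>.\<close>

lemma evq_split:
  assumes "c \<in> A_loc"
  obtains d where "d \<in> A_loc" "c = to_fract [:evq c:] + eps * d"
proof -
  obtain f g where *: "poly g 1 \<noteq> 0" "g \<noteq> 0" "c = to_fract f / to_fract g" "evq c = poly f 1 / poly g 1"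
    using A_locE[OF assms] .
  have "poly (f - [:evq c:] * g) 1 = 0" using * by simp
  then obtain h where h: "f - [:evq c:] * g = [:- 1, 1:] * h"
    using poly_eq_0_iff_dvd by blast
  have "to_fract [:- 1, 1:] = eps"
  proof -
    have "[:- 1, 1:] = [:0, 1:] - (1 :: complex poly)" by (simp add: one_pCons)
    then show ?thesis by (simp only: eps_def qvar_def to_fract_diff to_fract_1)
  qed
  then have **: "to_fract f - to_fract [:evq c:] * to_fract g = eps * to_fract h"
    using arg_cong[OF h, of to_fract] by (simp only: to_fract_diff to_fract_mult)
  have "to_fract f / to_fract g = to_fract [:evq c:] + eps * (to_fract h / to_fract g)"
  proof -
    have "x / z = v + e * (y / z)" if "x - v * z = e * y" "z \<noteq> 0" for x v z e y :: ratfun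
      using that by (simp add: field_simps)
    from this[OF **] show ?thesis using *(2) by simp
  qed
  then have "c = to_fract [:evq c:] + eps * (to_fract h / to_fract g)"
    unfolding *(3)[symmetric] .
  then show ?thesis using that A_locI[OF *(1)] by blast
qed

text \<open>\<open>(q - q\<^sup>-\<^sup>1) / (q - 1)\<close>\<close>

definition eta :: ratfun
  where "eta = 1 + inverse qvar"

lemma evq_inverse_qvar: "inverse qvar \<in> A_loc" "evq (inverse qvar) = 1"
  using evq_inverse[of qvar] by (simp_all add: evq_basic)

lemma evq_eta: "eta \<in> A_loc" "evq eta = 2" "inverse eta \<in> A_loc" "evq (inverse eta) = 1 / 2" "eta \<noteq> 0"
proof -
  show 1: "eta \<in> A_loc" "evq eta = 2"
    using evq_add[of 1 "inverse qvar"] by (simp_all add: eta_def evq_basic evq_inverse_qvar)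
  show "inverse eta \<in> A_loc" "evq (inverse eta) = 1 / 2" "eta \<noteq> 0"
    using evq_inverse[of eta] 1 evq_basic(3) by auto
qed

lemma q_minus: "qvar - inverse qvar = eps * eta"
  using qvar_nz by (simp add: eps_def eta_def field_simps)

text \<open>\<open>qx\<close> and \<open>qy\<close> are the quotients of
  \<open>q\<^sub>i - 1\<close> and of \<open>1/q\<^sub>i - 1\<close> by \<open>q - 1\<close>,
  written so that they are visibly regular at \<open>q = 1\<close>.\<close>

definition qx :: "nat \<Rightarrow> nat \<Rightarrow> ratfun"
  where "qx M i = (if ipar M i = 0 then 1 else - inverse qvar)"
definition qy :: "nat \<Rightarrow> nat \<Rightarrow> ratfun"
  where "qy M i = (if ipar M i = 0 then - inverse qvar else 1)"

lemma qi_split: "qi M i = 1 + eps * qx M i" "inverse (qi M i) = 1 + eps * qy M i"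
    "qc M i = eps * (ksign (ipar M i) * eta)"
  using qvar_nz q_minus
  by (auto simp: qi_def qx_def qy_def qc_def ksign_def eps_def field_simps)

lemma evq_qxy: "qx M i \<in> A_loc" "evq (qx M i) = ksign (ipar M i)"
    "qy M i \<in> A_loc" "evq (qy M i) = - ksign (ipar M i)"
  using evq_uminus[of "inverse qvar"]
  by (auto simp: qx_def qy_def ksign_def evq_basic evq_inverse_qvar)

lemma evq_ksign: "ksign p \<in> A_loc" "evq (ksign p) = ksign p"
  using evq_uminus[of 1] by (cases p; simp add: evq_basic)+

section \<open>The lattice and its specialization\<close>

locale qloop =
  fixes M N :: nat
begin

sublocale presentation "qloop_gens M N" "qloop_par M" "qloop_rels M N"
  by standard (rule qloop_rels_carrier)

lemma Uq: "Uq_loop M N = P"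
  by (rule Uq_loop_def)

definition gam :: "nat \<Rightarrow> nat \<Rightarrow> nat \<Rightarrow> qfree"
  where "gam i j r = (if i = j \<and> r = 0 then fscalar (inverse eps) * (fgen (QT i i 0) - 1)
    else fscalar (inverse (eps * eta)) * fgen (QT i j r))"

definition gamt :: "nat \<Rightarrow> nat \<Rightarrow> nat \<Rightarrow> qfree"
  where "gamt i j r = (if i = j \<and> r = 0 then fscalar (inverse eps) * (fgen (QTt i i 0) - 1)
    else fscalar (inverse (eps * eta)) * fgen (QTt i j r))"

lemma gam_carrier:
  assumes "i \<in> idx M N" "j \<in> idx M N"
  shows "gam i j r \<in> carrier F" "gamt i j r \<in> carrier F"
  unfolding gam_def gamt_def using assms by (intro if_in carrier_closed; simp)+

lemma gamma_cls:
  assumes "i \<in> idx M N" "j \<in> idx M N"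
  shows "gamma M N i j r = cls (gam i j r)" "gammat M N i j r = cls (gamt i j r)"
  unfolding gamma_def gammat_def gam_def gamt_def T_el_def Tt_el_def presented_gen_def Uq
    q_minus eps_def[symmetric]
  using assms by (simp_all add: P_simps(4) a_minus_P P_smult carrier_closed)

text \<open>The preimage of \<open>U_A\<close> in the free algebra; computing there avoids nested
  cosets.\<close>

definition lat :: "qfree set"
  where "lat = {x \<in> carrier F. cls x \<in> carrier (U_A M N)}"

lemma lat_carrier: "x \<in> lat \<Longrightarrow> x \<in> carrier F"
  by (simp add: lat_def)

abbreviation gens where "gens \<equiv>
  {gamma M N i j r | i j r. i \<in> idx M N \<and> j \<in> idx M N} \<union>
  {gammat M N i j r | i j r. i \<in> idx M N \<and> j \<in> idx M N}"

lemma U_A_simps: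
  "carrier (U_A M N) = gen_subalgebra P A_loc gens" "mult (U_A M N) = mult P"
  "add (U_A M N) = add P" "one (U_A M N) = one P" "zero (U_A M N) = zero P"
  "smult (U_A M N) = smult P" "homog (U_A M N) p = homog P p \<inter> gen_subalgebra P A_loc gens"
  by (simp_all add: U_A_def sub_superalgebra_def Uq)

lemma lat_closed:
  "1 \<in> lat" "i \<in> idx M N \<Longrightarrow> j \<in> idx M N \<Longrightarrow> gam i j r \<in> lat"
  "i \<in> idx M N \<Longrightarrow> j \<in> idx M N \<Longrightarrow> gamt i j r \<in> lat"
  "x \<in> lat \<Longrightarrow> y \<in> lat \<Longrightarrow> x + y \<in> lat" "x \<in> lat \<Longrightarrow> y \<in> lat \<Longrightarrow> x * y \<in> lat"
  "c \<in> A_loc \<Longrightarrow> x \<in> lat \<Longrightarrow> fscalar c * x \<in> lat"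
proof -
  let ?U = "gen_subalgebra P A_loc gens"
  show "1 \<in> lat"
    using gen_subalgebra.one[of P A_loc gens] by (simp add: lat_def U_A_simps P_simps carrier_closed)
  show "gam i j r \<in> lat" if "i \<in> idx M N" "j \<in> idx M N"
  proof -
    have "gamma M N i j r \<in> ?U" by (rule gen_subalgebra.gen) (use that in blast)
    then show ?thesis using that by (simp add: lat_def U_A_simps gamma_cls gam_carrier)
  qed
  show "gamt i j r \<in> lat" if "i \<in> idx M N" "j \<in> idx M N"
  proof -
    have "gammat M N i j r \<in> ?U" by (rule gen_subalgebra.gen) (use that in blast)
    then show ?thesis using that by (simp add: lat_def U_A_simps gamma_cls gam_carrier)
  qed
  show "x + y \<in> lat" "x * y \<in> lat" if "x \<in> lat" "y \<in> lat"
    using that gen_subalgebra.add[of "cls x" P A_loc gens "cls y"]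
      gen_subalgebra.mult[of "cls x" P A_loc gens "cls y"]
    by (simp_all add: lat_def U_A_simps P_simps carrier_closed)
  show "fscalar c * x \<in> lat" if "c \<in> A_loc" "x \<in> lat"
    using that gen_subalgebra.smult[of c A_loc "cls x" P gens]
    by (simp_all add: lat_def U_A_simps P_smult carrier_closed)
qed

lemma J_lat: "x \<in> J \<Longrightarrow> x \<in> lat"
proof -
  assume x: "x \<in> J"
  have "fscalar 0 * 1 \<in> lat" by (rule lat_closed(6)[OF evq_basic(1) lat_closed(1)])
  moreover have "cls x = cls 0"
    using x by (simp add: cls_eq J_carrier carrier_closed)
  ultimately show "x \<in> lat" using x by (simp add: lat_def fs.h_zero J_carrier)
qed

lemma lat_uminus: "x \<in> lat \<Longrightarrow> - x \<in> lat"
  using lat_closed(6)[of "- 1" x] evq_uminus(1)[OF evq_basic(2)] by (simp add: fs.h_minus fscalar_one)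

lemma lat_diff: "x \<in> lat \<Longrightarrow> y \<in> lat \<Longrightarrow> x - y \<in> lat"
  using lat_closed(4)[of x "- y"] lat_uminus by simp

lemma lat_zero: "0 \<in> lat"
  by (rule J_lat) (rule J_zero)

lemma lat_fscalar: "c \<in> A_loc \<Longrightarrow> fscalar c \<in> lat"
  using lat_closed(6)[OF _ lat_closed(1), of c] by simp

text \<open>The generated subalgebra consists of classes, and each step of its construction reaches
  only some representative. The case \<open>ideal\<close> passes from that one to the given
  \<open>x\<close>.\<close>

lemma lat_induct [consumes 1, case_names ideal one gam gamt add mult smult]:
  assumes "x \<in> lat" and ideal: "\<And>x y. x \<in> lat \<Longrightarrow> Q x \<Longrightarrow> y \<in> J \<Longrightarrow> Q (x + y)"
    and one: "Q 1" and gam: "\<And>i j r. i \<in> idx M N \<Longrightarrow> j \<in> idx M N \<Longrightarrow> Q (gam i j r)"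
    and gamt: "\<And>i j r. i \<in> idx M N \<Longrightarrow> j \<in> idx M N \<Longrightarrow> Q (gamt i j r)"
    and add: "\<And>x y. x \<in> lat \<Longrightarrow> y \<in> lat \<Longrightarrow> Q x \<Longrightarrow> Q y \<Longrightarrow> Q (x + y)"
    and mult: "\<And>x y. x \<in> lat \<Longrightarrow> y \<in> lat \<Longrightarrow> Q x \<Longrightarrow> Q y \<Longrightarrow> Q (x * y)"
    and smult: "\<And>c x. c \<in> A_loc \<Longrightarrow> x \<in> lat \<Longrightarrow> Q x \<Longrightarrow> Q (fscalar c * x)"
  shows "Q x"
proof -
  have "\<exists>y\<in>lat. cls y = X \<and> Q y" if "X \<in> gen_subalgebra P A_loc gens" for X
    using that
  proof induction
    case one
    show ?case using assms(3) lat_closed(1) by (auto simp: P_simps)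
  next
    case (gen X)
    then consider i j r where "X = gamma M N i j r" "i \<in> idx M N" "j \<in> idx M N"
      | i j r where "X = gammat M N i j r" "i \<in> idx M N" "j \<in> idx M N" by blast
    then show ?case
    proof cases
      case 1
      then show ?thesis using gamma_cls(1) gam lat_closed(2) by blast
    next
      case 2
      then show ?thesis using gamma_cls(2) gamt lat_closed(3) by blast
    qed
  next
    case (add X Y)
    then obtain x y where "x \<in> lat" "y \<in> lat" "cls x = X" "cls y = Y" "Q x" "Q y" by blast
    then show ?case
      using assms(6)[of x y] lat_closed(4)[of x y] P_simps(3)[of x y] lat_carrier by blast
  next
    case (mult X Y)
    then obtain x y where "x \<in> lat" "y \<in> lat" "cls x = X" "cls y = Y" "Q x" "Q y" by blast
    then show ?case
      using assms(7)[of x y] lat_closed(5)[of x y] P_simps(2)[of x y] lat_carrier by blast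
  next
    case (smult c X)
    then obtain x where "x \<in> lat" "cls x = X" "Q x" by blast
    then show ?case
      using assms(8)[of c x] lat_closed(6)[of c x] P_smult[of x c] lat_carrier smult by blast
  qed
  then obtain y where y: "y \<in> lat" "cls y = cls x" "Q y"
    using assms(1) by (auto simp: lat_def U_A_simps)
  then have "x - y \<in> J" using assms(1) by (simp add: cls_eq[symmetric] lat_carrier)
  from ideal[OF y(1,3) this] show ?thesis by simp
qed

text \<open>The preimage of \<open>(q - 1) U_A\<close>, with equality up to the relation ideal built
  in.\<close>

definition latI :: "qfree set"
  where "latI = {x \<in> lat. \<exists>y\<in>lat. x - fscalar eps * y \<in> J}"

lemma carrier_U_A: "carrier (U_A M N) = cls ` lat"
proof -
  have "\<exists>x\<in>carrier F. X = cls x" if "X \<in> gen_subalgebra P A_loc gens" for X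
    using that
  proof induction
    case one
    then show ?case using carrier_closed by (auto simp: P_simps)
  next
    case (gen X)
    then show ?case using gamma_cls gam_carrier by blast
  next
    case (add X Y)
    then show ?case using P_simps(3) carrier_closed(5) by blast
  next
    case (mult X Y)
    then show ?case using P_simps(2) carrier_closed(7) by blast
  next
    case (smult c X)
    then show ?case using P_smult carrier_closed(3,7) by blast
  qed
  then show ?thesis by (auto simp: lat_def U_A_simps)
qed

lemma ring_U_A: "ring (U_A M N)"
proof -
  interpret P: ring P by (rule ring_P)
  have "subring (carrier (U_A M N)) P"
    by (rule P.subringI)
      (auto simp: carrier_U_A P_simps a_inv_P lat_carrier lat_closed lat_uminus)
  from P.subring_is_ring[OF this] show ?thesis
    by (rule ring_cong) (simp_all add: U_A_simps)
qed

lemma q1_ideal_eq: "q1_ideal M N = cls ` latI"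
proof -
  have "q1_ideal M N = (\<lambda>y. cls (fscalar eps * y)) ` lat"
    unfolding q1_ideal_def carrier_U_A image_image U_A_simps eps_def[symmetric]
    by (rule image_cong) (simp_all add: P_smult lat_carrier)
  also have "\<dots> = cls ` latI"
  proof (intro equalityI subsetI)
    fix X assume "X \<in> (\<lambda>y. cls (fscalar eps * y)) ` lat"
    then obtain y where y: "y \<in> lat" "X = cls (fscalar eps * y)" by blast
    then have "fscalar eps * y \<in> latI"
      unfolding latI_def using lat_closed(6)[OF evq_eps(1) y(1)] J_zero by (auto intro!: bexI[of _ y])
    then show "X \<in> cls ` latI" using y by blast
  next
    fix X assume "X \<in> cls ` latI"
    then obtain x y where "x \<in> lat" "y \<in> lat" "x - fscalar eps * y \<in> J" "X = cls x"
      by (auto simp: latI_def)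
    then have "X = cls (fscalar eps * y)" using lat_carrier carrier_closed by (simp add: cls_eq)
    then show "X \<in> (\<lambda>y. cls (fscalar eps * y)) ` lat" using \<open>y \<in> lat\<close> by blast
  qed
  finally show ?thesis .
qed

lemma J_latI: "x \<in> J \<Longrightarrow> x \<in> latI"
  using J_lat lat_zero by (auto simp: latI_def intro!: bexI[of _ 0])

lemma latI_lat: "x \<in> latI \<Longrightarrow> x \<in> lat"
  by (simp add: latI_def)

lemma latI_eps: "x \<in> lat \<Longrightarrow> fscalar eps * x \<in> latI"
  using lat_closed(6)[OF evq_eps(1)] J_zero by (auto simp: latI_def intro!: bexI[of _ x])

lemma latI_add:
  assumes "x \<in> latI" "y \<in> latI" shows "x + y \<in> latI"
proof -
  obtain x' y' where *: "x' \<in> lat" "x - fscalar eps * x' \<in> J" "y' \<in> lat" "y - fscalar eps * y' \<in> J"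
    using assms by (auto simp: latI_def)
  have "(x + y) - fscalar eps * (x' + y') \<in> J"
    using J_add[OF *(2,4)] by (simp add: distrib_left add_diff_add)
  then show ?thesis using assms * lat_closed(4) latI_lat unfolding latI_def by blast
qed

lemma latI_lmult:
  assumes "x \<in> latI" "y \<in> lat" shows "y * x \<in> latI"
proof -
  obtain x' where *: "x' \<in> lat" "x - fscalar eps * x' \<in> J"
    using assms by (auto simp: latI_def)
  have "y * (fscalar eps * x') = fscalar eps * (y * x')"
    by (metis fscalar_comm mult.assoc)
  then have "y * x - fscalar eps * (y * x') \<in> J"
    using J_lmult[OF *(2) lat_carrier[OF assms(2)]] by (simp add: right_diff_distrib)
  then show ?thesis using assms * lat_closed(5) latI_lat unfolding latI_def by blast
qed

lemma latI_rmult: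
  assumes "x \<in> latI" "y \<in> lat" shows "x * y \<in> latI"
proof -
  obtain x' where *: "x' \<in> lat" "x - fscalar eps * x' \<in> J"
    using assms by (auto simp: latI_def)
  have "x * y - fscalar eps * (x' * y) \<in> J"
    using J_rmult[OF *(2) lat_carrier[OF assms(2)]] by (simp add: left_diff_distrib mult.assoc)
  then show ?thesis using assms * lat_closed(5) latI_lat unfolding latI_def by blast
qed

lemma latI_smult: "c \<in> A_loc \<Longrightarrow> x \<in> latI \<Longrightarrow> fscalar c * x \<in> latI"
  by (rule latI_lmult) (auto intro: lat_fscalar)

lemma latI_zero: "0 \<in> latI"
  by (rule J_latI) (rule J_zero)

lemma latI_uminus: "x \<in> latI \<Longrightarrow> - x \<in> latI"
  using latI_smult[of "- 1" x] evq_uminus(1)[OF evq_basic(2)] by (simp add: fs.h_minus fscalar_one)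

lemma latI_diff: "x \<in> latI \<Longrightarrow> y \<in> latI \<Longrightarrow> x - y \<in> latI"
  using latI_add[of x "- y"] latI_uminus by simp

lemma cls_latI: "x \<in> lat \<Longrightarrow> cls x \<in> cls ` latI \<longleftrightarrow> x \<in> latI"
proof
  assume x: "x \<in> lat" "cls x \<in> cls ` latI"
  then obtain y where y: "y \<in> latI" "cls x = cls y" by blast
  then have "x - y \<in> J" using x latI_lat lat_carrier by (simp add: cls_eq)
  then show "x \<in> latI" using latI_add[OF y(1) J_latI] by force
qed blast

lemma ideal_q1: "ideal (q1_ideal M N) (U_A M N)"
proof (rule idealI[OF ring_U_A])
  interpret U: ring "U_A M N" by (rule ring_U_A)
  have inv: "\<ominus>\<^bsub>U_A M N\<^esub> (cls x) = cls (- x)" if "x \<in> lat" for x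
    by (rule U.minus_equality)
      (use that lat_uminus in \<open>auto simp: carrier_U_A U_A_simps P_simps lat_carrier\<close>)
  show "subgroup (q1_ideal M N) (add_monoid (U_A M N))"
    unfolding q1_ideal_eq
  proof (rule U.add.subgroupI)
    show "cls ` latI \<subseteq> carrier (U_A M N)" using latI_lat by (auto simp: carrier_U_A)
    show "cls ` latI \<noteq> {}" using latI_zero by blast
    show "\<ominus>\<^bsub>U_A M N\<^esub> a \<in> cls ` latI" if "a \<in> cls ` latI" for a
      using that latI_uminus latI_lat by (auto simp: inv)
    show "a \<oplus>\<^bsub>U_A M N\<^esub> b \<in> cls ` latI" if "a \<in> cls ` latI" "b \<in> cls ` latI" for a b
      using that latI_add latI_lat by (auto simp: U_A_simps P_simps lat_carrier)
  qed
  show "x \<otimes>\<^bsub>U_A M N\<^esub> a \<in> q1_ideal M N" "a \<otimes>\<^bsub>U_A M N\<^esub> x \<in> q1_ideal M N"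
    if "a \<in> q1_ideal M N" "x \<in> carrier (U_A M N)" for a x
    using that latI_lmult latI_rmult latI_lat
    unfolding q1_ideal_eq carrier_U_A by (auto simp: U_A_simps P_simps lat_carrier)
qed

definition spec :: "qfree \<Rightarrow> qfree set set"
  where "spec x = spec_class M N (cls x)"

lemma spec_eq:
  assumes "x \<in> lat" "y \<in> lat" shows "spec x = spec y \<longleftrightarrow> x - y \<in> latI"
proof -
  interpret U: ring "U_A M N" by (rule ring_U_A)
  have inv: "\<ominus>\<^bsub>U_A M N\<^esub> (cls y) = cls (- y)"
    by (rule U.minus_equality)
      (use assms lat_uminus in \<open>auto simp: carrier_U_A U_A_simps P_simps lat_carrier\<close>)
  have "cls x \<ominus>\<^bsub>U_A M N\<^esub> cls y = cls (x - y)"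
    using assms carrier_closed by (simp add: a_minus_def inv U_A_simps P_simps lat_carrier)
  then show ?thesis
    using U.quotient_eq_iff_same_a_r_cos[OF ideal_q1, of "cls x" "cls y"] assms
    by (simp add: spec_def spec_class_def carrier_U_A q1_ideal_eq cls_latI lat_diff)
qed

lemma U_spec_simps:
  "carrier (U_spec M N) = spec ` lat"
  "x \<in> lat \<Longrightarrow> y \<in> lat \<Longrightarrow> mult (U_spec M N) (spec x) (spec y) = spec (x * y)"
  "x \<in> lat \<Longrightarrow> y \<in> lat \<Longrightarrow> add (U_spec M N) (spec x) (spec y) = spec (x + y)"
  "one (U_spec M N) = spec 1"
  "x \<in> lat \<Longrightarrow> smult (U_spec M N) c (spec x) = spec (fscalar (to_fract [:c:]) * x)"
  "x \<in> lat \<Longrightarrow> x \<in> homog F p \<Longrightarrow> spec x \<in> homog (U_spec M N) p"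
proof -
  interpret I: ideal "q1_ideal M N" "U_A M N" by (rule ideal_q1)
  note defs = U_spec_def restrict_scalars_def quot_superalgebra_def
  show "carrier (U_spec M N) = spec ` lat"
    by (auto simp: defs FactRing_def A_RCOSETS_def' carrier_U_A spec_def spec_class_def)
  show "one (U_spec M N) = spec 1"
    by (simp add: defs FactRing_def spec_def spec_class_def U_A_simps P_simps)
  show "mult (U_spec M N) (spec x) (spec y) = spec (x * y)" if "x \<in> lat" "y \<in> lat"
    using I.rcoset_mult_add[of "cls x" "cls y"] that
    by (simp add: defs FactRing_def spec_def spec_class_def carrier_U_A U_A_simps(2) P_simps lat_carrier)
  show "add (U_spec M N) (spec x) (spec y) = spec (x + y)" if "x \<in> lat" "y \<in> lat"
    using I.a_rcos_sum[of "cls x" "cls y"] that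
    by (simp add: defs FactRing_def spec_def spec_class_def carrier_U_A U_A_simps(3) P_simps lat_carrier)
  show "spec x \<in> homog (U_spec M N) p" if "x \<in> lat" "x \<in> homog F p"
    using that by (auto simp: defs spec_def spec_class_def lat_def U_A_simps P_simps)
  show "smult (U_spec M N) c (spec x) = spec (fscalar (to_fract [:c:]) * x)" if x: "x \<in> lat"
  proof -
    let ?c = "fscalar (to_fract [:c:])"
    have A: "spec_class M N (smult (U_A M N) (to_fract [:c:]) Y) = spec (?c * x)" if "Y \<in> spec x" for Y
    proof -
      have "Y \<in> carrier (U_A M N)"
        using that x I.a_r_coset_subset_G[OF I.a_subset, of "cls x"]
        by (auto simp: spec_def spec_class_def carrier_U_A)
      then obtain y where y: "y \<in> lat" "Y = cls y" by (auto simp: carrier_U_A)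
      have "q1_ideal M N +>\<^bsub>U_A M N\<^esub> cls x = q1_ideal M N +>\<^bsub>U_A M N\<^esub> Y"
        by (rule I.a_repr_independence[OF _ _ I.a_subgroup])
          (use that x in \<open>auto simp: spec_def spec_class_def carrier_U_A\<close>)
      then have "spec y = spec x"
        using y by (simp add: spec_def spec_class_def)
      then have "y - x \<in> latI" using x y by (simp add: spec_eq)
      then have "spec (?c * y) = spec (?c * x)"
        using x y evq_const(1) by (simp add: spec_eq lat_closed(6) latI_smult flip: right_diff_distrib)
      then show ?thesis using y by (simp add: U_A_simps P_smult lat_carrier spec_def)
    qed
    have "cls x \<in> spec x"
      unfolding spec_def spec_class_def by (rule I.a_rcos_self) (use x in \<open>simp add: carrier_U_A\<close>)
    then have "(\<Union>Y\<in>spec x. spec_class M N (smult (U_A M N) (to_fract [:c:]) Y)) = spec (?c * x)"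
      using A by blast
    then show ?thesis by (simp add: defs spec_class_def)
  qed
qed

end

section \<open>The limit \<open>q \<rightarrow> 1\<close> of the RTT relations\<close>

text \<open>
  Since \<open>q\<^sub>i = 1 + (q - 1) qx\<^sub>i\<close> and \<open>q\<^sub>i\<^sup>-\<^sup>1 = 1 + (q - 1) qy\<^sub>i\<close>, the expression
  \<open>RTT\<close> is \<open>RTT0 + (q - 1) RTT1\<close>.
\<close>

definition RTT0 :: "nat \<Rightarrow> (nat \<Rightarrow> nat \<Rightarrow> int \<Rightarrow> 'b) \<Rightarrow>
    (nat \<Rightarrow> nat \<Rightarrow> int \<Rightarrow> 'b) \<Rightarrow> nat \<Rightarrow> nat \<Rightarrow> nat \<Rightarrow> nat \<Rightarrow> int \<Rightarrow> int \<Rightarrow> 'b::ring_1"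
  where "RTT0 M X Y i j k l a b =
    ksign ((ipar M i + ipar M j) * (ipar M k + ipar M l)) *
      (X i j (a - 1) * Y k l b - X i j a * Y k l (b - 1))
    - (Y k l b * X i j (a - 1) - Y k l (b - 1) * X i j a)"

definition RTT1 :: "nat \<Rightarrow> (nat \<Rightarrow> 'b) \<Rightarrow> (nat \<Rightarrow> 'b) \<Rightarrow> (nat \<Rightarrow> 'b) \<Rightarrow> (nat \<Rightarrow> nat \<Rightarrow> int \<Rightarrow> 'b) \<Rightarrow>
    (nat \<Rightarrow> nat \<Rightarrow> int \<Rightarrow> 'b) \<Rightarrow> nat \<Rightarrow> nat \<Rightarrow> nat \<Rightarrow> nat \<Rightarrow> int \<Rightarrow> int \<Rightarrow> 'b::ring_1"
  where "RTT1 M cx cy ce X Y i j k l a b =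
    (if i = k then ksign ((ipar M i + ipar M j) * (ipar M k + ipar M l)) *
        (cx i * (X i j (a - 1) * Y k l b) - cy i * (X i j a * Y k l (b - 1)))
     else ksign ((ipar M k + ipar M j) * (ipar M k + ipar M l)) *
        (ce k * (if k < i then X k j (a - 1) * Y i l b else X k j a * Y i l (b - 1))))
    - (if j = l then cx j * (Y k l b * X i j (a - 1)) - cy j * (Y k l (b - 1) * X i j a)
       else ksign ((ipar M l + ipar M j) * (ipar M k + ipar M j)) *
        (ce j * (if j < l then Y k j b * X i l (a - 1) else Y k j (b - 1) * X i l a)))"

lemma RTT0_add:
  "RTT0 M (\<lambda>i j a. X i j a + X' i j a) Y i j k l a b = RTT0 M X Y i j k l a b + RTT0 M X' Y i j k l a b"
  "RTT0 M X (\<lambda>i j a. Y i j a + Y' i j a) i j k l a b = RTT0 M X Y i j k l a b + RTT0 M X Y' i j k l a b"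
  unfolding RTT0_def by (simp_all add: algebra_simps)

lemma RTT1_add:
  "RTT1 M cx cy ce (\<lambda>i j a. X i j a + X' i j a) Y i j k l a b
    = RTT1 M cx cy ce X Y i j k l a b + RTT1 M cx cy ce X' Y i j k l a b"
  "RTT1 M cx cy ce X (\<lambda>i j a. Y i j a + Y' i j a) i j k l a b
    = RTT1 M cx cy ce X Y i j k l a b + RTT1 M cx cy ce X Y' i j k l a b"
  unfolding RTT1_def
  by (cases "i = k"; cases "j = l"; cases "k < i"; cases "j < l"; simp add: algebra_simps)+

lemma RTT_scale:
  fixes e :: "'b::ring_1"
  assumes e: "\<And>z. z * e = e * z"
  shows "RTT0 M (\<lambda>i j a. e * X i j a) Y i j k l a b = e * RTT0 M X Y i j k l a b"
    "RTT0 M X (\<lambda>i j a. e * Y i j a) i j k l a b = e * RTT0 M X Y i j k l a b"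
    "RTT1 M cx cy ce (\<lambda>i j a. e * X i j a) Y i j k l a b = e * RTT1 M cx cy ce X Y i j k l a b"
    "RTT1 M cx cy ce X (\<lambda>i j a. e * Y i j a) i j k l a b = e * RTT1 M cx cy ce X Y i j k l a b"
proof -
  have e': "y * (e * z) = e * (y * z)" for y z by (metis e mult.assoc)
  note rules = mult.assoc e'[of "X _ _ _"] e'[of "Y _ _ _"] e'[of "ksign _"] e'[of "cx _"] e'[of "cy _"] e'[of "ce _"]
      right_diff_distrib[of e, symmetric]
  show "RTT0 M (\<lambda>i j a. e * X i j a) Y i j k l a b = e * RTT0 M X Y i j k l a b"
    "RTT0 M X (\<lambda>i j a. e * Y i j a) i j k l a b = e * RTT0 M X Y i j k l a b"
    unfolding RTT0_def by (simp_all only: rules)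
  show "RTT1 M cx cy ce (\<lambda>i j a. e * X i j a) Y i j k l a b = e * RTT1 M cx cy ce X Y i j k l a b"
    "RTT1 M cx cy ce X (\<lambda>i j a. e * Y i j a) i j k l a b = e * RTT1 M cx cy ce X Y i j k l a b"
    unfolding RTT1_def by (simp_all only: rules if_distrib[of "\<lambda>z. e * z", symmetric])
qed

definition dd :: "nat \<Rightarrow> nat \<Rightarrow> int \<Rightarrow> 'b::ring_1"
  where "dd i j a = (if i = j \<and> a = 0 then 1 else 0)"

lemma RTT0_dd: "RTT0 M dd Y i j k l a b = 0" "RTT0 M X dd i j k l a b = 0"
  by (cases "i = j"; simp add: RTT0_def dd_def)
    (cases "k = l"; simp add: RTT0_def dd_def)

lemma RTT1_dd: "RTT1 M cx cy ce dd dd i j k l a b = 0"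
  by (cases "i = k"; cases "j = l"; cases "i = j"; cases "k = l"; cases "i = l"; cases "j = k")
    (auto simp: RTT1_def dd_def)

lemma RTT_split:
  "RTT M fscalar X Y i j k l a b = RTT0 M X Y i j k l a b
    + fscalar eps * RTT1 M (\<lambda>i. fscalar (qx M i)) (\<lambda>i. fscalar (qy M i))
        (\<lambda>k. fscalar (ksign (ipar M k) * eta)) X Y i j k l a b"
proof -
  have e: "z * (fscalar eps * y) = fscalar eps * (z * y)" for z y :: "(ratfun, 'a) free_alg"
    by (metis fscalar_comm mult.assoc)
  have s: "fscalar (1 + eps * c) * z = z + fscalar eps * (fscalar c * z)"
     for c and z :: "(ratfun, 'a) free_alg"
    by (simp add: fscalar_add fscalar_mult fscalar_one distrib_right mult.assoc)
  have q: "fscalar (eps * c) * z = fscalar eps * (fscalar c * z)"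
     for c and z :: "(ratfun, 'a) free_alg"
    by (simp add: fscalar_mult mult.assoc)
  show ?thesis
    unfolding RTT_def RTT0_def RTT1_def unfolding qi_split(2,3) unfolding qi_split(1)
    by (cases "i = k"; cases "j = l";
        simp only: if_True if_False s q fscalar_one mult_1_left e[of "ksign _"]
          distrib_left[of "ksign c" for c] right_diff_distrib[of "ksign c" for c]
          distrib_left[of "fscalar eps"] right_diff_distrib[of "fscalar eps"]
          simp_thms refl;
        simp only: diff_conv_add_uminus minus_add_distrib minus_minus add_ac add_0_left add_0_right minus_zero)
qed

text \<open>The identity matrix \<open>dd\<close> is invisible to \<open>RTT0\<close> in either
  argument, and \<open>RTT1\<close> vanishes on the pair of two identities. Hence the orders 0 and 1
  drop out and \<open>(q - 1)\<close> can be divided out twice.\<close>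

lemma RTT_limit:
  fixes M :: nat and x y :: "nat \<Rightarrow> nat \<Rightarrow> int \<Rightarrow> (ratfun, 'g) free_alg"
  defines "c1 \<equiv> \<lambda>i. fscalar (qx M i)" and "c2 \<equiv> \<lambda>i. fscalar (qy M i)"
    and "c3 \<equiv> \<lambda>k. fscalar (ksign (ipar M k) * eta)" and "e \<equiv> fscalar eps"
  shows "RTT M fscalar (\<lambda>i j a. dd i j a + e * x i j a) (\<lambda>i j a. dd i j a + e * y i j a) i j k l a b
    = e * (e * (RTT0 M x y i j k l a b + RTT1 M c1 c2 c3 x dd i j k l a b
        + RTT1 M c1 c2 c3 dd y i j k l a b + e * RTT1 M c1 c2 c3 x y i j k l a b))"
proof -
  have e: "z * e = e * z" for z :: "(ratfun, 'g) free_alg"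
    unfolding e_def by (rule fscalar_comm[symmetric])
  show ?thesis
    unfolding RTT_split unfolding c1_def[symmetric] c2_def[symmetric] c3_def[symmetric] e_def[symmetric]
    by (simp only: RTT0_add RTT1_add RTT_scale[OF e] RTT0_dd RTT1_dd)
      (simp add: algebra_simps)
qed

text \<open>The limit of the coefficient of \<open>u\<^sup>a\<close> in \<open>x(u)\<close>,
  measured against a signed loop generator: 1 for the diagonal entry at \<open>a = 0\<close>, where
  the normalisation is by \<open>q - 1\<close>; 2 for the others, where it is by
  \<open>q - 1/q\<close>; 0 where the coefficient is absent or killed by triangularity.\<close>

definition hT :: "nat \<Rightarrow> nat \<Rightarrow> int \<Rightarrow> int"
  where "hT i j a = (if a > 0 then 2 else if a < 0 then 0 else if i < j then 2 else if i = j then 1 else 0)"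

text \<open>The constant shift by 2 says that in the limit the two series differ, up to sign, by
  twice the two-sided current of loop generators, as do two expansions of one rational
  function.\<close>

definition hTt :: "nat \<Rightarrow> nat \<Rightarrow> int \<Rightarrow> int"
  where "hTt i j a = hT i j a - 2"

definition hx :: "nat \<Rightarrow> (nat \<Rightarrow> nat \<Rightarrow> int \<Rightarrow> int) \<Rightarrow> (nat \<Rightarrow> nat \<Rightarrow> int \<Rightarrow> 'b) \<Rightarrow> nat \<Rightarrow> nat \<Rightarrow> int \<Rightarrow> 'b::ring_1"
  where "hx M h E i j a = of_int (h i j a) * (ksign (ipar M i * ipar M j) * E i j (- a))"

text \<open>The value that the loop relations predict for the signed product \<open>x y\<close>
  minus \<open>y x\<close>, where \<open>x\<close> and \<open>y\<close> are the scaled generators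
  \<open>hx\<close>.\<close>

definition tgt :: "nat \<Rightarrow> (nat \<Rightarrow> nat \<Rightarrow> int \<Rightarrow> int) \<Rightarrow> (nat \<Rightarrow> nat \<Rightarrow> int \<Rightarrow> int) \<Rightarrow> (nat \<Rightarrow> nat \<Rightarrow> int \<Rightarrow> 'b) \<Rightarrow>
    nat \<Rightarrow> nat \<Rightarrow> nat \<Rightarrow> nat \<Rightarrow> int \<Rightarrow> int \<Rightarrow> 'b::ring_1"
  where "tgt M h h' E i j k l a b = of_int (h i j a * h' k l b) *
    (ksign (ipar M i * ipar M j + ipar M k * ipar M l) *
      (ksign ((ipar M i + ipar M j) * (ipar M k + ipar M l)) * (if j = k then E i l (- a - b) else 0)
       - (if i = l then E k j (- a - b) else 0)))"

lemma int_cases4: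
  fixes a :: int
  obtains "a < 0" | "a = 0" | "a = 1" | "a > 1"
  by linarith

text \<open>The linear terms of the RTT relation are the difference of two neighbouring predicted
  brackets. The factors \<open>h\<close> jump only at exponent 0 and the exponents are
  \<open>a\<close>, \<open>a - 1\<close>, \<open>b\<close>, \<open>b - 1\<close>; hence the ranges
  below 0, 0, 1, above 1. Without a coincidence \<open>j = k\<close> or \<open>i = l\<close> all
  terms cancel.\<close>

lemma tgt_rec:
  fixes E :: "nat \<Rightarrow> nat \<Rightarrow> int \<Rightarrow> 'b::ring_1"
  assumes "(h, h') \<in> {(hT, hT), (hTt, hTt), (hTt, hT)}"
  shows "RTT1 M (\<lambda>i. ksign (ipar M i)) (\<lambda>i. - ksign (ipar M i)) (\<lambda>i. 2 * ksign (ipar M i)) (hx M h E) dd i j k l a b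
    + RTT1 M (\<lambda>i. ksign (ipar M i)) (\<lambda>i. - ksign (ipar M i)) (\<lambda>i. 2 * ksign (ipar M i)) dd (hx M h' E) i j k l a b
    + tgt M h h' E i j k l (a - 1) b - tgt M h h' E i j k l a (b - 1) = 0"
proof -
  have idx: "- a - (b - 1) = 1 - a - b" by simp
  have quad: "4 * z = z + z + (z + z)" for z :: 'b
  proof -
    have "(4::'b) = 1 + 1 + (1 + 1)" by simp
    then show ?thesis by (simp only: distrib_right mult_1_left)
  qed
  have dd_simps: "dd m n 0 = (if m = n then 1 else 0 :: 'b)" "c \<noteq> 0 \<Longrightarrow> dd m n c = (0 :: 'b)" for m n c
    by (simp_all add: dd_def)
  have hs: "c > 0 \<Longrightarrow> hT m n c = 2" "c < 0 \<Longrightarrow> hT m n c = 0" "hT m n 0 = (if m < n then 2 else if m = n then 1 else 0)" for m n c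
    by (simp_all add: hT_def)
  note defs = RTT1_def tgt_def hx_def
  note run = defs hTt_def dd_simps hs idx
  consider "j \<noteq> k" "i \<noteq> l" | "j = k" "i = l" "i = j" | "j = k" "i = l" "i < j" | "j = k" "i = l" "j < i"
    | "j = k" "i \<noteq> l" "i = j" | "j = k" "i \<noteq> l" "j = l" | "j = k" "i \<noteq> l" "i \<noteq> j" "j \<noteq> l"
    | "i = l" "j \<noteq> k" "i = j" | "i = l" "j \<noteq> k" "i = k" | "i = l" "j \<noteq> k" "i \<noteq> j" "i \<noteq> k"
    by linarith
  then show ?thesis
  proof cases
    case 1
    then show ?thesis by (cases "i = k"; cases "j = l") (auto simp: defs dd_def)
  next
    case 2
    then show ?thesis using assms
      by - (elim insertE emptyE; rule int_cases4[of a]; rule int_cases4[of b]; cases "ipar M i",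
        (simp_all add: run)?, (simp_all add: mult_2 quad)?)
  next
    case 3
    then show ?thesis using assms
      by - (elim insertE emptyE; rule int_cases4[of a]; rule int_cases4[of b]; cases "ipar M i"; cases "ipar M j",
        (simp_all add: run)?, (simp_all add: mult_2 quad)?)
  next
    case 4
    then show ?thesis using assms
      by - (elim insertE emptyE; rule int_cases4[of a]; rule int_cases4[of b]; cases "ipar M i"; cases "ipar M j",
        (simp_all add: run)?, (simp_all add: mult_2 quad)?)
  next
    case 5
    then show ?thesis using assms
      by - (elim insertE emptyE; rule int_cases4[of a]; rule int_cases4[of b]; cases "ipar M i"; cases "ipar M l",
        (simp_all add: run)?, (simp_all add: mult_2 quad)?)
  next
    case 6
    then show ?thesis using assms
      by - (elim insertE emptyE; rule int_cases4[of a]; rule int_cases4[of b]; cases "ipar M i"; cases "ipar M j",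
        (simp_all add: run)?, (simp_all add: mult_2 quad)?)
  next
    case 7
    then show ?thesis using assms
      by - (elim insertE emptyE; rule int_cases4[of a]; rule int_cases4[of b]; cases "ipar M i"; cases "ipar M j"; cases "ipar M l",
        (simp_all add: run)?, (simp_all add: mult_2 quad)?)
  next
    case 8
    then show ?thesis using assms
      by - (elim insertE emptyE; rule int_cases4[of a]; rule int_cases4[of b]; cases "ipar M i"; cases "ipar M k",
        (simp_all add: run)?, (simp_all add: mult_2 quad)?)
  next
    case 9
    then show ?thesis using assms
      by - (elim insertE emptyE; rule int_cases4[of a]; rule int_cases4[of b]; cases "ipar M i"; cases "ipar M j",
        (simp_all add: run)?, (simp_all add: mult_2 quad)?)
  next
    case 10
    then show ?thesis using assms
      by - (elim insertE emptyE; rule int_cases4[of a]; rule int_cases4[of b]; cases "ipar M i"; cases "ipar M j"; cases "ipar M k",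
        (simp_all add: run)?, (simp_all add: mult_2 quad)?)
  qed
qed

lemma of_int_ksign: "of_int (ksign p) = (ksign p :: 'b::ring_1)"
  by (cases p) simp_all

lemma homog_mult:
  fixes x y :: "('k::field, 'g) free_alg"
  assumes "x \<in> homog (free_superalgebra G par) p" "y \<in> homog (free_superalgebra G par) p'"
  shows "x * y \<in> homog (free_superalgebra G par) (p + p')"
  using assms Poly_Mapping.keys_mult[of x y]
  by (fastforce simp: free_superalgebra_def plus_word_def word_parity_def)

lemma homog_closed:
  fixes x y :: "('k::field, 'g) free_alg"
  shows "x \<in> homog (free_superalgebra G par) p \<Longrightarrow> y \<in> homog (free_superalgebra G par) p \<Longrightarrow> x + y \<in> homog (free_superalgebra G par) p"
    "x \<in> homog (free_superalgebra G par) p \<Longrightarrow> - x \<in> homog (free_superalgebra G par) p"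
    "x \<in> homog (free_superalgebra G par) p \<Longrightarrow> fscalar c * x \<in> homog (free_superalgebra G par) p"
    "g \<in> G \<Longrightarrow> fgen g \<in> homog (free_superalgebra G par) (par g)"
    "(1 :: ('k, 'g) free_alg) \<in> homog (free_superalgebra G par) 0"
    "(0 :: ('k, 'g) free_alg) \<in> homog (free_superalgebra G par) p"
proof -
  show "x + y \<in> homog (free_superalgebra G par) p"
    if "x \<in> homog (free_superalgebra G par) p" "y \<in> homog (free_superalgebra G par) p"
    using that Poly_Mapping.keys_add[of x y] by (fastforce simp: free_superalgebra_def)
  show "- x \<in> homog (free_superalgebra G par) p" if "x \<in> homog (free_superalgebra G par) p"
    using that by (simp add: free_superalgebra_def)
  have "(fscalar c :: ('k, 'g) free_alg) \<in> homog (free_superalgebra G par) 0"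
    by (simp add: free_superalgebra_def fscalar_def word_parity_def)
  then show "fscalar c * x \<in> homog (free_superalgebra G par) p"
    if "x \<in> homog (free_superalgebra G par) p" using homog_mult[OF _ that] by (metis add_0)
qed (auto simp: free_superalgebra_def fgen_def word_parity_def)

lemma homog_sum_list:
  assumes "\<And>w. w \<in> A \<Longrightarrow> f w \<in> homog (free_superalgebra G par) p"
  shows "(\<Sum>w\<in>A. f w :: ('k::field, 'g) free_alg) \<in> homog (free_superalgebra G par) p"
  using assms by (induction A rule: infinite_finite_induct) (simp_all add: homog_closed)

lemma central_scalars_const: "central_scalars (\<lambda>c. fscalar (to_fract [:c:]) :: qfree)"
proof
  show "fscalar (to_fract [:a + b:]) = fscalar (to_fract [:a:]) + (fscalar (to_fract [:b:]) :: qfree)"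
    "fscalar (to_fract [:a * b:]) = fscalar (to_fract [:a:]) * (fscalar (to_fract [:b:]) :: qfree)" for a b
    unfolding fscalar_add[symmetric] fscalar_mult[symmetric] to_fract_add[symmetric] to_fract_mult[symmetric]
    by (simp_all add: mult.commute)
  show "fscalar (to_fract [:1:]) = (1 :: qfree)"
    by (simp add: fscalar_one flip: one_pCons)
qed (rule fscalar_comm)

section \<open>Loop generators in the lattice and their relations modulo
  \<open>q - 1\<close>\<close>

locale qloop_limit = qloop
begin

text \<open>The formulas of the theorem on representatives. For \<open>i = j\<close> and
  \<open>r = 0\<close> both families provide an image; \<open>gam\<close> is taken, and
  \<open>gam_gamt\<close> shows that the other agrees modulo \<open>q - 1\<close>.\<close>

fun lgen :: "loop_gen \<Rightarrow> qfree"
  where "lgen (LE i j r) = (if r < 0 \<or> r = 0 \<and> i \<le> j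
    then ksign (ipar M i * ipar M j) * gam i j (nat (- r))
    else - (ksign (ipar M i * ipar M j) * gamt i j (nat r)))"

abbreviation E where "E i j r \<equiv> lgen (LE i j r)"

lemma lat_ksign: "x \<in> lat \<Longrightarrow> ksign p * x \<in> lat"
  by (cases p) (simp_all add: lat_uminus)

lemma lgen_lat: "i \<in> idx M N \<Longrightarrow> j \<in> idx M N \<Longrightarrow> E i j r \<in> lat"
  by (simp add: lat_ksign lat_closed lat_uminus)

text \<open>Membership in the lattice is part of the congruence, so that it is compatible with
  products.\<close>

definition eqv :: "qfree \<Rightarrow> qfree \<Rightarrow> bool"
  where "eqv x y \<longleftrightarrow> x \<in> lat \<and> y \<in> lat \<and> x - y \<in> latI"

lemma eqv_refl: "x \<in> lat \<Longrightarrow> eqv x x"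
  by (simp add: eqv_def latI_zero)

lemma eqv_add: "eqv x x' \<Longrightarrow> eqv y y' \<Longrightarrow> eqv (x + y) (x' + y')"
  using latI_add[of "x - x'" "y - y'"] by (simp add: eqv_def lat_closed add_diff_add)

lemma eqv_uminus: "eqv x x' \<Longrightarrow> eqv (- x) (- x')"
  using latI_uminus[of "x - x'"] by (simp add: eqv_def lat_uminus)

lemma eqv_diff: "eqv x x' \<Longrightarrow> eqv y y' \<Longrightarrow> eqv (x - y) (x' - y')"
  using eqv_add[of x x' "- y" "- y'"] eqv_uminus[of y y'] by simp

lemma eqv_mult: "eqv x x' \<Longrightarrow> eqv y y' \<Longrightarrow> eqv (x * y) (x' * y')"
  using latI_add[OF latI_rmult[of "x - x'" y] latI_lmult[of "y - y'" x']]
  by (simp add: eqv_def lat_closed algebra_simps)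

lemma eqv_if: "eqv x x' \<Longrightarrow> eqv y y' \<Longrightarrow> eqv (if c then x else y) (if c then x' else y')"
  by simp

lemma eqv_sym: "eqv x y \<Longrightarrow> eqv y x"
  using latI_uminus[of "x - y"] by (simp add: eqv_def)

lemma eqv_trans: "eqv x y \<Longrightarrow> eqv y z \<Longrightarrow> eqv x z"
  using latI_add[of "x - y" "y - z"] by (simp add: eqv_def)

lemma eqv_latI: "x \<in> latI \<longleftrightarrow> eqv x 0"
  using latI_lat by (auto simp: eqv_def lat_zero)

lemma lat_ksign1: "ksign p \<in> lat"
  using lat_ksign[OF lat_closed(1)] by simp

lemma lat_of_int: "of_int n \<in> lat"
  by (induction n rule: int_induct[of _ 0]) (simp_all add: lat_zero lat_closed lat_diff)

lemma eqv_fscalar: "c \<in> A_loc \<Longrightarrow> eqv (fscalar c) (fscalar (to_fract [:evq c:]))"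
proof -
  assume c: "c \<in> A_loc"
  then obtain d where d: "d \<in> A_loc" "c = to_fract [:evq c:] + eps * d" by (rule evq_split)
  have "fscalar c - fscalar (to_fract [:evq c:]) = fscalar eps * fscalar d"
    by (subst d(2)) (simp add: fscalar_add fscalar_mult)
  then have "fscalar c - fscalar (to_fract [:evq c:]) \<in> latI"
    by (metis latI_eps[OF lat_fscalar[OF d(1)]])
  then show ?thesis
    using c by (simp add: eqv_def lat_fscalar evq_const)
qed

lemma fscalar_of_int: "fscalar (of_int n) = of_int n"
  by (induction n rule: int_induct[of _ 0]) (simp_all add: fs.h_zero fscalar_one fs.h_diff fscalar_add)

lemma eqv_fscalar_int: "c \<in> A_loc \<Longrightarrow> evq c = of_int n \<Longrightarrow> eqv (fscalar c) (of_int n)"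
proof -
  assume c: "c \<in> A_loc" "evq c = of_int n"
  have "to_fract [:of_int n :: complex:] = of_int n"
  proof (induction n rule: int_induct[of _ 0])
    case (step1 i)
    have "[:of_int (i + 1) :: complex:] = [:of_int i:] + 1" by (simp add: one_pCons)
    then show ?case using step1 by (simp only: to_fract_add to_fract_1 of_int_add of_int_1)
  next
    case (step2 i)
    have "[:of_int (i - 1) :: complex:] = [:of_int i:] - 1" by (simp add: one_pCons)
    then show ?case using step2 by (simp only: to_fract_diff to_fract_1 of_int_diff of_int_1)
  qed simp
  then show ?thesis using eqv_fscalar[OF c(1)] c(2) by (simp add: fscalar_of_int)
qed

definition xT :: "nat \<Rightarrow> nat \<Rightarrow> int \<Rightarrow> qfree"
  where "xT i j a = fscalar (inverse eps) * (T_series i j a - dd i j a)"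

definition xTt :: "nat \<Rightarrow> nat \<Rightarrow> int \<Rightarrow> qfree"
  where "xTt i j a = fscalar (inverse eps) * (Tt_series i j a - dd i j a)"

lemma fscalar_inv: "c \<noteq> 0 \<Longrightarrow> fscalar c * (fscalar (inverse c) * x) = x"
  "c \<noteq> 0 \<Longrightarrow> fscalar (inverse c) * (fscalar c * x) = x"
  by (simp_all add: fscalar_one flip: mult.assoc fscalar_mult)

lemma series_x: "T_series = (\<lambda>i j a. dd i j a + fscalar eps * xT i j a)"
  "Tt_series = (\<lambda>i j a. dd i j a + fscalar eps * xTt i j a)"
  by (simp_all add: fun_eq_iff xT_def xTt_def fscalar_inv eps_nz)

lemma eta_gam: "inverse eps = eta * inverse (eps * eta)"
  using evq_eta(5) by (simp add: field_simps)

lemma ksign_ksign_mult [simp]: "ksign p * (ksign p * x) = (x :: 'b::ring_1)"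
  by (cases p) simp_all

text \<open>Writing both diagonal generators as \<open>1 + (q - 1) z\<close> in the relation that
  their product is 1, the part linear in \<open>q - 1\<close> must vanish modulo
  \<open>q - 1\<close>.\<close>

lemma gam_gamt: "i \<in> idx M N \<Longrightarrow> eqv (gamt i i 0) (- gam i i 0)"
proof -
  assume i: "i \<in> idx M N"
  have T: "fgen (QT i i 0) = 1 + fscalar eps * gam i i 0" "fgen (QTt i i 0) = 1 + fscalar eps * gamt i i 0"
    by (simp_all add: gam_def gamt_def fscalar_inv eps_nz)
  have "fgen (QT i i 0) * fgen (QTt i i 0) - 1 \<in> J"
    by (rule J_rels) (use i in \<open>auto simp: qloop_rels_eq\<close>)
  also have "fgen (QT i i 0) * fgen (QTt i i 0) - 1
      = fscalar eps * (gamt i i 0 + gam i i 0 + fscalar eps * (gam i i 0 * gamt i i 0))"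
  proof -
    have "gam i i 0 * (fscalar eps * gamt i i 0) = fscalar eps * (gam i i 0 * gamt i i 0)"
      by (metis fscalar_comm mult.assoc)
    then show ?thesis
      unfolding T by (simp only: distrib_left distrib_right mult.assoc mult_1_left mult_1_right) simp
  qed
  finally have "fscalar (inverse eps) * (fscalar eps * (gamt i i 0 + gam i i 0 + fscalar eps * (gam i i 0 * gamt i i 0))) \<in> J"
    by (rule J_scalar)
  then have "gamt i i 0 + gam i i 0 + fscalar eps * (gam i i 0 * gamt i i 0) \<in> latI"
    by (simp add: fscalar_inv eps_nz J_latI)
  moreover have "fscalar eps * (gam i i 0 * gamt i i 0) \<in> latI"
    by (intro latI_eps lat_closed i)
  ultimately have "gamt i i 0 + gam i i 0 + fscalar eps * (gam i i 0 * gamt i i 0) - fscalar eps * (gam i i 0 * gamt i i 0) \<in> latI"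
    by (rule latI_diff)
  then
  show ?thesis using i by (simp add: eqv_def lat_closed lat_uminus)
qed

lemma x_val:
  assumes ij: "i \<in> idx M N" "j \<in> idx M N"
  shows "eqv (xT i j a) (hx M hT E i j a)" "eqv (xTt i j a) (hx M hTt E i j a)"
proof -
  have two: "eqv (fscalar eta * z) (of_int 2 * z)" if "z \<in> lat" for z
    by (rule eqv_mult[OF eqv_fscalar_int eqv_refl]) (use that evq_eta in simp_all)
  \<comment> \<open>\<open>xT\<close> divides by \<open>q - 1\<close>, but \<open>gam\<close> off
    the diagonal divides by \<open>(q - 1) eta\<close>; the surplus \<open>eta\<close> becomes
    2.\<close>
  have eg: "fscalar (inverse eps) * z = fscalar eta * (fscalar (inverse (eps * eta)) * z)" for z :: qfree
    by (subst eta_gam) (simp add: fscalar_mult mult.assoc)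
  have J0: "eqv (fscalar c * fgen (QT j i 0)) 0" "eqv (fscalar c * fgen (QTt i j 0)) 0"
     if "i < j" "i \<in> idx M N" "j \<in> idx M N" for i j c
  proof -
    have "fgen (QT j i 0) \<in> qloop_rels M N" "fgen (QTt i j 0) \<in> qloop_rels M N"
      using that by (auto simp: qloop_rels_eq)
    then show "eqv (fscalar c * fgen (QT j i 0)) 0" "eqv (fscalar c * fgen (QTt i j 0)) 0"
      by (simp_all flip: eqv_latI add: J_latI J_scalar J_rels)
  qed
  show "eqv (xT i j a) (hx M hT E i j a)"
  proof -
    consider "a < 0" | "a = 0" "i = j" | "a = 0" "j < i" | "a > 0 \<or> a = 0 \<and> i < j" by linarith
    then show ?thesis
    proof cases
      case 1
      then show ?thesis by (simp add: xT_def T_series_def dd_def hx_def hT_def eqv_refl lat_zero)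
    next
      case 2
      then show ?thesis using ij
        by (simp add: xT_def T_series_def dd_def hx_def hT_def gam_def[symmetric] eqv_refl lat_closed
            del: gam_def) (simp add: gam_def[of j j 0, simplified, symmetric] eqv_refl lat_closed)
    next
      case 3
      then show ?thesis using ij J0(1)[of j i] by (simp add: xT_def T_series_def dd_def hx_def hT_def)
    next
      case 4
      then have "xT i j a = fscalar eta * gam i j (nat a)"
        by (auto simp: xT_def T_series_def dd_def gam_def eg)
      moreover have "hx M hT E i j a = of_int 2 * gam i j (nat a)"
        using 4 by (auto simp: hx_def hT_def)
      ultimately show ?thesis using two[OF lat_closed(2)[OF ij]] by simp
    qed
  qed
  show "eqv (xTt i j a) (hx M hTt E i j a)"
  proof -
    consider "a > 0" | "a = 0" "i = j" | "a = 0" "i < j" | "a < 0 \<or> a = 0 \<and> j < i" by linarith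
    then show ?thesis
    proof cases
      case 1
      then show ?thesis by (simp add: xTt_def Tt_series_def dd_def hx_def hTt_def hT_def eqv_refl lat_zero)
    next
      case 2
      then have "xTt i j a = gamt i i 0" "hx M hTt E i j a = - gam i i 0"
        by (simp_all add: xTt_def Tt_series_def dd_def gamt_def hx_def hTt_def hT_def)
      then show ?thesis using gam_gamt[OF ij(1)] by simp
    next
      case 3
      then show ?thesis using ij J0(2)[of i j] by (simp add: xTt_def Tt_series_def dd_def hx_def hTt_def hT_def)
    next
      case 4
      then have "xTt i j a = fscalar eta * gamt i j (nat (- a))"
        by (auto simp: xTt_def Tt_series_def dd_def gamt_def eg)
      moreover have "hx M hTt E i j a = of_int 2 * gamt i j (nat (- a))"
        using 4 by (auto simp: hx_def hTt_def hT_def)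
      ultimately show ?thesis using two[OF lat_closed(3)[OF ij]] by simp
    qed
  qed
qed

lemma dd_lat: "dd i j a \<in> lat"
  by (simp add: dd_def lat_zero lat_closed)

lemma eqv_RTT1:
  assumes "\<And>i. eqv (cx i) (cx' i)" "\<And>i. eqv (cy i) (cy' i)" "\<And>i. eqv (ce i) (ce' i)"
    "\<And>i j a. i \<in> idx M N \<Longrightarrow> j \<in> idx M N \<Longrightarrow> eqv (X i j a) (X' i j a)"
    "\<And>i j a. i \<in> idx M N \<Longrightarrow> j \<in> idx M N \<Longrightarrow> eqv (Y i j a) (Y' i j a)"
    and idx: "i \<in> idx M N" "j \<in> idx M N" "k \<in> idx M N" "l \<in> idx M N"
  shows "eqv (RTT1 M cx cy ce X Y i j k l a b) (RTT1 M cx' cy' ce' X' Y' i j k l a b)"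
  unfolding RTT1_def by (intro eqv_if eqv_diff eqv_mult eqv_refl lat_ksign1 assms)

abbreviation "RTT1q \<equiv> RTT1 M (\<lambda>i. fscalar (qx M i)) (\<lambda>i. fscalar (qy M i))
    (\<lambda>k. fscalar (ksign (ipar M k) * eta))"
abbreviation "RTT1c \<equiv> RTT1 M (\<lambda>i. ksign (ipar M i)) (\<lambda>i. - ksign (ipar M i)) (\<lambda>i. 2 * ksign (ipar M i))"

lemma eqv_coeffs:
  "eqv (fscalar (qx M i)) (ksign (ipar M i))" "eqv (fscalar (qy M i)) (- ksign (ipar M i))"
  "eqv (fscalar (ksign (ipar M i) * eta)) (2 * ksign (ipar M i))"
proof -
  show "eqv (fscalar (qx M i)) (ksign (ipar M i))"
    using eqv_fscalar_int[OF evq_qxy(1)[of M i], of "ksign (ipar M i)"] evq_qxy(2)[of M i] by (simp add: of_int_ksign)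
  show "eqv (fscalar (qy M i)) (- ksign (ipar M i))"
    using eqv_fscalar_int[OF evq_qxy(3)[of M i], of "- ksign (ipar M i)"] evq_qxy(4)[of M i] by (simp add: of_int_ksign)
  show "eqv (fscalar (ksign (ipar M i) * eta)) (2 * ksign (ipar M i))"
    using eqv_fscalar_int[of "ksign (ipar M i) * eta" "2 * ksign (ipar M i)"]
      evq_mult[OF evq_ksign(1)[of "ipar M i"] evq_eta(1)] evq_ksign(2)[of "ipar M i"] evq_eta(2)
    by (simp add: mult.commute of_int_ksign)
qed

text \<open>The three available RTT relations, each with its first-order parts and limit factors.
  The pair with \<open>T\<close> first and \<open>T\<^sup>~\<close> second is not among
  them.\<close>

definition triples where "triples = {(T_series, xT, hT, T_series, xT, hT),
  (Tt_series, xTt, hTt, Tt_series, xTt, hTt), (Tt_series, xTt, hTt, T_series, xT, hT)}"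

lemma RTT_eqv:
  assumes t: "(X, x, h, Y, y, h') \<in> triples"
    and idx: "i \<in> idx M N" "j \<in> idx M N" "k \<in> idx M N" "l \<in> idx M N"
  shows "eqv (RTT0 M x y i j k l a b + RTT1c (hx M h E) dd i j k l a b + RTT1c dd (hx M h' E) i j k l a b) 0"
proof -
  have X: "X = (\<lambda>i j a. dd i j a + fscalar eps * x i j a)" "Y = (\<lambda>i j a. dd i j a + fscalar eps * y i j a)"
    and x: "\<And>i j a. i \<in> idx M N \<Longrightarrow> j \<in> idx M N \<Longrightarrow> eqv (x i j a) (hx M h E i j a)"
    and y: "\<And>i j a. i \<in> idx M N \<Longrightarrow> j \<in> idx M N \<Longrightarrow> eqv (y i j a) (hx M h' E i j a)"
    using t series_x x_val by (auto simp: triples_def)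
  have xl: "\<And>i j a. i \<in> idx M N \<Longrightarrow> j \<in> idx M N \<Longrightarrow> x i j a \<in> lat"
    and yl: "\<And>i j a. i \<in> idx M N \<Longrightarrow> j \<in> idx M N \<Longrightarrow> y i j a \<in> lat"
    using x y by (auto simp: eqv_def)
  let ?Z = "RTT0 M x y i j k l a b + RTT1q x dd i j k l a b + RTT1q dd y i j k l a b
      + fscalar eps * RTT1q x y i j k l a b"
  have "RTT M fscalar X Y i j k l a b \<in> qloop_rels M N"
    unfolding qloop_rels_eq
    by (rule UnI2, unfold mem_Collect_eq, intro exI conjI, rule refl)
      (use t idx in \<open>auto simp: triples_def\<close>)
  then have "RTT M fscalar X Y i j k l a b \<in> J" by (rule J_rels)
  then have eeZ: "fscalar eps * (fscalar eps * ?Z) \<in> J"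
    unfolding X RTT_limit .
  \<comment> \<open>The relation ideal lives over the field of rational functions, where
    \<open>q - 1\<close> is invertible; congruences in the lattice are taken only after this
    division.\<close>
  have cancel: "z \<in> J" if "fscalar eps * z \<in> J" for z
    using J_scalar[OF that, of "inverse eps"] by (simp only: fscalar_inv(2)[OF eps_nz])
  have "?Z \<in> J" by (rule cancel[OF cancel[OF eeZ]])
  then have Z: "eqv ?Z 0" using J_latI eqv_latI by blast
  have q: "eqv (RTT1q x dd i j k l a b) (RTT1c (hx M h E) dd i j k l a b)"
    by (rule eqv_RTT1[OF eqv_coeffs _ _ idx]) (auto intro: x eqv_refl dd_lat simp only:)
  have q': "eqv (RTT1q dd y i j k l a b) (RTT1c dd (hx M h' E) i j k l a b)"
    by (rule eqv_RTT1[OF eqv_coeffs _ _ idx]) (auto intro: y eqv_refl dd_lat simp only:)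
  have "eqv (RTT1q x y i j k l a b) (RTT1q x y i j k l a b)"
    by (rule eqv_RTT1[OF _ _ _ _ _ idx])
      (auto intro: eqv_refl lat_fscalar evq_qxy evq_mult evq_ksign evq_eta xl yl simp only:)
  then have "RTT1q x y i j k l a b \<in> lat" by (simp only: eqv_def)
  then have "eqv (fscalar eps * RTT1q x y i j k l a b) 0"
    by (simp only: latI_eps flip: eqv_latI)
  from eqv_diff[OF Z this]
  have "eqv (RTT0 M x y i j k l a b + RTT1q x dd i j k l a b + RTT1q dd y i j k l a b) 0"
    by simp
  then have 0: "RTT0 M x y i j k l a b + RTT1q x dd i j k l a b + RTT1q dd y i j k l a b \<in> latI"
    by (simp only: eqv_latI)
  have d: "RTT1q x dd i j k l a b - RTT1c (hx M h E) dd i j k l a b \<in> latI"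
    "RTT1q dd y i j k l a b - RTT1c dd (hx M h' E) i j k l a b \<in> latI"
    using q q' by (simp_all only: eqv_def)
  have "RTT0 M x y i j k l a b + RTT1c (hx M h E) dd i j k l a b + RTT1c dd (hx M h' E) i j k l a b \<in> latI"
    using latI_diff[OF latI_diff[OF 0 d(1)] d(2)] by (simp add: algebra_simps)
  then show ?thesis by (simp only: eqv_latI)
qed

definition defect where
  "defect x h y h' i j k l a b = ksign ((ipar M i + ipar M j) * (ipar M k + ipar M l)) * (x i j a * y k l b)
    - y k l b * x i j a - tgt M h h' E i j k l a b"

text \<open>Modulo \<open>q - 1\<close> the defect depends only on \<open>a + b\<close>, by
  \<open>rec\<close>. On the line \<open>a + b = const\<close> there is a mode at which the first
  series has no coefficient, and there the brackets and the prediction are both zero.\<close>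

lemma defect_latI:
  assumes t: "(X, x, h, Y, y, h') \<in> triples"
    and idx: "i \<in> idx M N" "j \<in> idx M N" "k \<in> idx M N" "l \<in> idx M N"
  shows "defect x h y h' i j k l a b \<in> latI"
proof -
  let ?D = "defect x h y h' i j k l"
  have rec: "?D (a - 1) b - ?D a (b - 1) \<in> latI" for a b
  proof -
    let ?R = "RTT1c (hx M h E) dd i j k l a b" and ?R' = "RTT1c dd (hx M h' E) i j k l a b"
    let ?t = "tgt M h h' E i j k l (a - 1) b" and ?t' = "tgt M h h' E i j k l a (b - 1)"
    have r: "?R + ?R' + ?t - ?t' = 0"
      by (rule tgt_rec) (use t in \<open>auto simp: triples_def\<close>)
    have "?D (a - 1) b - ?D a (b - 1) = RTT0 M x y i j k l a b - (?t - ?t')"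
      unfolding defect_def RTT0_def right_diff_distrib
      by (simp only: diff_conv_add_uminus minus_add_distrib minus_minus add_ac)
    also have "\<dots> = RTT0 M x y i j k l a b + ?R + ?R'"
      using r by (simp add: algebra_simps eq_neg_iff_add_eq_0)
    finally show ?thesis using RTT_eqv[OF t idx, of a b] eqv_latI by simp
  qed
  have down: "?D a b - ?D (a - int n) (b + int n) \<in> latI" for a b n
  proof (induction n)
    case (Suc n)
    have "?D (a - int n) (b + int n) - ?D (a - int (Suc n)) (b + int (Suc n)) \<in> latI"
      using latI_uminus[OF rec[of "a - int n" "b + int (Suc n)"]] by (simp add: algebra_simps)
    from latI_add[OF Suc this] show ?case by simp
  qed (simp add: latI_zero)
  have up: "?D a b - ?D (a + int n) (b - int n) \<in> latI" for a b n
    using latI_uminus[OF down[of "a + int n" "b - int n" n]] by simp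
  have xT0: "a < 0 \<Longrightarrow> xT m n a = 0" "a > 0 \<Longrightarrow> xTt m n a = 0" for m n a
    by (simp_all add: xT_def xTt_def T_series_def Tt_series_def dd_def)
  from t consider "x = xT" "h = hT" | "x = xTt" "h = hTt" by (auto simp: triples_def)
  then show ?thesis
  proof cases
    case 1
    \<comment> \<open>This shift moves a nonnegative \<open>a\<close> to -1 and leaves a negative
      one in place; \<open>xT\<close> and \<open>hT\<close> vanish at negative exponents.\<close>
    let ?n = "nat (a + 1)"
    have "?D (a - int ?n) (b + int ?n) = 0"
      unfolding 1 defect_def by (simp add: xT0 tgt_def hT_def)
    then show ?thesis using down[of a b ?n] by simp
  next
    case 2
    \<comment> \<open>Here the move goes to a positive exponent, where \<open>xTt\<close> and
      \<open>hTt\<close> vanish.\<close>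
    let ?n = "nat (1 - a)"
    have "?D (a + int ?n) (b - int ?n) = 0"
      unfolding 2 defect_def by (simp add: xT0 tgt_def hTt_def hT_def)
    then show ?thesis using up[of a b ?n] by simp
  qed
qed

definition lrel where
  "lrel i j r k l s = ksign ((ipar M i + ipar M j) * (ipar M k + ipar M l)) * (E i j r * E k l s)
    - E k l s * E i j r - (ksign ((ipar M i + ipar M j) * (ipar M k + ipar M l)) *
      (if j = k then E i l (r + s) else 0) - (if i = l then E k j (r + s) else 0))"

lemma ksign_latI: "ksign t * z \<in> latI \<Longrightarrow> z \<in> latI"
  using latI_uminus[of "- z"] by (cases t) simp_all

text \<open>Up to a sign the defect is the loop relation multiplied by the integer
  \<open>h h'\<close>, which is a unit of \<open>A_loc\<close> as soon as it is nonzero.\<close>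

lemma lrel_aux:
  assumes t: "(X, x, h, Y, y, h') \<in> triples"
    and idx: "i \<in> idx M N" "j \<in> idx M N" "k \<in> idx M N" "l \<in> idx M N"
    and nz: "h i j (- r) \<noteq> 0" "h' k l (- s) \<noteq> 0"
  shows "lrel i j r k l s \<in> latI"
proof -
  have x: "eqv (x i j (- r)) (hx M h E i j (- r))" "eqv (y k l (- s)) (hx M h' E k l (- s))"
    using t x_val idx by (auto simp: triples_def)
  let ?n = "h i j (- r) * h' k l (- s)"
  let ?p = "ipar M i * ipar M j" and ?p' = "ipar M k * ipar M l"
  have alg: "ksign t * ((of_int m * (ksign p * A)) * (of_int m' * (ksign p' * B)))
      - (of_int m' * (ksign p' * B)) * (of_int m * (ksign p * A)) - of_int (m * m') * (ksign (p + p') * C)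
    = of_int (m * m') * (ksign (p + p') * (ksign t * (A * B) - B * A - C))" for t p p' m m' and A B C :: qfree
  proof -
    have cc: "y * (of_int n * z) = of_int n * (y * z)" "y * (ksign q * z) = ksign q * (y * z)"
      for n q and y z :: qfree
      by (metis mult_of_int_commute mult.assoc) (metis ksign_comm mult.assoc)
    note move = cc(1)[of A] cc(1)[of B] cc(1)[of "ksign t"] cc(1)[of "ksign p"] cc(1)[of "ksign p'"]
      cc(2)[of A] cc(2)[of B] cc(2)[of "ksign t" p] cc(2)[of "ksign t" p'] cc(2)[of "ksign p'" p]
      cc(1)[of "of_int m'" m]
    show ?thesis unfolding ksign_add of_int_mult
      by (simp only: mult.assoc move right_diff_distrib)
  qed
  have tg: "tgt M h h' E i j k l (- r) (- s) = of_int ?n * (ksign (?p + ?p') *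
      (ksign ((ipar M i + ipar M j) * (ipar M k + ipar M l)) *
      (if j = k then E i l (r + s) else 0) - (if i = l then E k j (r + s) else 0)))"
    by (simp only: tgt_def minus_minus diff_conv_add_uminus)
  have tl: "tgt M h h' E i j k l (- r) (- s) \<in> lat"
    unfolding tgt_def by (intro lat_closed lat_diff if_in lat_ksign lat_zero lgen_lat idx lat_of_int)
  have "eqv (defect x h y h' i j k l (- r) (- s))
    (ksign ((ipar M i + ipar M j) * (ipar M k + ipar M l)) * (hx M h E i j (- r) * hx M h' E k l (- s))
      - hx M h' E k l (- s) * hx M h E i j (- r) - tgt M h h' E i j k l (- r) (- s))"
    unfolding defect_def by (intro eqv_diff eqv_mult eqv_refl lat_ksign1 x tl)
  also have "ksign ((ipar M i + ipar M j) * (ipar M k + ipar M l)) * (hx M h E i j (- r) * hx M h' E k l (- s))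
      - hx M h' E k l (- s) * hx M h E i j (- r) - tgt M h h' E i j k l (- r) (- s)
     = of_int ?n * (ksign (?p + ?p') * lrel i j r k l s)"
    unfolding tg hx_def alg minus_minus lrel_def ..
  finally have "eqv 0 (of_int ?n * (ksign (?p + ?p') * lrel i j r k l s))"
    using defect_latI[OF t idx, of "- r" "- s"] eqv_latI eqv_sym eqv_trans by blast
  then have 1: "of_int ?n * (ksign (?p + ?p') * lrel i j r k l s) \<in> latI"
    using eqv_sym eqv_latI by blast
  have A: "of_int ?n \<in> A_loc" "evq (of_int ?n) = of_int ?n"
  proof -
    have "to_fract [:of_int n :: complex:] = of_int n" for n
    proof (induction n rule: int_induct[of _ 0])
      case (step1 i)
      have "[:of_int (i + 1) :: complex:] = [:of_int i:] + 1" by (simp add: one_pCons)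
      then show ?case using step1 by (simp only: to_fract_add to_fract_1 of_int_add of_int_1)
    next
      case (step2 i)
      have "[:of_int (i - 1) :: complex:] = [:of_int i:] - 1" by (simp add: one_pCons)
      then show ?case using step2 by (simp only: to_fract_diff to_fract_1 of_int_diff of_int_1)
    qed simp
    then show "of_int ?n \<in> A_loc" "evq (of_int ?n) = of_int ?n"
      using evq_const[of "of_int ?n"] by metis+
  qed
  have n0: "(of_int ?n :: complex) \<noteq> 0" using nz by simp
  then have i: "inverse (of_int ?n) \<in> A_loc" using evq_inverse(1)[OF A(1)] A(2) by metis
  have n1: "(of_int ?n :: ratfun) \<noteq> 0" using A(2) n0 evq_basic(3) by metis
  have "fscalar (inverse (of_int ?n)) * (fscalar (of_int ?n) * (ksign (?p + ?p') * lrel i j r k l s)) \<in> latI"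
    unfolding fscalar_of_int by (rule latI_smult[OF i 1])
  then have "ksign (?p + ?p') * lrel i j r k l s \<in> latI" by (simp only: fscalar_inv(2)[OF n1])
  then show ?thesis by (rule ksign_latI)
qed

text \<open>Each generator is taken from the series that \<open>lgen\<close> uses for it, and there
  its limit factor is nonzero. Of the four combinations one has no RTT relation of its own and is
  obtained from the super antisymmetry of the bracket.\<close>

lemma lrel_latI:
  assumes idx: "i \<in> idx M N" "j \<in> idx M N" "k \<in> idx M N" "l \<in> idx M N"
  shows "lrel i j r k l s \<in> latI"
proof -
  have h: "hT m n (- t) \<noteq> 0" if "t < 0 \<or> t = 0 \<and> m \<le> n" for m n t
    using that by (auto simp: hT_def)
  have ht: "hTt m n (- t) \<noteq> 0" if "\<not> (t < 0 \<or> t = 0 \<and> m \<le> n)" for m n t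
    using that by (auto simp: hTt_def hT_def)
  show ?thesis
  proof (cases "r < 0 \<or> r = 0 \<and> i \<le> j"; cases "s < 0 \<or> s = 0 \<and> k \<le> l")
    assume a: "r < 0 \<or> r = 0 \<and> i \<le> j" "s < 0 \<or> s = 0 \<and> k \<le> l"
    show ?thesis
      by (rule lrel_aux[where X = T_series and x = xT and h = hT and Y = T_series and y = xT and h' = hT, OF _ idx h[OF a(1)] h[OF a(2)]])
        (simp add: triples_def)
  next
    assume a: "r < 0 \<or> r = 0 \<and> i \<le> j" "\<not> (s < 0 \<or> s = 0 \<and> k \<le> l)"
    let ?t = "(ipar M i + ipar M j) * (ipar M k + ipar M l)"
    have t: "(ipar M k + ipar M l) * (ipar M i + ipar M j) = ?t" by (rule mult.commute)
    have 1: "lrel k l s i j r \<in> latI"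
      by (rule lrel_aux[where X = Tt_series and x = xTt and h = hTt and Y = T_series and y = xT and h' = hT, OF _ idx(3,4,1,2) ht[OF a(2)] h[OF a(1)]])
        (simp add: triples_def)
    have eq: "ksign u * (A * B) - B * A - (ksign u * C - D) = - (ksign u * (ksign u * (B * A) - A * B - (ksign u * D - C)))"
      for u and A B C D :: qfree
      by (cases u) (simp_all add: algebra_simps)
    have "lrel i j r k l s = - (ksign ?t * lrel k l s i j r)"
      unfolding lrel_def t by (subst eq) (simp only: add.commute[of s r] eq_commute[of l i] eq_commute[of j k])
    then show ?thesis
      using latI_uminus latI_smult[OF evq_ksign(1) 1, of ?t] by (simp only: fscalar_ksign)
  next
    assume a: "\<not> (r < 0 \<or> r = 0 \<and> i \<le> j)" "s < 0 \<or> s = 0 \<and> k \<le> l"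
    show ?thesis
      by (rule lrel_aux[where X = Tt_series and x = xTt and h = hTt and Y = T_series and y = xT and h' = hT, OF _ idx ht[OF a(1)] h[OF a(2)]])
        (simp add: triples_def)
  next
    assume a: "\<not> (r < 0 \<or> r = 0 \<and> i \<le> j)" "\<not> (s < 0 \<or> s = 0 \<and> k \<le> l)"
    show ?thesis
      by (rule lrel_aux[where X = Tt_series and x = xTt and h = hTt and Y = Tt_series and y = xTt and h' = hTt, OF _ idx ht[OF a(1)] ht[OF a(2)]])
        (simp add: triples_def)
  qed
qed

section \<open>The induced map on the enveloping algebra and a criterion for its bijectivity\<close>

sublocale L: presentation "loop_gens M N" "loop_par M" "loop_rels M N"
  by unfold_locales (rule loop_rels_carrier)

definition lift :: "(complex, loop_gen) free_alg \<Rightarrow> qfree"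
  where "lift = feval (\<lambda>c. fscalar (to_fract [:c:])) lgen"

lemma lift_simps:
  "lift 0 = 0" "lift 1 = 1" "lift (x + y) = lift x + lift y" "lift (x - y) = lift x - lift y"
  "lift (- x) = - lift x" "lift (x * y) = lift x * lift y"
  "lift (fscalar c) = fscalar (to_fract [:c:])" "lift (fgen g) = lgen g" "lift (ksign p * x) = ksign p * lift x"
proof -
  interpret li: central_scalars "\<lambda>c. fscalar (to_fract [:c:]) :: qfree"
    by (rule central_scalars_const)
  show "lift 0 = 0" "lift 1 = 1" "lift (x + y) = lift x + lift y" "lift (x - y) = lift x - lift y"
    "lift (- x) = - lift x" "lift (x * y) = lift x * lift y"
    "lift (fscalar c) = fscalar (to_fract [:c:])" "lift (fgen g) = lgen g" "lift (ksign p * x) = ksign p * lift x"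
    unfolding lift_def
    by (cases p; simp add: li.feval_add li.feval_diff li.feval_uminus li.feval_mult li.feval_one
      li.feval_fscalar li.feval_fgen)+
qed

lemma lgen_lat': "g \<in> loop_gens M N \<Longrightarrow> lgen g \<in> lat"
  by (cases g) (simp only: loop_gens_iff lgen_lat)

lemma lift_lat: "x \<in> carrier L.F \<Longrightarrow> lift x \<in> lat"
  by (induction x rule: carrier_free_induct)
    (simp_all only: lift_simps lat_closed lat_fscalar evq_const lgen_lat' lat_zero)

lemma lift_rel: "lift (loop_rel M i j r k l s)
    = ksign ((ipar M i + ipar M j) * (ipar M k + ipar M l)) * lrel i j r k l s"
proof -
  have if_lift: "lift (if c then x else y) = (if c then lift x else lift y)" for c x y by simp
  show ?thesis
    unfolding loop_rel_def Let_def lrel_def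
    by (cases "(ipar M i + ipar M j) * (ipar M k + ipar M l)")
      (simp_all only: ksign_simps lift_simps if_lift mult_1_left mult_minus_left minus_minus
        diff_conv_add_uminus minus_add_distrib add_ac)
qed

lemma lift_J: "x \<in> L.J \<Longrightarrow> lift x \<in> latI"
proof -
  assume x: "x \<in> L.J"
  have "ideal {x \<in> carrier L.F. lift x \<in> latI} L.F" (is "ideal ?K _")
  proof (rule idealI)
    show "ring L.F" by (rule ring_free_superalgebra)
    show "subgroup ?K (add_monoid L.F)"
    proof (rule L.F.add.subgroupI)
      show "?K \<noteq> {}" using L.carrier_closed(1) lift_simps(1) latI_zero by force
    qed (auto simp: L.a_inv_F lift_simps latI_add latI_uminus L.carrier_closed simp flip: a_inv_def)
  qed (auto simp: lift_simps L.carrier_closed intro: latI_lmult latI_rmult lift_lat)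
  moreover have "loop_rels M N \<subseteq> ?K"
  proof
    fix x assume "x \<in> loop_rels M N"
    then obtain i j r k l s where x: "x = loop_rel M i j r k l s"
      and idx: "i \<in> idx M N" "j \<in> idx M N" "k \<in> idx M N" "l \<in> idx M N"
      by (auto simp: loop_rels_def)
    have "lift x \<in> latI" unfolding x lift_rel
      using latI_smult[OF evq_ksign(1) lrel_latI[OF idx, of r s]] by (simp only: fscalar_ksign)
    then show "x \<in> ?K" using \<open>x \<in> loop_rels M N\<close> loop_rels_carrier by blast
  qed
  ultimately have "L.J \<subseteq> ?K"
    unfolding rel_ideal_def by (rule L.F.genideal_minimal)
  then show ?thesis using x by blast
qed

lemma gam_homog:
  assumes "i \<in> idx M N" "j \<in> idx M N"
  shows "gam i j r \<in> homog F (ipar M i + ipar M j)" "gamt i j r \<in> homog F (ipar M i + ipar M j)"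
proof -
  have 1: "x - 1 \<in> homog F 0" if "x \<in> homog F 0" for x
    using homog_closed(1)[OF that homog_closed(2)[OF homog_closed(5)]] by simp
  have "fgen (QT i i 0) - 1 \<in> homog F 0" "fgen (QTt i i 0) - 1 \<in> homog F 0"
    using 1[of "fgen (QT i i 0)"] 1[of "fgen (QTt i i 0)"] assms
      homog_closed(4)[of "QT i i 0" "qloop_gens M N" "qloop_par M"]
      homog_closed(4)[of "QTt i i 0" "qloop_gens M N" "qloop_par M"] by simp_all
  moreover have "fgen (QT i j r) \<in> homog F (ipar M i + ipar M j)"
    "fgen (QTt i j r) \<in> homog F (ipar M i + ipar M j)"
    using homog_closed(4)[of "QT i j r" "qloop_gens M N" "qloop_par M"]
      homog_closed(4)[of "QTt i j r" "qloop_gens M N" "qloop_par M"] assms by simp_all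
  ultimately show "gam i j r \<in> homog F (ipar M i + ipar M j)" "gamt i j r \<in> homog F (ipar M i + ipar M j)"
    unfolding gam_def gamt_def by (auto intro!: homog_closed(3))
qed

lemma lgen_homog: "g \<in> loop_gens M N \<Longrightarrow> lgen g \<in> homog F (loop_par M g)"
proof (cases g)
  case (LE i j r)
  assume "g \<in> loop_gens M N"
  then have ij: "i \<in> idx M N" "j \<in> idx M N" using LE by simp_all
  have ks: "ksign p * x \<in> homog F (ipar M i + ipar M j)" if "x \<in> homog F (ipar M i + ipar M j)" for p and x :: qfree
    using homog_closed(3)[OF that, of "ksign p"] by (simp only: fscalar_ksign)
  show ?thesis unfolding LE lgen.simps loop_par.simps
    by (intro if_in homog_closed(2) ks gam_homog ij)
qed

lemma lift_homog:
  assumes "x \<in> homog L.F p" shows "lift x \<in> homog F p"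
proof -
  have "prod_list (map lgen u) \<in> homog F (sum_list (map (loop_par M) u))" if "set u \<subseteq> loop_gens M N" for u
    using that
  proof (induction u)
    case (Cons g u)
    then have "lgen g \<in> homog F (loop_par M g)" "prod_list (map lgen u) \<in> homog F (sum_list (map (loop_par M) u))"
      using lgen_homog by auto
    from homog_mult[OF this] show ?case by simp
  qed (simp add: homog_closed)
  then show ?thesis
    unfolding lift_def feval_def using assms
    by (intro homog_sum_list homog_closed(3)) (auto simp: free_superalgebra_def word_parity_def)
qed

text \<open>The lattice generators outside the image of \<open>lgen\<close> are either relations or,
  on the diagonal in degree 0, negatives of generators in the image modulo
  \<open>q - 1\<close>.\<close>

lemma lift_onto:
  assumes "x \<in> lat" obtains y where "y \<in> carrier L.F" "x - lift y \<in> latI"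
proof -
  have "\<exists>y\<in>carrier L.F. x - lift y \<in> latI"
    using assms
  proof (induction rule: lat_induct)
    case (ideal x y)
    then obtain z where z: "z \<in> carrier L.F" "x - lift z \<in> latI" by blast
    then have "x + y - lift z \<in> latI" using latI_add[OF z(2) J_latI[OF ideal(2)]] by (simp add: algebra_simps)
    then show ?case using z by blast
  next
    case one
    show ?case using L.carrier_closed(2) by (auto intro!: bexI[of _ 1] simp: lift_simps latI_zero)
  next
    case (gam i j r)
    show ?case
    proof (cases "r = 0 \<and> j < i")
      case True
      then have "fgen (QT i j 0) \<in> qloop_rels M N" using gam by (auto simp: qloop_rels_eq)
      then have "gam i j r \<in> latI" using True by (simp add: gam_def J_rels J_scalar J_latI)
      then show ?thesis using L.carrier_closed(1) by (auto intro!: bexI[of _ 0] simp: lift_simps)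
    next
      case False
      then have "lift (ksign (ipar M i * ipar M j) * fgen (LE i j (- int r))) = gam i j r"
        by (simp only: lift_simps(9,8)) auto
      then show ?thesis using gam latI_zero
        by (intro bexI[of _ "ksign (ipar M i * ipar M j) * fgen (LE i j (- int r))"] ksign_carrier)
          (simp_all add: free_closed)
    qed
  next
    case (gamt i j r)
    consider "r = 0 \<and> i < j" | "r = 0 \<and> i = j" | "r > 0 \<or> j < i" by linarith
    then show ?case
    proof cases
      case 1
      then have "fgen (QTt i j 0) \<in> qloop_rels M N" using gamt by (auto simp: qloop_rels_eq)
      then have "gamt i j r \<in> latI" using 1 by (simp add: gamt_def J_rels J_scalar J_latI)
      then show ?thesis using L.carrier_closed(1) by (auto intro!: bexI[of _ 0] simp: lift_simps)
    next
      case 2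
      let ?y = "- (ksign (ipar M i * ipar M i) * fgen (LE i i 0)) :: (complex, loop_gen) free_alg"
      have "lift ?y = - gam i i 0" by (simp only: lift_simps(5,9,8)) simp
      moreover have "eqv (gamt i i 0) (- gam i i 0)" using gam_gamt gamt by blast
      ultimately have "gamt i j r - lift ?y \<in> latI" using 2 by (simp add: eqv_def)
      moreover have "?y \<in> carrier L.F" using gamt by (intro L.carrier_closed(8) ksign_carrier L.carrier_closed(4)) simp
      ultimately show ?thesis by blast
    next
      case 3
      let ?y = "- (ksign (ipar M i * ipar M j) * fgen (LE i j (int r))) :: (complex, loop_gen) free_alg"
      have "lift ?y = gamt i j r" using 3 by (simp only: lift_simps(5,9,8)) auto
      moreover have "?y \<in> carrier L.F" using gamt by (intro L.carrier_closed(8) ksign_carrier L.carrier_closed(4)) simp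
      ultimately show ?thesis using latI_zero by (intro bexI[of _ ?y]) simp_all
    qed
  next
    case (add x y)
    then obtain x' y' where *: "x' \<in> carrier L.F" "x - lift x' \<in> latI" "y' \<in> carrier L.F" "y - lift y' \<in> latI" by blast
    have "x + y - lift (x' + y') \<in> latI"
      using latI_add[OF *(2,4)] by (simp add: lift_simps add_diff_add)
    then show ?case using L.carrier_closed(5)[OF *(1,3)] by blast
  next
    case (mult x y)
    then obtain x' y' where *: "x' \<in> carrier L.F" "x - lift x' \<in> latI" "y' \<in> carrier L.F" "y - lift y' \<in> latI" by blast
    have "x * y - lift (x' * y') = (x - lift x') * y + lift x' * (y - lift y')"
      by (simp add: lift_simps algebra_simps)
    then have "x * y - lift (x' * y') \<in> latI"
      using latI_add[OF latI_rmult[OF *(2) mult(2)] latI_lmult[OF *(4) lift_lat[OF *(1)]]] by simp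
    then show ?case using L.carrier_closed(7)[OF *(1,3)] by blast
  next
    case (smult c x)
    then obtain x' where *: "x' \<in> carrier L.F" "x - lift x' \<in> latI" by blast
    \<comment> \<open>A scalar of \<open>A_loc\<close> is a complex constant plus a multiple of
      \<open>q - 1\<close>, and the latter only contributes to \<open>latI\<close>.\<close>
    obtain d where d: "d \<in> A_loc" "c = to_fract [:evq c:] + eps * d" using evq_split[OF smult(1)] .
    let ?c = "fscalar (to_fract [:evq c:]) :: qfree"
    have "fscalar c * x - lift (fscalar (evq c) * x') = ?c * (x - lift x') + fscalar eps * (fscalar d * x)"
      by (subst d(2)) (simp add: lift_simps fscalar_add fscalar_mult algebra_simps)
    then have "fscalar c * x - lift (fscalar (evq c) * x') \<in> latI"
      using latI_add[OF latI_smult[OF evq_const(1) *(2)] latI_eps[OF lat_closed(6)[OF d(1) smult(2)]]] by simp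
    then show ?case using L.carrier_closed(7)[OF L.carrier_closed(3) *(1)] by blast
  qed
  then show ?thesis using that by blast
qed

definition psi :: "(complex, loop_gen) free_alg set \<Rightarrow> qfree set set"
  where "psi X = spec (lift (SOME x. x \<in> carrier L.F \<and> X = L.cls x))"

lemma psi_cls: "x \<in> carrier L.F \<Longrightarrow> psi (L.cls x) = spec (lift x)"
proof -
  assume x: "x \<in> carrier L.F"
  let ?y = "SOME y. y \<in> carrier L.F \<and> L.cls x = L.cls y"
  have y: "?y \<in> carrier L.F" "L.cls x = L.cls ?y"
    using someI[of "\<lambda>y. y \<in> carrier L.F \<and> L.cls x = L.cls y" x] x by blast+
  then have "x - ?y \<in> L.J" using x by (simp only: L.cls_eq)
  then have "lift ?y - lift x \<in> latI"
    using latI_uminus[OF lift_J] by (force simp: lift_simps)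
  then show ?thesis unfolding psi_def using x y by (simp only: spec_eq lift_lat)
qed

lemma U_loop: "U_loop M N = L.P"
  by (rule U_loop_def)

text \<open>Surjectivity is \<open>lift_onto\<close>. Injectivity is isolated as the hypothesis,
  which the tensor representations later supply.\<close>

lemma psi_iso:
  assumes faithful: "\<And>x. x \<in> carrier L.F \<Longrightarrow> lift x \<in> latI \<Longrightarrow> x \<in> L.J"
  shows "psi \<in> superalgebra_iso (U_loop M N) (U_spec M N)"
proof -
  have "psi \<in> ring_hom L.P (U_spec M N)"
    by (rule ring_hom_memI)
      (auto simp: L.P_simps U_spec_simps psi_cls L.carrier_closed lift_lat lift_simps)
  moreover have "psi (c \<odot>\<^bsub>L.P\<^esub> X) = c \<odot>\<^bsub>U_spec M N\<^esub> psi X" if "X \<in> carrier L.P" for c X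
    using that by (auto simp: L.P_simps L.P_smult U_spec_simps psi_cls L.carrier_closed lift_lat lift_simps)
  moreover have "psi X \<in> homog (U_spec M N) p" if X: "X \<in> homog L.P p" for p X
  proof -
    obtain x where x: "x \<in> homog L.F p" "X = L.cls x" using X by (auto simp: L.P_simps)
    then have "x \<in> carrier L.F" by (auto simp: free_superalgebra_def)
    then show ?thesis using x lift_homog lift_lat by (simp add: psi_cls U_spec_simps(6))
  qed
  moreover have "bij_betw psi (carrier L.P) (carrier (U_spec M N))"
  proof (rule bij_betwI')
    fix X Y assume "X \<in> carrier L.P" "Y \<in> carrier L.P"
    then obtain x y where *: "x \<in> carrier L.F" "X = L.cls x" "y \<in> carrier L.F" "Y = L.cls y"
      by (auto simp: L.P_simps)
    have "lift (x - y) \<in> latI \<Longrightarrow> x - y \<in> L.J" by (rule faithful[OF L.carrier_closed(6)[OF *(1,3)]])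
    moreover have "x - y \<in> L.J \<Longrightarrow> lift (x - y) \<in> latI" by (rule lift_J)
    ultimately have "lift (x - y) \<in> latI \<longleftrightarrow> x - y \<in> L.J" by blast
    then show "psi X = psi Y \<longleftrightarrow> X = Y"
      using * by (simp add: psi_cls spec_eq lift_lat L.cls_eq lift_simps(4))
  next
    fix X assume "X \<in> carrier L.P"
    then show "psi X \<in> carrier (U_spec M N)"
      by (auto simp: L.P_simps psi_cls U_spec_simps lift_lat)
  next
    fix Z assume "Z \<in> carrier (U_spec M N)"
    then obtain x where x: "x \<in> lat" "Z = spec x" by (auto simp: U_spec_simps)
    obtain y where y: "y \<in> carrier L.F" "x - lift y \<in> latI" using lift_onto[OF x(1)] .
    have "Z = psi (L.cls y)" using x y by (simp only: psi_cls spec_eq lift_lat)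
    then show "\<exists>X\<in>carrier L.P. Z = psi X" using y(1) by (auto simp: L.P_simps)
  qed
  ultimately show ?thesis
    by (auto simp: superalgebra_iso_def superalgebra_hom_def U_loop)
qed

lemma psi_E:
  assumes "i \<in> idx M N" "j \<in> idx M N"
  shows "psi (loop_E M N i j r) = spec (E i j r)"
  unfolding loop_E_def presented_gen_def using assms by (simp only: psi_cls L.carrier_closed loop_gens_iff lift_simps)

lemma spec_smult:
  assumes "i \<in> idx M N" "j \<in> idx M N"
  shows "ksign p \<odot>\<^bsub>U_spec M N\<^esub> spec_class M N (gamma M N i j r) = spec (ksign p * gam i j r)"
    "(- ksign p) \<odot>\<^bsub>U_spec M N\<^esub> spec_class M N (gammat M N i j r) = spec (- (ksign p * gamt i j r))"
proof -
  have c: "fscalar (to_fract [:ksign p:]) = (ksign p :: qfree)" "fscalar (to_fract [:- ksign p:]) = - (ksign p :: qfree)"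
  proof -
    have "fscalar (to_fract [:1:]) = (1 :: qfree)" by (simp add: fscalar_one flip: one_pCons)
    moreover have "fscalar (to_fract [:- 1:]) = - (1 :: qfree)"
    proof -
      have "[:- 1 :: complex:] = - 1" by (simp add: one_pCons)
      then have "to_fract [:- 1 :: complex:] = - 1" by simp
      then show ?thesis by (simp only: fs.h_minus fscalar_one)
    qed
    ultimately show "fscalar (to_fract [:ksign p:]) = (ksign p :: qfree)" "fscalar (to_fract [:- ksign p:]) = - (ksign p :: qfree)"
      by (cases p; simp)+
  qed
  show "ksign p \<odot>\<^bsub>U_spec M N\<^esub> spec_class M N (gamma M N i j r) = spec (ksign p * gam i j r)"
    unfolding gamma_cls[OF assms] spec_def[symmetric] U_spec_simps(5)[OF lat_closed(2)[OF assms]] c ..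
  show "(- ksign p) \<odot>\<^bsub>U_spec M N\<^esub> spec_class M N (gammat M N i j r) = spec (- (ksign p * gamt i j r))"
    unfolding gamma_cls[OF assms] spec_def[symmetric] U_spec_simps(5)[OF lat_closed(3)[OF assms]] c
    by simp
qed

lemma psi_formulas:
  assumes ij: "i \<in> idx M N" "j \<in> idx M N"
  shows "i \<le> j \<Longrightarrow> psi (loop_E M N i j 0)
         = ksign (ipar M i * ipar M j) \<odot>\<^bsub>U_spec M N\<^esub> spec_class M N (gamma M N i j 0)"
    "i \<le> j \<Longrightarrow> psi (loop_E M N j i 0)
         = (- ksign (ipar M i * ipar M j)) \<odot>\<^bsub>U_spec M N\<^esub> spec_class M N (gammat M N j i 0)"
    "r > 0 \<Longrightarrow> psi (loop_E M N i j (- int r))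
         = ksign (ipar M i * ipar M j) \<odot>\<^bsub>U_spec M N\<^esub> spec_class M N (gamma M N i j r)"
    "r > 0 \<Longrightarrow> psi (loop_E M N i j (int r))
         = (- ksign (ipar M i * ipar M j)) \<odot>\<^bsub>U_spec M N\<^esub> spec_class M N (gammat M N i j r)"
proof -
  show "psi (loop_E M N j i 0)
         = (- ksign (ipar M i * ipar M j)) \<odot>\<^bsub>U_spec M N\<^esub> spec_class M N (gammat M N j i 0)" if "i \<le> j"
  proof (cases "i = j")
    case True
    \<comment> \<open>For \<open>i = j\<close> the theorem prescribes two images of the same
      element; they agree by \<open>gam_gamt\<close>.\<close>
    have "eqv (gam j j 0) (- gamt j j 0)"
      using eqv_uminus[OF gam_gamt[OF ij(2)]] eqv_sym by fastforce
    then have "eqv (ksign (ipar M j * ipar M j) * gam j j 0) (- (ksign (ipar M j * ipar M j) * gamt j j 0))"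
      using eqv_mult[OF eqv_refl[OF lat_ksign1]] by fastforce
    then have "spec (ksign (ipar M j * ipar M j) * gam j j 0) = spec (- (ksign (ipar M j * ipar M j) * gamt j j 0))"
      by (simp only: eqv_def spec_eq)
    then show ?thesis
      unfolding True psi_E[OF ij(2,2)] spec_smult[OF ij(2,2)] by simp
  next
    case False
    then show ?thesis using that
      unfolding psi_E[OF ij(2,1)] spec_smult[OF ij(2,1)] by (simp add: mult.commute)
  qed
qed (simp_all add: psi_E spec_smult ij)

end

section \<open>Linear operators on spaces of functions\<close>

typedef (overloaded) ('s, 'k) linop =
  "{F :: ('s \<Rightarrow> 'k::comm_ring_1) \<Rightarrow> ('s \<Rightarrow> 'k).
    (\<forall>f g. F (\<lambda>s. f s + g s) = (\<lambda>s. F f s + F g s)) \<and> (\<forall>c f. F (\<lambda>s. c * f s) = (\<lambda>s. c * F f s))}"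
  morphisms app Linop
  by (rule exI[of _ id]) simp

setup_lifting type_definition_linop

lemma app_fadd: "app A (\<lambda>s. f s + g s) = (\<lambda>s. app A f s + app A g s)"
  using app[of A] by simp

lemma app_fmult: "app A (\<lambda>s. c * f s) = (\<lambda>s. c * app A f s)"
  using app[of A] by simp

instantiation linop :: (type, comm_ring_1) ring_1
begin

lift_definition zero_linop :: "('a, 'b) linop" is "\<lambda>f s. 0" by simp
lift_definition one_linop :: "('a, 'b) linop" is "\<lambda>f. f" by simp
lift_definition plus_linop :: "('a, 'b) linop \<Rightarrow> ('a, 'b) linop \<Rightarrow> ('a, 'b) linop"
  is "\<lambda>A B f s. A f s + B f s"
  by (simp add: fun_eq_iff algebra_simps)
lift_definition minus_linop :: "('a, 'b) linop \<Rightarrow> ('a, 'b) linop \<Rightarrow> ('a, 'b) linop"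
  is "\<lambda>A B f s. A f s - B f s"
  by (simp add: fun_eq_iff algebra_simps)
lift_definition uminus_linop :: "('a, 'b) linop \<Rightarrow> ('a, 'b) linop"
  is "\<lambda>A f s. - A f s"
  by (simp add: fun_eq_iff)
lift_definition times_linop :: "('a, 'b) linop \<Rightarrow> ('a, 'b) linop \<Rightarrow> ('a, 'b) linop"
  is "\<lambda>A B f. A (B f)"
  by simp

instance
proof
  fix A B C :: "('a, 'b) linop"
  show "A * B * C = A * (B * C)" "1 * A = A" "A * 1 = A" "A + B + C = A + (B + C)"
    "0 + A = A" "A + B = B + A" "- A + A = 0" "A - B = A + - B" "(A + B) * C = A * C + B * C"
    "A * (B + C) = A * B + A * C"
    by (transfer; simp add: fun_eq_iff algebra_simps)+
  show "(0 :: ('a, 'b) linop) \<noteq> 1"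
    by transfer (auto simp: fun_eq_iff intro!: exI[of _ "\<lambda>_. 1"])
qed

end

lift_definition sc :: "'k::comm_ring_1 \<Rightarrow> ('s, 'k) linop" is "\<lambda>c f s. c * f s"
  by (simp add: fun_eq_iff algebra_simps)

text \<open>An operator touching a single coordinate. Operators on different coordinates commute
  outright, so every super sign has to be written explicitly.\<close>

lift_definition slot :: "nat \<Rightarrow> ('l \<Rightarrow> 'k) \<Rightarrow> ('l \<Rightarrow> 'l) \<Rightarrow> (nat \<Rightarrow> 'l, 'k::comm_ring_1) linop"
  is "\<lambda>n c \<tau> f s. c (s n) * f (s(n := \<tau> (s n)))"
  by (simp add: fun_eq_iff algebra_simps)

lemma app_simps:
  "app 0 f s = 0" "app 1 f = f" "app (A + B) f s = app A f s + app B f s"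
  "app (A - B) f s = app A f s - app B f s" "app (- A) f s = - app A f s"
  "app (A * B) f = app A (app B f)" "app (sc c) f s = c * f s"
  by (transfer; simp)+

lemma app_slot: "app (slot n d \<tau>) f s = d (s n) * f (s(n := \<tau> (s n)))"
  by transfer simp

lemma linop_eqI: "(\<And>f s. app A f s = app B f s) \<Longrightarrow> A = B"
  by (rule app_inject[THEN iffD1]) (intro ext)

lemma app_ksign: "app (ksign p * A) f s = ksign p * app A f s" "app (ksign p) f s = ksign p * f s"
  by (cases p; simp only: ksign_simps app_simps mult_1_left mult_minus_left)+

lemma sc_add: "sc (a + b) = sc a + sc b" and sc_mult: "sc (a * b) = sc a * sc b" and sc_one: "sc 1 = 1"
  by (transfer; simp add: fun_eq_iff algebra_simps)+

lemma sc_comm: "sc a * A = A * sc a"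
  by transfer (simp add: fun_eq_iff)

lemma central_scalars_sc: "central_scalars (sc :: 'k::field \<Rightarrow> ('s, 'k) linop)"
  by standard (auto simp: sc_add sc_mult sc_one intro: sc_comm)

lemma slot_comm: "m \<noteq> n \<Longrightarrow> slot m c \<tau> * slot n d \<sigma> = slot n d \<sigma> * slot m c \<tau>"
  by (rule linop_eqI) (simp add: app_simps app_slot fun_upd_twist mult.left_commute)

type_synonym letter = "nat \<times> int"
type_synonym 'k seqop = "(nat \<Rightarrow> letter, 'k) linop"

definition mE :: "nat \<Rightarrow> nat \<Rightarrow> nat \<Rightarrow> int \<Rightarrow> 'k::comm_ring_1 seqop"
  where "mE n a b r = slot n (\<lambda>z. if fst z = a then 1 else 0) (\<lambda>z. (b, snd z + r))"

definition sg :: "nat \<Rightarrow> nat \<Rightarrow> bit \<Rightarrow> 'k::comm_ring_1 seqop"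
  where "sg M n p = slot n (\<lambda>z. ksign (p * ipar M (fst z))) id"

lemma app_mE: "app (mE n a b r) f s = (if fst (s n) = a then f (s(n := (b, snd (s n) + r))) else 0)"
  by (simp add: mE_def app_slot)

lemma app_sg: "app (sg M n p) f s = ksign (p * ipar M (fst (s n))) * f s"
  by (simp add: sg_def app_slot)

lemma mE_mult: "mE n a b r * mE n c d t = (if b = c then mE n a d (r + t) else 0)"
  by (rule linop_eqI) (simp add: app_simps app_mE add.assoc)

lemma sg_mE: "sg M n p * mE n a b r = ksign (p * ipar M a) * mE n a b r"
  by (rule linop_eqI) (simp add: app_simps app_mE app_sg app_ksign)

lemma mE_sg: "mE n a b r * sg M n p = ksign (p * ipar M b) * mE n a b r"
  by (rule linop_eqI) (simp add: app_simps app_mE app_sg app_ksign)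

lemma sg_sg: "sg M n p * sg M n p' = sg M n (p + p')"
  by (rule linop_eqI) (simp add: app_simps app_sg ksign_add distrib_right)

lemma sg_0: "sg M n 0 = 1"
  by (rule linop_eqI) (simp add: app_simps app_sg)

section \<open>Tensor products of vector representations of the loop algebra\<close>

text \<open>
  Sequences of letters \<open>(k, t)\<close> index a basis \<open>v\<^sub>k x\<^sup>t\<close> in each tensor factor; a letter \<open>k\<close>
  outside the index set spans a trivial summand of parity \<open>|k|\<close>. Operators act dually, on functions on
  the basis. The factor \<open>sg\<close> carries the sign rule for tensor products.
\<close>

fun lop :: "nat \<Rightarrow> nat \<Rightarrow> loop_gen \<Rightarrow> 'k::comm_ring_1 seqop"
  where "lop M n (LE i j r) = - (ksign (ipar M i * ipar M j + ipar M i) * mE n j i r)"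

fun gop :: "nat \<Rightarrow> nat \<Rightarrow> loop_gen \<Rightarrow> 'k::comm_ring_1 seqop"
  where
    "gop M 0 x = 0"
  | "gop M (Suc n) x = gop M n x * sg M n (loop_par M x) + lop M n x"

lemma slot_lop_comm: "m \<noteq> n \<Longrightarrow> slot m c \<tau> * lop M n x = lop M n x * slot m c \<tau>"
proof (cases x)
  case (LE i j r)
  assume "m \<noteq> n"
  then have "slot m c \<tau> * mE n j i r = mE n j i r * slot m c \<tau>"
    unfolding mE_def by (rule slot_comm)
  then show ?thesis unfolding LE
    by (cases "ipar M i * ipar M j + ipar M i") simp_all
qed

lemma slot_gop_comm: "n \<le> m \<Longrightarrow> slot m c \<tau> * gop M n x = gop M n x * slot m c \<tau>"
proof (induction n)
  case (Suc n)
  then have "slot m c \<tau> * sg M n p = sg M n p * slot m c \<tau>" for p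
    unfolding sg_def by (intro slot_comm) simp
  note 1 = this
  have IH: "slot m c \<tau> * gop M n x = gop M n x * slot m c \<tau>"
    and 2: "slot m c \<tau> * lop M n x = lop M n x * slot m c \<tau>"
    using Suc slot_lop_comm[of m n c \<tau> M x] by simp_all
  have "slot m c \<tau> * (gop M n x * sg M n (loop_par M x)) = gop M n x * sg M n (loop_par M x) * slot m c \<tau>"
    unfolding mult.assoc[symmetric] IH unfolding mult.assoc 1 ..
  then show ?case
    by (simp only: gop.simps distrib_left distrib_right 2)
qed simp

lemma lop_gop_comm: "lop M n x * gop M n y = gop M n y * lop M n x"
proof (cases x)
  case (LE i j r)
  have "mE n j i r * gop M n y = gop M n y * mE n j i r"
    unfolding mE_def by (rule slot_gop_comm) simp
  then show ?thesis unfolding LE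
    by (cases "ipar M i * ipar M j + ipar M i") simp_all
qed

lemma sg_lop: "sg M n p * lop M n x = ksign (p * loop_par M x) * (lop M n x * sg M n p)"
proof (cases x)
  case (LE i j r)
  show ?thesis unfolding LE
    by (cases "ipar M i"; cases "ipar M j"; cases p; simp add: sg_mE mE_sg)
qed

definition lbr :: "nat \<Rightarrow> (loop_gen \<Rightarrow> 'b::ring_1) \<Rightarrow> loop_gen \<Rightarrow> loop_gen \<Rightarrow> 'b"
  where "lbr M \<phi> x y = (case x of LE i j r \<Rightarrow> case y of LE k l s \<Rightarrow>
    (if j = k then \<phi> (LE i l (r + s)) else 0)
    - ksign (loop_par M x * loop_par M y) * (if i = l then \<phi> (LE k j (r + s)) else 0))"

text \<open>\<open>lop\<close> is minus the supertranspose, the action on the dual of the vector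
  representation; the sign \<open>|i||j| + |i|\<close> makes it respect the superbracket.\<close>

lemma lop_bracket:
  "lop M n x * lop M n y - ksign (loop_par M x * loop_par M y) * (lop M n y * lop M n x) = lbr M (lop M n) x y"
proof (cases x; cases y)
  fix i j r k l s assume xy: "x = LE i j r" "y = LE k l s"
  show ?thesis unfolding xy lbr_def
    by (cases "ipar M i"; cases "ipar M j"; cases "ipar M k"; cases "ipar M l";
        simp add: mE_mult; simp add: add.commute; intro conjI impI; simp)
qed

text \<open>A letter in the last factor passes the parity operator with the sign of the
  superbracket, so the mixed terms cancel. In what remains the two parity operators multiply to the
  one belonging to the bracket.\<close>

lemma gop_bracket:
  "gop M n x * gop M n y - ksign (loop_par M x * loop_par M y) * (gop M n y * gop M n x) = lbr M (gop M n) x y"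
proof (induction n)
  case 0
  show ?case by (simp add: lbr_def split: loop_gen.split)
next
  case (Suc n)
  let ?e = "ksign (loop_par M x * loop_par M y) :: 'a seqop"
  let ?gx = "gop M n x :: 'a seqop" and ?gy = "gop M n y :: 'a seqop"
  let ?lx = "lop M n x :: 'a seqop" and ?ly = "lop M n y :: 'a seqop"
  let ?sx = "sg M n (loop_par M x) :: 'a seqop" and ?sy = "sg M n (loop_par M y) :: 'a seqop"
  have sgc: "sg M n p * gop M n z = gop M n z * sg M n p" for p z
    unfolding sg_def by (rule slot_gop_comm) simp
  have t1: "(?gx * ?sx) * (?gy * ?sy) = ?gx * ?gy * sg M n (loop_par M x + loop_par M y)"
    unfolding sg_sg[symmetric] mult.assoc[symmetric] unfolding mult.assoc[of _ ?sx] sgc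
    unfolding mult.assoc ..
  have t2: "(?gy * ?sy) * (?gx * ?sx) = ?gy * ?gx * sg M n (loop_par M x + loop_par M y)"
    unfolding add.commute[of "loop_par M x"] sg_sg[symmetric] mult.assoc[symmetric]
    unfolding mult.assoc[of _ ?sy] sgc unfolding mult.assoc ..
  have t3: "(?gx * ?sx) * ?ly = ?e * (?ly * (?gx * ?sx))"
  proof -
    have "(?gx * ?sx) * ?ly = ?gx * (?e * (?ly * ?sx))" by (simp add: mult.assoc sg_lop)
    also have "\<dots> = ?e * (?gx * ?ly * ?sx)" by (cases "loop_par M x * loop_par M y") (simp_all add: mult.assoc)
    finally show ?thesis by (simp add: lop_gop_comm mult.assoc[symmetric])
  qed
  have t4: "?e * ((?gy * ?sy) * ?lx) = ?lx * (?gy * ?sy)"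
  proof -
    have "?e * ((?gy * ?sy) * ?lx) = ?e * (?gy * (?e * (?lx * ?sy)))" by (simp add: mult.assoc sg_lop mult.commute[of "loop_par M x"])
    also have "\<dots> = ?gy * ?lx * ?sy" by (cases "loop_par M x * loop_par M y") (simp_all add: mult.assoc)
    finally show ?thesis by (simp add: lop_gop_comm mult.assoc[symmetric])
  qed
  have par: "loop_par M z = loop_par M x + loop_par M y"
    if "x = LE i j r" "y = LE k l s" "z = LE i l t \<and> j = k \<or> z = LE k j t \<and> i = l" for z i j r k l s t
    using that by (cases "ipar M i"; cases "ipar M j"; cases "ipar M k"; cases "ipar M l"; auto)
  have alg: "(A + B) * (C + D) - e * ((C + D) * (A + B)) = (A * C - e * (C * A)) + (B * D - e * (D * B))
       + (A * D - e * (D * A)) + (B * C - e * (C * B))" for A B C D e :: "'a seqop"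
    by (simp add: algebra_simps)
  have "gop M (Suc n) x * gop M (Suc n) y - ?e * (gop M (Suc n) y * gop M (Suc n) x)
     = (?gx * ?gy - ?e * (?gy * ?gx)) * sg M n (loop_par M x + loop_par M y) + (?lx * ?ly - ?e * (?ly * ?lx))
       + ((?gx * ?sx) * ?ly - ?e * (?ly * (?gx * ?sx))) + (?lx * (?gy * ?sy) - ?e * ((?gy * ?sy) * ?lx))"
    unfolding gop.simps alg t1 t2 by (simp only: left_diff_distrib mult.assoc)
  also have "\<dots> = lbr M (gop M n) x y * sg M n (loop_par M x + loop_par M y) + lbr M (lop M n) x y"
    unfolding t3 t4 Suc lop_bracket by simp
  also have "\<dots> = lbr M (gop M (Suc n)) x y"
  proof (cases x; cases y)
    fix i j r k l s assume xy: "x = LE i j r" "y = LE k l s"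
    have 1: "j = k \<Longrightarrow> loop_par M (LE i l (r + s)) = loop_par M x + loop_par M y"
      "i = l \<Longrightarrow> loop_par M (LE k j (r + s)) = loop_par M x + loop_par M y"
      using par[OF xy] by blast+
    show ?thesis
      unfolding lbr_def xy[symmetric]
      unfolding xy(1) xy(2) loop_gen.case
      using 1[unfolded xy] by (cases "j = k"; cases "i = l"; simp only: if_True if_False gop.simps simp_thms
          mult_zero_right mult_zero_left diff_0_right diff_0 distrib_left left_diff_distrib mult.assoc add_0_right;
          simp only: diff_conv_add_uminus minus_add_distrib add_ac minus_zero add_0_left add_0_right mult_minus_left mult.assoc)
  qed
  finally show ?case .
qed

section \<open>The tensor representations are jointly faithful\<close>

lemma app_sum_list: "app A (\<lambda>s. \<Sum>x\<leftarrow>xs. f x s) = (\<lambda>s. \<Sum>x\<leftarrow>xs. app A (f x) s)"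
proof (induction xs)
  case Nil
  show ?case using app_fmult[of A 0 "\<lambda>_. 0"] by simp
qed (simp add: app_fadd)

text \<open>A letter outside the index set with the same parity as \<open>i\<close>: the letter 0 is
  even and \<open>M + N + 1\<close> is odd.\<close>

definition triv :: "nat \<Rightarrow> nat \<Rightarrow> nat \<Rightarrow> nat"
  where "triv M N i = (if i \<le> M then 0 else M + N + 1)"

lemma ipar_triv: "ipar M (triv M N i) = ipar M i"
  by (simp add: triv_def ipar_def)

lemma triv_idx: "triv M N i \<notin> idx M N"
  by (simp add: triv_def idx_def)

definition indep :: "((nat \<Rightarrow> letter) \<Rightarrow> complex) \<Rightarrow> nat \<Rightarrow> bool"
  where "indep F n \<longleftrightarrow> (\<forall>s z. F (s(n := z)) = F s)"

definition sw :: "nat \<Rightarrow> bit \<Rightarrow> (letter \<Rightarrow> complex) \<Rightarrow> letter \<Rightarrow> complex"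
  where "sw M p H z = ksign (p * ipar M (fst z)) * H z"

fun lw :: "nat \<Rightarrow> loop_gen \<Rightarrow> (letter \<Rightarrow> complex) \<Rightarrow> letter \<Rightarrow> complex"
  where "lw M (LE i j r) H z = - (ksign (ipar M i * ipar M j + ipar M i) *
    (if fst z = j then H (i, snd z + r) else 0))"

lemma app_gop_factor: "app (gop M n x) (\<lambda>s. G s * H (s n)) = (\<lambda>s. app (gop M n x) G s * H (s n))"
proof -
  have "app (gop M n x * slot n H id) G = app (slot n H id * gop M n x) G"
    by (simp add: slot_gop_comm)
  then show ?thesis by (simp add: app_simps app_slot[abs_def] mult.commute fun_eq_iff)
qed

lemma indep_gop: "indep F n \<Longrightarrow> indep (app (gop M n x) F) n"
proof -
  assume F: "indep F n"
  have "app (gop M n x) F (s(n := z)) = app (gop M n x) F s" for s z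
  proof -
    have "app (slot n (\<lambda>_. 1) (\<lambda>_. z) * gop M n x) F s = app (gop M n x * slot n (\<lambda>_. 1) (\<lambda>_. z)) F s"
      by (simp add: slot_gop_comm)
    moreover have "app (slot n (\<lambda>_. 1) (\<lambda>_. z)) F = F"
      using F unfolding indep_def by (intro ext) (simp only: app_slot mult_1_left)
    ultimately show ?thesis by (simp add: app_simps app_slot)
  qed
  then show ?thesis by (simp add: indep_def)
qed

lemma app_gop_Suc:
  assumes "indep F n"
  shows "app (gop M (Suc n) x) (\<lambda>s. F s * H (s n))
    = (\<lambda>s. app (gop M n x) F s * sw M (loop_par M x) H (s n) + F s * lw M x H (s n))"
proof
  fix s
  have 1: "app (sg M n (loop_par M x)) (\<lambda>s. F s * H (s n)) = (\<lambda>s. F s * sw M (loop_par M x) H (s n))"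
    by (simp add: fun_eq_iff app_sg sw_def)
  have 2: "app (lop M n x) (\<lambda>s. F s * H (s n)) s = F s * lw M x H (s n)"
  proof (cases x)
    case (LE i j r)
    show ?thesis
      using assms unfolding LE by (simp add: app_simps app_ksign app_mE indep_def)
  qed
  show "app (gop M (Suc n) x) (\<lambda>s. F s * H (s n)) s
    = app (gop M n x) F s * sw M (loop_par M x) H (s n) + F s * lw M x H (s n)"
    by (simp add: app_simps 1 2 app_gop_factor)
qed

definition opw :: "nat \<Rightarrow> nat \<Rightarrow> loop_gen list \<Rightarrow> complex seqop"
  where "opw M n u = prod_list (map (gop M n) u)"

lemma opw_simps: "opw M n [] = 1" "opw M n (x # u) = gop M n x * opw M n u"
  by (simp_all add: opw_def)

lemma indep_opw: "indep F n \<Longrightarrow> indep (app (opw M n u) F) n"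
  by (induction u) (simp_all add: opw_simps app_simps indep_gop)

text \<open>
  All ways of distributing the letters of a word over the first \<open>n\<close> tensor factors and the last one:
  the subword acting on the former, and its complement as an operator on the latter.
\<close>

fun spl :: "nat \<Rightarrow> loop_gen list \<Rightarrow> (loop_gen list \<times> ((letter \<Rightarrow> complex) \<Rightarrow> letter \<Rightarrow> complex)) list"
  where
    "spl M [] = [([], \<lambda>h. h)]"
  | "spl M (x # w) = map (\<lambda>(u, W). (x # u, \<lambda>h. sw M (loop_par M x) (W h))) (spl M w)
      @ map (\<lambda>(u, W). (u, \<lambda>h. lw M x (W h))) (spl M w)"

lemma app_opw_spl:
  assumes "indep F n"
  shows "app (opw M (Suc n) w) (\<lambda>s. F s * H (s n))
    = (\<lambda>s. \<Sum>(u, W)\<leftarrow>spl M w. app (opw M n u) F s * W H (s n))"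
proof (induction w)
  case Nil
  show ?case by (simp add: opw_simps app_simps)
next
  case (Cons x w)
  have "app (opw M (Suc n) (x # w)) (\<lambda>s. F s * H (s n))
      = app (gop M (Suc n) x) (\<lambda>s. \<Sum>z\<leftarrow>spl M w. app (opw M n (fst z)) F s * snd z H (s n))"
    by (simp add: opw_simps app_simps Cons case_prod_beta)
  also have "\<dots> = (\<lambda>s. \<Sum>z\<leftarrow>spl M w. app (opw M n (x # fst z)) F s * sw M (loop_par M x) (snd z H) (s n)
      + app (opw M n (fst z)) F s * lw M x (snd z H) (s n))"
    unfolding app_sum_list app_gop_Suc[OF indep_opw[OF assms]] by (simp add: opw_simps app_simps)
  also have "\<dots> = (\<lambda>s. \<Sum>(u, W)\<leftarrow>spl M (x # w). app (opw M n u) F s * W H (s n))"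
    by (simp add: sum_list_addf case_prod_beta comp_def)
  finally show ?case .
qed

definition pw :: "nat \<Rightarrow> loop_gen list \<Rightarrow> bit"
  where "pw M u = sum_list (map (loop_par M) u)"

lemma pw_simps [simp]: "pw M [] = 0" "pw M (x # u) = loop_par M x + pw M u" "pw M (u @ v) = pw M u + pw M v"
  by (simp_all add: pw_def)

lemma sw_sw: "sw M p (sw M q H) = sw M (p + q) H"
  by (simp add: fun_eq_iff sw_def ksign_add distrib_right)

lemma sw_0: "sw M 0 H = H"
  by (simp add: fun_eq_iff sw_def)

lemma spl_length: "(u, W) \<in> set (spl M w) \<Longrightarrow> length u \<le> length w"
  by (induction w arbitrary: u W) fastforce+

text \<open>Here and in the next sums \<open>c\<close> kills words shorter than \<open>d\<close>,
  and \<open>p\<close> holds letters already sent to the first factors. With fewer than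
  \<open>d\<close> letters in total nothing survives; with \<open>d\<close>, only the distribution
  sending no letter to the last factor; with \<open>d + 1\<close>, also those sending exactly
  one.\<close>

lemma spl_sum0:
  assumes "\<And>u. length u < d \<Longrightarrow> c u = 0" "length p + length w < d"
  shows "(\<Sum>(u, W)\<leftarrow>spl M w. c (p @ u) * (e (W H) :: complex)) = 0"
proof -
  have "map (\<lambda>(u, W). c (p @ u) * e (W H)) (spl M w) = map (\<lambda>_. 0) (spl M w)"
  proof (rule map_cong[OF refl], clarify)
    fix u W assume "(u, W) \<in> set (spl M w)"
    then have "length (p @ u) < d" using spl_length assms(2) by fastforce
    then show "c (p @ u) * e (W H) = 0" using assms(1) by simp
  qed
  then show ?thesis by (simp only: sum_list_0)
qed

lemma spl_Cons_sum:
  "(\<Sum>(u, W)\<leftarrow>spl M (x # w). f u W) = (\<Sum>(u, W)\<leftarrow>spl M w. f (x # u) (\<lambda>h. sw M (loop_par M x) (W h)))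
    + (\<Sum>(u, W)\<leftarrow>spl M w. f u (\<lambda>h. lw M x (W h)) :: complex)"
  by (simp add: case_prod_unfold comp_def)

lemma spl_sum1:
  assumes "\<And>u. length u < d \<Longrightarrow> c u = 0" "length p + length w = d"
  shows "(\<Sum>(u, W)\<leftarrow>spl M w. c (p @ u) * (e (W H) :: complex)) = c (p @ w) * e (sw M (pw M w) H)"
  using assms(2)
proof (induction w arbitrary: p e)
  case Nil
  show ?case by (simp add: sw_0)
next
  case (Cons x w)
  have A: "(\<Sum>(u, W)\<leftarrow>spl M w. c (p @ x # u) * e (sw M (loop_par M x) (W H)))
      = c (p @ x # w) * e (sw M (loop_par M x) (sw M (pw M w) H))"
    using Cons.IH[of "p @ [x]" "\<lambda>h. e (sw M (loop_par M x) h)"] Cons.prems by simp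
  have B: "(\<Sum>(u, W)\<leftarrow>spl M w. c (p @ u) * e (lw M x (W H))) = 0"
    using Cons.prems by (intro spl_sum0[where e = "\<lambda>h. e (lw M x h)"] assms(1)) auto
  show ?case
    unfolding spl_Cons_sum A B pw_simps sw_sw by simp
qed

lemma spl_sum2:
  assumes "\<And>u. length u < d \<Longrightarrow> c u = 0" "length p + length w = Suc d"
  shows "(\<Sum>(u, W)\<leftarrow>spl M w. c (p @ u) * (e (W H) :: complex)) = c (p @ w) * e (sw M (pw M w) H)
    + (\<Sum>k<length w. c (p @ take k w @ drop (Suc k) w) *
        e (sw M (pw M (take k w)) (lw M (w ! k) (sw M (pw M (drop (Suc k) w)) H))))"
  using assms(2)
proof (induction w arbitrary: p e)
  case Nil
  show ?case by (simp add: sw_0)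
next
  case (Cons x w)
  have A: "(\<Sum>(u, W)\<leftarrow>spl M w. c (p @ x # u) * e (sw M (loop_par M x) (W H)))
      = c (p @ x # w) * e (sw M (loop_par M x) (sw M (pw M w) H))
        + (\<Sum>k<length w. c (p @ x # take k w @ drop (Suc k) w) * e (sw M (loop_par M x)
          (sw M (pw M (take k w)) (lw M (w ! k) (sw M (pw M (drop (Suc k) w)) H)))))"
    using Cons.IH[of "p @ [x]" "\<lambda>h. e (sw M (loop_par M x) h)"] Cons.prems by simp
  have B: "(\<Sum>(u, W)\<leftarrow>spl M w. c (p @ u) * e (lw M x (W H))) = c (p @ w) * e (lw M x (sw M (pw M w) H))"
    using Cons.prems by (intro spl_sum1[where e = "\<lambda>h. e (lw M x h)"] assms(1)) auto
  show ?case
    unfolding spl_Cons_sum A B length_Cons sum.lessThan_Suc_shift take_0 drop_0 take_Suc_Cons drop_Suc_Cons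
      nth_Cons_0 nth_Cons_Suc pw_simps sw_sw sw_0 append_Nil append_Cons
    by (simp only: add_ac)
qed

section \<open>Matrix coefficients that separate words in the loop generators\<close>

locale loopalg =
  fixes M N :: nat
begin

sublocale presentation "loop_gens M N" "loop_par M" "loop_rels M N"
  by standard (rule loop_rels_carrier)

text \<open>\<open>Hx\<close> is a test function on one tensor factor and \<open>ev1\<close> a
  functional on such functions. Together they read off the coefficient of
  \<open>E\<^sub>i\<^sub>j x\<^sup>r\<close>; their components on the trivial letter cancel the
  contribution of the identity, which otherwise appears for \<open>i = j\<close> and
  \<open>r = 0\<close>.\<close>

fun Hx :: "loop_gen \<Rightarrow> letter \<Rightarrow> complex"
  where "Hx (LE i j r) z = (if snd z = r then (if fst z = i then 1 else 0)
    + (if i = j \<and> fst z = triv M N i then 1 else 0) else 0)"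

fun ev1 :: "loop_gen \<Rightarrow> (letter \<Rightarrow> complex) \<Rightarrow> complex"
  where "ev1 (LE i j r) h = h (j, 0) - h (triv M N j, 0)"

fun Fv :: "loop_gen list \<Rightarrow> (nat \<Rightarrow> letter) \<Rightarrow> complex"
  where
    "Fv [] = (\<lambda>s. 1)"
  | "Fv (x # v) = (\<lambda>s. Fv v s * Hx x (s (length v)))"

fun Ev :: "loop_gen list \<Rightarrow> ((nat \<Rightarrow> letter) \<Rightarrow> complex) \<Rightarrow> complex"
  where
    "Ev [] f = f (\<lambda>_. (0, 0))"
  | "Ev (x # v) f = Ev v (\<lambda>s. ev1 x (\<lambda>z. f (s(length v := z))))"

text \<open>
  \<open>Phi v u\<close> is the matrix coefficient in the tensor power of degree \<open>length v\<close> that reads off, in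
  each factor, the coefficient of one letter of \<open>v\<close>; subtracting the trivial summand makes the
  unit invisible, so that words shorter than \<open>v\<close> are killed.
\<close>

definition Phi :: "loop_gen list \<Rightarrow> loop_gen list \<Rightarrow> complex"
  where "Phi v u = Ev v (app (opw M (length v) u) (Fv v))"

lemma ev1_lin: "ev1 x (\<lambda>z. f z + g z) = ev1 x f + ev1 x g" "ev1 x (\<lambda>z. c * f z) = c * ev1 x f"
  by (cases x; simp add: algebra_simps)+

lemma Ev_add: "Ev v (\<lambda>s. f s + g s) = Ev v f + Ev v g"
  by (induction v arbitrary: f g) (simp_all add: ev1_lin)

lemma Ev_scale: "Ev v (\<lambda>s. c * f s) = c * Ev v f"
  by (induction v arbitrary: f) (simp_all add: ev1_lin)

lemma Ev_zero: "Ev v (\<lambda>s. 0) = 0"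
  using Ev_scale[of v 0 "\<lambda>_. 0"] by simp

lemma Ev_sum_list: "Ev v (\<lambda>s. \<Sum>x\<leftarrow>xs. f x s) = (\<Sum>x\<leftarrow>xs. Ev v (f x))"
  by (induction xs) (simp_all add: Ev_zero Ev_add)

lemma ev1_sum_list: "ev1 y (\<lambda>s. \<Sum>x\<leftarrow>xs. f x s) = (\<Sum>x\<leftarrow>xs. ev1 y (f x))"
proof (induction xs)
  case Nil
  show ?case using ev1_lin(2)[of y 0 "\<lambda>_. 0"] by simp
qed (simp_all add: ev1_lin)

lemma indep_Fv: "length v \<le> n \<Longrightarrow> indep (Fv v) n"
  by (induction v) (auto simp: indep_def)

lemma Phi_split:
  "Phi (x # v) w = (\<Sum>(u, W)\<leftarrow>spl M w. Phi v u * ev1 x (W (Hx x)))"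
proof -
  let ?n = "length v"
  have F: "indep (Fv v) ?n" by (rule indep_Fv) simp
  have "app (opw M ?n u) (Fv v) (s(?n := z)) = app (opw M ?n u) (Fv v) s" for u s z
    using indep_opw[OF F] unfolding indep_def by blast
  then show ?thesis
    by (simp add: Phi_def app_opw_spl[OF F] case_prod_unfold ev1_sum_list ev1_lin Ev_sum_list
      Ev_scale mult.commute[of _ "ev1 _ _"])
qed

text \<open>For \<open>i = j\<close> and \<open>r = 0\<close> the values at \<open>j\<close> and at
  the trivial letter cancel, even after a parity twist, since both letters have the same parity. In
  all other cases both values are zero.\<close>

lemma ev1_sw_Hx: "x \<in> loop_gens M N \<Longrightarrow> ev1 x (sw M p (Hx x)) = 0"
proof (cases x)
  case (LE i j r)
  assume "x \<in> loop_gens M N"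
  then have "triv M N j \<noteq> i" "triv M N i \<noteq> j" using triv_idx[of M N i] triv_idx[of M N j] unfolding LE by auto
  then show ?thesis unfolding LE by (simp add: sw_def ipar_triv)
qed

text \<open>If no letter acts on the last factor, \<open>ev1_sw_Hx\<close> gives zero; if some
  letter does, too few remain for the other factors.\<close>

lemma Phi_short: "set v \<subseteq> loop_gens M N \<Longrightarrow> length u < length v \<Longrightarrow> Phi v u = 0"
proof (induction v arbitrary: u)
  case (Cons x v)
  have short: "length u < length v \<Longrightarrow> Phi v u = 0" for u using Cons by simp
  show ?case
  proof (cases "length u = length v")
    case True
    then show ?thesis
      using spl_sum1[where d = "length v" and c = "Phi v" and p = "[]" and w = u and M = M and e = "ev1 x" and H = "Hx x"] short Cons.prems
      by (simp add: Phi_split ev1_sw_Hx)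
  next
    case False
    then show ?thesis
      using spl_sum0[where d = "length v" and c = "Phi v" and p = "[]" and w = u and M = M and e = "ev1 x" and H = "Hx x"] short Cons.prems
      by (simp add: Phi_split)
  qed
qed simp

fun sgnc :: "loop_gen \<Rightarrow> bit \<Rightarrow> bit \<Rightarrow> complex"
  where "sgnc (LE i j r) a b = - (ksign (ipar M i * ipar M j + ipar M i) *
    (ksign (a * ipar M j) * ksign (b * ipar M i)))"

text \<open>No generator of the loop algebra touches a trivial letter, so only the value at
  \<open>j\<close> contributes and it forces all three labels to agree.\<close>

lemma ev1_lw:
  assumes "x \<in> loop_gens M N" "y \<in> loop_gens M N"
  shows "ev1 x (sw M a (lw M y (sw M b (Hx x)))) = (if y = x then sgnc x a b else 0)"
proof (cases x; cases y)
  fix i j r k l s assume xy: "x = LE i j r" "y = LE k l s"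
  have "triv M N j \<noteq> l" "triv M N i \<noteq> k"
    using assms triv_idx[of M N i] triv_idx[of M N j] unfolding xy by auto
  then show ?thesis unfolding xy by (cases "k = i"; cases "l = j"; cases "s = r") (simp_all add: sw_def)
qed

text \<open>With one letter more than there are first factors, exactly one letter reaches the last
  factor, and \<open>ev1_lw\<close> forces it to be \<open>x\<close>: an expansion along the first
  entry of \<open>x # v\<close>, like that of a permanent with signs.\<close>

lemma Phi_step:
  assumes "set (x # v) \<subseteq> loop_gens M N" "set w \<subseteq> loop_gens M N" "length w = Suc (length v)"
  shows "Phi (x # v) w = (\<Sum>k<length w. Phi v (take k w @ drop (Suc k) w) *
      (if w ! k = x then sgnc x (pw M (take k w)) (pw M (drop (Suc k) w)) else 0))"
proof -
  have "Phi (x # v) w = (\<Sum>k<length w. Phi v (take k w @ drop (Suc k) w) *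
      ev1 x (sw M (pw M (take k w)) (lw M (w ! k) (sw M (pw M (drop (Suc k) w)) (Hx x)))))"
    using spl_sum2[where d = "length v" and c = "Phi v" and p = "[]" and w = w and M = M and e = "ev1 x" and H = "Hx x"] assms Phi_short[of v]
    by (simp add: Phi_split ev1_sw_Hx)
  also have "\<dots> = (\<Sum>k<length w. Phi v (take k w @ drop (Suc k) w) *
      (if w ! k = x then sgnc x (pw M (take k w)) (pw M (drop (Suc k) w)) else 0))"
    using assms by (intro sum.cong refl) (subst ev1_lw, auto simp: subset_iff)
  finally show ?thesis .
qed

lemma mset_take_drop: "k < length w \<Longrightarrow> mset w = add_mset (w ! k) (mset (take k w @ drop (Suc k) w))"
  by (subst id_take_nth_drop[of k w]) simp_all

lemma Phi_ne:
  assumes "set v \<subseteq> loop_gens M N" "set w \<subseteq> loop_gens M N" "length w = length v" "mset w \<noteq> mset v"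
  shows "Phi v w = 0"
  using assms
proof (induction v arbitrary: w)
  case (Cons x v)
  have "Phi v (take k w @ drop (Suc k) w) = 0" if "k < length w" "w ! k = x" for k
  proof (rule Cons.IH)
    show "mset (take k w @ drop (Suc k) w) \<noteq> mset v"
      using mset_take_drop[OF that(1)] that(2) Cons.prems(4) by auto
    show "set (take k w @ drop (Suc k) w) \<subseteq> loop_gens M N"
      using Cons.prems(2) set_take_subset[of k w] set_drop_subset[of "Suc k" w] by auto
  qed (use that Cons.prems in auto)
  note 0 = this
  have "Phi (x # v) w = (\<Sum>k<length w. Phi v (take k w @ drop (Suc k) w) *
      (if w ! k = x then sgnc x (pw M (take k w)) (pw M (drop (Suc k) w)) else 0))"
    using Cons.prems by (intro Phi_step) auto
  also have "\<dots> = 0" by (rule sum.neutral) (use 0 in auto)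
  finally show ?case .
qed simp

section \<open>Reordering of words modulo shorter words\<close>

definition wd :: "loop_gen list \<Rightarrow> (complex, loop_gen) free_alg"
  where "wd u = Poly_Mapping.single (Word u) 1"

lemma wd_Nil: "wd [] = 1"
  by (simp add: wd_def flip: zero_word_def)

lemma wd_append: "wd (u @ v) = wd u * wd v"
  by (simp add: wd_def mult_single plus_word_def)

lemma wd_Cons: "wd (x # u) = fgen x * wd u"
  by (simp add: wd_def fgen_def mult_single plus_word_def)

lemma wd_carrier: "set u \<subseteq> loop_gens M N \<Longrightarrow> wd u \<in> carrier F"
  by (simp add: wd_def free_superalgebra_def)

definition short :: "nat \<Rightarrow> (complex, loop_gen) free_alg set"
  where "short n = {x \<in> carrier F. \<forall>w\<in>Poly_Mapping.keys x. length (letters w) < n}"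

text \<open>The length filtration, modulo the relations.\<close>

definition Rn :: "nat \<Rightarrow> (complex, loop_gen) free_alg set"
  where "Rn n = {y + x | y x. y \<in> J \<and> x \<in> short n}"

lemma short_wd: "set u \<subseteq> loop_gens M N \<Longrightarrow> length u < n \<Longrightarrow> wd u \<in> short n"
  using wd_carrier[of u] by (simp add: short_def) (simp add: wd_def)

lemma short_zero: "0 \<in> short n"
  by (simp add: short_def carrier_closed)

lemma short_add: "x \<in> short n \<Longrightarrow> y \<in> short n \<Longrightarrow> x + y \<in> short n"
  using Poly_Mapping.keys_add[of x y] by (auto simp: short_def carrier_closed)

lemma short_mult: "x \<in> short (Suc m) \<Longrightarrow> y \<in> short n \<Longrightarrow> x * y \<in> short (m + n)"
  using Poly_Mapping.keys_mult[of x y]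
  by (fastforce simp: short_def carrier_closed plus_word_def)

lemma short_mult': "x \<in> short n \<Longrightarrow> y \<in> short (Suc m) \<Longrightarrow> x * y \<in> short (n + m)"
  using Poly_Mapping.keys_mult[of x y]
  by (fastforce simp: short_def carrier_closed plus_word_def)

lemma short_scalar: "x \<in> short n \<Longrightarrow> fscalar c * x \<in> short n"
  by (simp add: short_def carrier_closed in_keys_iff lookup_fscalar_mult)

lemma short_uminus: "x \<in> short n \<Longrightarrow> - x \<in> short n"
  by (simp add: short_def carrier_closed)

lemma Rn_J: "y \<in> J \<Longrightarrow> y \<in> Rn n"
  using short_zero by (force simp: Rn_def)

lemma Rn_short: "x \<in> short n \<Longrightarrow> x \<in> Rn n"
  using J_zero by (force simp: Rn_def)

lemma RnE:
  assumes "x \<in> Rn n" obtains y z where "y \<in> J" "z \<in> short n" "x = y + z"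
  using assms by (auto simp: Rn_def)

lemma RnI: "y \<in> J \<Longrightarrow> z \<in> short n \<Longrightarrow> x = y + z \<Longrightarrow> x \<in> Rn n"
  by (auto simp: Rn_def)

lemma Rn_add:
  assumes "x \<in> Rn n" "x' \<in> Rn n" shows "x + x' \<in> Rn n"
proof -
  obtain y z y' z' where *: "y \<in> J" "z \<in> short n" "x = y + z" "y' \<in> J" "z' \<in> short n" "x' = y' + z'"
    using RnE[OF assms(1)] RnE[OF assms(2)] by metis
  show ?thesis
    by (rule RnI[OF J_add[OF *(1,4)] short_add[OF *(2,5)]]) (simp add: *(3,6) ac_simps)
qed

lemma Rn_scalar:
  assumes "x \<in> Rn n" shows "fscalar c * x \<in> Rn n"
proof -
  obtain y z where *: "y \<in> J" "z \<in> short n" "x = y + z" using RnE[OF assms] by metis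
  show ?thesis
    by (rule RnI[OF J_scalar[OF *(1)] short_scalar[OF *(2)]]) (simp add: *(3) distrib_left)
qed

lemma Rn_ksign: "x \<in> Rn n \<Longrightarrow> ksign p * x \<in> Rn n"
  using Rn_scalar[of x n "ksign p"] by (simp add: fscalar_ksign)

lemma Rn_wd_mult:
  assumes "x \<in> Rn n" "set u \<subseteq> loop_gens M N" "set v \<subseteq> loop_gens M N"
  shows "wd u * x * wd v \<in> Rn (length u + n + length v)"
proof -
  obtain y z where *: "y \<in> J" "z \<in> short n" "x = y + z" using assms(1) by (auto simp: Rn_def)
  have "wd u * y * wd v \<in> J"
    using J_rmult[OF J_lmult[OF *(1) wd_carrier[OF assms(2)]] wd_carrier[OF assms(3)]] .
  moreover have "wd u * z * wd v \<in> short (length u + n + length v)"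
    by (intro short_mult short_mult' short_wd *(2) assms) simp_all
  ultimately show ?thesis unfolding *(3) by (auto simp: Rn_def distrib_left distrib_right)
qed

lemma rel_J:
  assumes "x \<in> loop_gens M N" "y \<in> loop_gens M N"
  shows "fgen x * fgen y - ksign (loop_par M x * loop_par M y) * (fgen y * fgen x) - lbr M fgen x y \<in> J"
proof (cases x; cases y)
  fix i j r k l s assume xy: "x = LE i j r" "y = LE k l s"
  have "loop_rel M i j r k l s \<in> J"
  proof (rule J_rels)
    show "loop_rel M i j r k l s \<in> loop_rels M N"
      unfolding loop_rels_def mem_Collect_eq
      by (intro exI conjI refl) (use assms xy in auto)
  qed
  then show ?thesis unfolding xy loop_rel_def Let_def lbr_def by (simp add: mult.assoc)
qed

lemma lbr_short:
  assumes "x \<in> loop_gens M N" "y \<in> loop_gens M N"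
  shows "lbr M fgen x y \<in> short 2"
proof -
  have g: "fgen z \<in> short 2" if "z \<in> loop_gens M N" for z
    using short_wd[of "[z]" 2] that by (simp add: wd_Cons wd_Nil)
  have k: "ksign p * z \<in> short 2" if "z \<in> short 2" for p z
    using short_scalar[OF that, of "ksign p"] by (simp add: fscalar_ksign)
  show ?thesis
    using assms g short_zero short_uminus short_add[OF g short_uminus[OF k[OF g]]]
    by (cases x; cases y) (auto simp: lbr_def intro!: k short_uminus g)
qed

lemma ksign_pull:
  "A * (x - ksign t * y) * B = A * x * B - ksign t * (A * y * (B :: 'b::ring_1))"
  by (cases t) (simp_all add: algebra_simps)

lemma wd_swap:
  assumes "x \<in> loop_gens M N" "y \<in> loop_gens M N" "set p \<subseteq> loop_gens M N" "set q \<subseteq> loop_gens M N"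
  shows "wd (p @ x # y # q) - ksign (loop_par M x * loop_par M y) * wd (p @ y # x # q)
    \<in> Rn (length p + 2 + length q)"
proof -
  let ?e = "ksign (loop_par M x * loop_par M y) :: (complex, loop_gen) free_alg"
  have "fgen x * fgen y - ?e * (fgen y * fgen x) \<in> Rn 2"
    using Rn_add[OF Rn_J[OF rel_J[OF assms(1,2)]] Rn_short[OF lbr_short[OF assms(1,2)]]] by simp
  from Rn_wd_mult[OF this assms(3,4)] show ?thesis
    unfolding ksign_pull unfolding wd_append wd_Cons mult.assoc .
qed

lemma telescope: "(A - e * B) + e * (B - f * C) = A - e * f * (C :: 'b::ring_1)"
  by (simp add: right_diff_distrib mult.assoc)

lemma wd_move:
  assumes "x \<in> loop_gens M N" "set a \<subseteq> loop_gens M N" "set b \<subseteq> loop_gens M N"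
  shows "wd (x # a @ b) - ksign (loop_par M x * pw M a) * wd (a @ x # b) \<in> Rn (Suc (length a + length b))"
  using assms(2)
proof (induction a)
  case Nil
  show ?case by (simp add: Rn_J J_zero)
next
  case (Cons y a)
  let ?e = "ksign (loop_par M x * loop_par M y) :: (complex, loop_gen) free_alg"
  have 1: "wd (x # y # a @ b) - ?e * wd (y # x # a @ b) \<in> Rn (Suc (length (y # a) + length b))"
    using wd_swap[of x y "[]" "a @ b"] assms Cons.prems by simp
  have "wd [y] * (wd (x # a @ b) - ksign (loop_par M x * pw M a) * wd (a @ x # b)) * wd []
      \<in> Rn (length [y] + Suc (length a + length b) + length ([] :: loop_gen list))"
    by (intro Rn_wd_mult) (use Cons in auto)
  then have "wd (y # x # a @ b) - ksign (loop_par M x * pw M a) * wd (y # a @ x # b)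
      \<in> Rn (Suc (length (y # a) + length b))"
    unfolding ksign_pull by (simp add: wd_Cons wd_Nil)
  from Rn_add[OF 1 Rn_ksign[OF this, of "loop_par M x * loop_par M y"]]
  show ?case
    unfolding telescope pw_simps distrib_left[of "loop_par M x"] ksign_add append_Cons .
qed

text \<open>The associated graded algebra is supercommutative. Only the existence of the sign
  matters, so the permutation is not tracked.\<close>

lemma wd_perm:
  assumes "mset u = mset v" "set u \<subseteq> loop_gens M N"
  shows "\<exists>p. wd u - ksign p * wd v \<in> Rn (length u)"
  using assms
proof (induction u arbitrary: v)
  case Nil
  then show ?case by (intro exI[of _ 0]) (simp add: Rn_J J_zero)
next
  case (Cons x u)
  then have "x \<in> set v" by (metis list.set_intros(1) set_mset_mset)
  then obtain a b where v: "v = a @ x # b" by (auto simp: in_set_conv_decomp)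
  have ab: "set a \<subseteq> loop_gens M N" "set b \<subseteq> loop_gens M N" "length u = length a + length b"
    using Cons.prems mset_eq_setD[OF Cons.prems(1)] mset_eq_length[OF Cons.prems(1)] unfolding v by auto
  obtain p where p: "wd u - ksign p * wd (a @ b) \<in> Rn (length u)"
    using Cons.IH[of "a @ b"] Cons.prems unfolding v by auto
  have "wd [x] * (wd u - ksign p * wd (a @ b)) * wd [] \<in> Rn (length [x] + length u + length ([] :: loop_gen list))"
    by (intro Rn_wd_mult) (use Cons.prems p in auto)
  then have 1: "wd (x # u) - ksign p * wd (x # a @ b) \<in> Rn (length (x # u))"
    unfolding ksign_pull by (simp add: wd_Cons wd_Nil)
  have 2: "wd (x # a @ b) - ksign (loop_par M x * pw M a) * wd v \<in> Rn (length (x # u))"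
    using wd_move[of x a b] Cons.prems ab unfolding v by simp
  from Rn_add[OF 1 Rn_ksign[OF 2, of p]]
  have "wd (x # u) - ksign (p + loop_par M x * pw M a) * wd v \<in> Rn (length (x # u))"
    unfolding telescope ksign_add .
  then show ?case by blast
qed

section \<open>Linear functionals on the free algebra and descent on the word length\<close>

definition rep :: "nat \<Rightarrow> (complex, loop_gen) free_alg \<Rightarrow> complex seqop"
  where "rep n = feval sc (gop M n)"

interpretation sc: central_scalars "sc :: complex \<Rightarrow> complex seqop"
  by (rule central_scalars_sc)

lemma rep_J: "x \<in> J \<Longrightarrow> rep n x = 0"
  unfolding rep_def
proof (rule J_kernel[OF central_scalars_sc])
  fix x assume "x \<in> loop_rels M N"
  then obtain i j r k l s where x: "x = loop_rel M i j r k l s" by (auto simp: loop_rels_def)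
  have k: "feval sc (gop M n) (ksign p) = (ksign p :: complex seqop)" for p
    by (cases p) (simp_all add: sc.feval_uminus sc.feval_one)
  let ?x = "LE i j r" and ?y = "LE k l s" and ?g = "gop M n :: loop_gen \<Rightarrow> complex seqop"
  have "feval sc ?g x = ?g ?x * ?g ?y - ksign (loop_par M ?x * loop_par M ?y) * (?g ?y * ?g ?x) - lbr M ?g ?x ?y"
    unfolding x loop_rel_def Let_def mult.assoc lbr_def loop_gen.case loop_par.simps
    by (simp only: sc.feval_diff sc.feval_mult k sc.feval_fgen if_distrib[of "feval sc (gop M n)"] sc.feval_zero)
  then show "feval sc ?g x = 0"
    unfolding gop_bracket by simp
qed

definition Phil :: "loop_gen list \<Rightarrow> (complex, loop_gen) free_alg \<Rightarrow> complex"
  where "Phil v x = Ev v (app (rep (length v) x) (Fv v))"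

lemma Phil_add: "Phil v (x + y) = Phil v x + Phil v y"
  by (simp add: Phil_def rep_def sc.feval_add app_simps Ev_add[symmetric] cong: if_cong) (simp add: app_simps(3)[abs_def])

lemma Phil_scalar: "Phil v (fscalar c * x) = c * Phil v x"
  by (simp add: Phil_def rep_def sc.feval_mult sc.feval_fscalar app_simps Ev_scale[symmetric]) (simp add: app_simps(7)[abs_def])

lemma Phil_diff: "Phil v (x - y) = Phil v x - Phil v y"
  using Phil_add[of v "x - y" y] by simp

lemma Phil_wd: "Phil v (wd u) = Phi v u"
  by (simp add: Phil_def Phi_def rep_def wd_def sc.feval_single opw_def sc_one)

lemma Phil_zero: "Phil v 0 = 0"
  using Phil_add[of v 0 0] by simp

lemma Phil_sum: "Phil v (\<Sum>i\<in>I. f i) = (\<Sum>i\<in>I. Phil v (f i))"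
  by (induction I rule: infinite_finite_induct) (simp_all add: Phil_zero Phil_add)

lemma free_expand: "x = (\<Sum>w\<in>Poly_Mapping.keys x. fscalar (Poly_Mapping.lookup x w) * wd (letters w))"
proof -
  have "fscalar c * wd (letters w) = Poly_Mapping.single w c" for c :: complex and w
    by (simp add: wd_def fscalar_def mult_single)
  then show ?thesis
    by (intro poly_mapping_eqI) (simp add: lookup_sum lookup_single when_def in_keys_iff)
qed

lemma Phil_Rn:
  assumes v: "set v \<subseteq> loop_gens M N" and "x \<in> Rn (length v)"
  shows "Phil v x = 0"
proof -
  obtain y z where *: "y \<in> J" "z \<in> short (length v)" "x = y + z" using assms(2) by (auto simp: Rn_def)
  have "app (0 :: complex seqop) f = (\<lambda>s. 0)" for f by (simp add: fun_eq_iff app_simps)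
  then have "Phil v y = 0"
    by (simp add: Phil_def rep_J[OF *(1)] Ev_zero)
  moreover have "Phil v z = 0"
  proof -
    have "Phil v (fscalar c * wd (letters w)) = 0" if "w \<in> Poly_Mapping.keys z" for c w
      using that *(2) Phi_short[OF v] by (simp add: Phil_scalar Phil_wd short_def)
    then show ?thesis by (subst free_expand) (simp add: Phil_sum)
  qed
  ultimately show ?thesis by (simp add: *(3) Phil_add)
qed

text \<open>An odd \<open>E\<^sub>i\<^sub>j\<close> has \<open>i\<close> different from
  \<open>j\<close>, so its bracket with itself is zero; but that bracket is twice the
  square.\<close>

lemma odd_square:
  assumes "x \<in> loop_gens M N" "loop_par M x = 1" shows "fgen x * fgen x \<in> J"
proof -
  have "lbr M fgen x x = (0 :: (complex, loop_gen) free_alg)"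
    using assms(2) by (cases x) (auto simp: lbr_def)
  then have "fgen x * fgen x + fgen x * fgen x \<in> J"
    using rel_J[OF assms(1) assms(1)] by (simp add: assms(2))
  from J_scalar[OF this, of "1 / 2"]
  have "fscalar (1 / 2 + 1 / 2) * (fgen x * fgen x) \<in> J"
    unfolding fscalar_add by (simp only: distrib_left distrib_right)
  then show ?thesis by (simp add: fscalar_one)
qed

lemma sgnc_nz: "sgnc x a b \<noteq> 0"
proof (cases x)
  case (LE i j r)
  have "ksign p \<noteq> (0 :: complex)" for p by (cases p) simp_all
  then show ?thesis unfolding LE by simp
qed

lemma sgnc_even:
  assumes "loop_par M x = 0" shows "sgnc x a b = sgnc x 0 (a + b)"
proof (cases x)
  case (LE i j r)
  then have "ipar M i = ipar M j" using assms by (cases "ipar M i"; cases "ipar M j") simp_all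
  then show ?thesis unfolding LE by (simp add: ksign_add distrib_right)
qed

text \<open>For even \<open>x\<close> no sign arises, and the two words differ by relations and
  shorter words, both of which are killed at this length.\<close>

lemma Phi_move:
  assumes "x \<in> loop_gens M N" "loop_par M x = 0" "set a \<subseteq> loop_gens M N" "set b \<subseteq> loop_gens M N"
    "set v \<subseteq> loop_gens M N" "length v = Suc (length a + length b)"
  shows "Phi v (x # a @ b) = Phi v (a @ x # b)"
  using Phil_Rn[OF assms(5), of "wd (x # a @ b) - wd (a @ x # b)"] wd_move[OF assms(1,3,4)] assms(2,6)
  by (simp add: Phil_diff Phil_wd)

text \<open>If the first letter is even, all its occurrences in the word contribute the same nonzero
  number, and in characteristic 0 their sum is nonzero. If it is odd, it occurs once and only one
  summand is left.\<close>

lemma Phi_self: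
  assumes "set v \<subseteq> loop_gens M N" "\<And>x. loop_par M x = 1 \<Longrightarrow> count (mset v) x \<le> 1"
  shows "Phi v v \<noteq> 0"
  using assms
proof (induction v)
  case Nil
  show ?case by (simp add: Phi_def opw_simps app_simps)
next
  case (Cons x v)
  let ?w = "x # v"
  have "count (mset v) y \<le> 1" if "loop_par M y = 1" for y
    by (rule order_trans[OF _ Cons.prems(2)[OF that]]) simp
  then have IH: "Phi v v \<noteq> 0" using Cons by simp
  have step: "Phi ?w ?w = (\<Sum>k<length ?w. Phi v (take k ?w @ drop (Suc k) ?w) *
      (if ?w ! k = x then sgnc x (pw M (take k ?w)) (pw M (drop (Suc k) ?w)) else 0))"
    using Cons.prems by (intro Phi_step) auto
  show ?case
  proof (cases "loop_par M x")
    case zero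
    have "Phi v (take k ?w @ drop (Suc k) ?w) *
        (if ?w ! k = x then sgnc x (pw M (take k ?w)) (pw M (drop (Suc k) ?w)) else 0)
      = (if ?w ! k = x then Phi v v * sgnc x 0 (pw M v) else 0)" if "k < length ?w" for k
    proof (cases "?w ! k = x")
      case True
      have "pw M ?w = pw M (take k ?w) + (loop_par M x + pw M (drop (Suc k) ?w))"
        using arg_cong[OF id_take_nth_drop[OF that], of "pw M"] True by (simp only: pw_simps)
      then have "pw M v = pw M (take k ?w) + pw M (drop (Suc k) ?w)"
        unfolding pw_simps zero add_0_left .
      then have pw: "pw M (take k ?w) + pw M (drop (Suc k) ?w) = pw M v" by (rule sym)
      have "Phi v (take k ?w @ drop (Suc k) ?w) = Phi v v"
      proof (cases k)
        case (Suc m)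
        then have m: "m < length v" "v ! m = x" using that True by simp_all
        have v: "v = take m v @ x # drop (Suc m) v" using id_take_nth_drop[OF m(1)] m(2) by simp
        have "Phi v (x # take m v @ drop (Suc m) v) = Phi v (take m v @ x # drop (Suc m) v)"
          using Cons.prems(1) set_take_subset[of m v] set_drop_subset[of "Suc m" v] zero m(1)
          by (intro Phi_move) auto
        then show ?thesis unfolding Suc using v by simp
      qed simp
      then show ?thesis unfolding if_P[OF True] sgnc_even[OF zero, of "pw M (take k ?w)"] pw by simp
    qed simp
    then have "Phi ?w ?w = (\<Sum>k<length ?w. if ?w ! k = x then Phi v v * sgnc x 0 (pw M v) else 0)"
      unfolding step by (intro sum.cong) auto
    also have "\<dots> = of_nat (card {k. k < length ?w \<and> ?w ! k = x}) * (Phi v v * sgnc x 0 (pw M v))"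
      by (subst sum.inter_filter[symmetric]) simp_all
    also have "\<dots> \<noteq> 0"
    proof -
      have "0 \<in> {k. k < length ?w \<and> ?w ! k = x}" by simp
      then have "card {k. k < length ?w \<and> ?w ! k = x} \<noteq> 0"
        by (metis (no_types, lifting) card_0_eq empty_iff finite_nat_set_iff_bounded mem_Collect_eq)
      then show ?thesis using IH sgnc_nz by simp
    qed
    finally show ?thesis .
  next
    case one
    then have "count (mset ?w) x \<le> 1" by (rule Cons.prems(2))
    then have "x \<notin> set v" by (simp add: count_eq_zero_iff[symmetric])
    then have "v ! k \<noteq> x" if "k < length v" for k using that nth_mem by metis
    then have "Phi ?w ?w = Phi v v * sgnc x 0 (pw M v)"
      unfolding step list.size add_Suc_right Nat.add_0_right sum.lessThan_Suc_shift
      by (simp add: sum.neutral)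
    then show ?thesis using IH sgnc_nz by simp
  qed
qed

text \<open>Reordering brings two equal odd letters together, and their product is zero modulo the
  relations.\<close>

lemma wd_odd_repeated:
  assumes "set u \<subseteq> loop_gens M N" "loop_par M x = 1" "\<not> count (mset u) x \<le> 1"
  shows "wd u \<in> Rn (length u)"
proof -
  have "{#x, x#} \<subseteq># mset u" using assms(3) by (simp add: subseteq_mset_def)
  then obtain B where "mset u = {#x, x#} + B" by (metis mset_subset_eq_exists_conv)
  moreover obtain b where "B = mset b" by (metis ex_mset)
  ultimately have u: "mset u = mset (x # x # b)" by simp
  then have x: "x \<in> loop_gens M N" "set b \<subseteq> loop_gens M N"
    using assms(1) mset_eq_setD[OF u] by auto
  have "fgen x * fgen x * wd b \<in> J"
    by (rule J_rmult[OF odd_square[OF x(1) assms(2)] wd_carrier[OF x(2)]])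
  then have A: "wd (x # x # b) \<in> Rn (length u)" by (simp add: wd_Cons mult.assoc Rn_J)
  obtain p where B: "wd u - ksign p * wd (x # x # b) \<in> Rn (length u)"
    using wd_perm[OF u assms(1)] by blast
  from Rn_add[OF B Rn_ksign[OF A, of p]] show ?thesis by simp
qed

text \<open>Leading words are removed one by one, without an order on the generators. A word with a
  repeated odd letter is reducible; one that rearranges another word of \<open>W\<close> is merged
  into it; otherwise \<open>Phil w\<close> sees no other word of \<open>W\<close>, and its vanishing
  makes the coefficient zero.\<close>

lemma Rn_descent:
  assumes "finite W" "\<And>w. w \<in> W \<Longrightarrow> length w = n \<and> set w \<subseteq> loop_gens M N" "z \<in> Rn n"
    "y = (\<Sum>w\<in>W. fscalar (c w) * wd w) + z" "\<And>v. set v \<subseteq> loop_gens M N \<Longrightarrow> Phil v y = 0"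
  shows "y \<in> Rn n"
  using assms
proof (induction W arbitrary: c z rule: finite_psubset_induct)
  case (psubset W)
  show ?case
  proof (cases "W = {}")
    case True
    then show ?thesis using psubset.prems by simp
  next
    case False
    then obtain w where w: "w \<in> W" by blast
    let ?W = "W - {w}"
    have lw: "length w = n" "set w \<subseteq> loop_gens M N" using psubset.prems(1)[OF w] by auto
    have y: "y = (\<Sum>u\<in>?W. fscalar (c u) * wd u) + (fscalar (c w) * wd w + z)"
      using psubset.prems(3) sum.remove[OF psubset.hyps(1) w, of "\<lambda>u. fscalar (c u) * wd u"]
      by (simp add: ac_simps)
    have sub: "?W \<subset> W" using w by blast
    have IH: "y \<in> Rn n" if "z' \<in> Rn n" "y = (\<Sum>u\<in>?W. fscalar (c' u) * wd u) + z'" for c' z'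
      by (rule psubset.IH[OF sub _ that]) (use psubset.prems in auto)
    show ?thesis
    proof (cases "\<exists>x. loop_par M x = 1 \<and> \<not> count (mset w) x \<le> 1")
      case True
      then have "wd w \<in> Rn n" using wd_odd_repeated lw by blast
      then show ?thesis by (intro IH[OF _ y] Rn_add Rn_scalar psubset.prems(2))
    next
      case good: False
      show ?thesis
      proof (cases "\<exists>u\<in>?W. mset w = mset u")
        case True
        then obtain u where u: "u \<in> ?W" "mset w = mset u" by blast
        obtain p where p: "wd w - ksign p * wd u \<in> Rn n" using wd_perm[OF u(2) lw(2)] lw(1) by blast
        let ?c = "c(u := c u + c w * ksign p)"
        have fin: "finite ?W" using psubset.hyps by simp
        have "(\<Sum>u\<in>?W. fscalar (?c u) * wd u) = (\<Sum>u\<in>?W. fscalar (c u) * wd u) + fscalar (c w) * (ksign p * wd u)"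
          using sum.remove[OF fin u(1), of "\<lambda>u. fscalar (c u) * wd u"]
            sum.remove[OF fin u(1), of "\<lambda>u. fscalar (?c u) * wd u"]
          by (simp add: fscalar_add fscalar_mult fscalar_ksign distrib_right ac_simps)
            (cases p; simp)
        then have "y = (\<Sum>u\<in>?W. fscalar (?c u) * wd u) + (fscalar (c w) * (wd w - ksign p * wd u) + z)"
          using y by (simp add: right_diff_distrib)
        then show ?thesis by (rule IH[rotated]) (intro Rn_add Rn_scalar psubset.prems(2) p)
      next
        case False
        have "Phil w (fscalar (c u) * wd u) = 0" if "u \<in> ?W" for u
          proof -
          have "mset u \<noteq> mset w" "u \<in> W" using that False by (metis, blast)
          then have "Phi w u = 0" using lw psubset.prems(1)[of u] Phi_ne[of w u] by metis
          then show ?thesis by (simp add: Phil_scalar Phil_wd)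
        qed
        then have "Phil w y = c w * Phi w w"
          unfolding y by (simp add: Phil_add Phil_sum Phil_scalar Phil_wd Phil_Rn lw psubset.prems(2))
            (intro sum.neutral ballI, metis DiffE singletonI mult_eq_0_iff)
        moreover have "loop_par M x = 1 \<Longrightarrow> count (mset w) x \<le> 1" for x using good by blast
        then have "Phi w w \<noteq> 0" by (rule Phi_self[OF lw(2)])
        ultimately have "c w = 0" using psubset.prems(4)[OF lw(2)] by simp
        then show ?thesis using y by (intro IH[of z c] psubset.prems(2)) (simp add: fs.h_zero)
      qed
    qed
  qed
qed

text \<open>The vanishing matrix coefficients lower the filtration degree of \<open>y\<close> step
  by step; in degree 0 only the relation ideal is left.\<close>

theorem rep_faithful:
  assumes "y \<in> carrier F" "\<And>n. rep n y = 0"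
  shows "y \<in> J"
proof -
  have "app (0 :: complex seqop) f = (\<lambda>s. 0)" for f by (simp add: fun_eq_iff app_simps)
  then have Phil: "Phil v y = 0" for v
    by (simp add: Phil_def assms(2) Ev_zero)
  have "y \<in> Rn n \<Longrightarrow> y \<in> J" for n
  proof (induction n)
    case 0
    have "x = 0" if "x \<in> short 0" for x
      using that by (simp add: short_def)
    moreover obtain j x where "j \<in> J" "x \<in> short 0" "y = j + x" using 0 by (auto simp: Rn_def)
    ultimately show ?case by (metis add.right_neutral)
  next
    case (Suc n)
    then obtain j x where x: "j \<in> J" "x \<in> short (Suc n)" "y = j + x" by (auto simp: Rn_def)
    let ?K = "Poly_Mapping.keys x"
    let ?f = "\<lambda>w. fscalar (Poly_Mapping.lookup x w) * wd (letters w)"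
    let ?A = "{w \<in> ?K. length (letters w) = n}" and ?B = "{w \<in> ?K. length (letters w) < n}"
    have "length (letters w) < Suc n" if "w \<in> ?K" for w
      using x(2) that unfolding short_def by blast
    then have "?K = ?A \<union> ?B" unfolding less_Suc_eq by blast
    moreover have "?A \<inter> ?B = {}" by auto
    ultimately have "sum ?f ?K = sum ?f ?A + sum ?f ?B"
      by (metis (no_types, lifting) finite_Un finite_keys sum.union_disjoint)
    moreover have inj: "inj_on letters ?A" by (rule inj_onI) (metis word.expand)
    then have "sum ?f ?A = (\<Sum>u\<in>letters ` ?A. fscalar (Poly_Mapping.lookup x (Word u)) * wd u)"
      by (subst sum.reindex) simp_all
    ultimately have y: "y = (\<Sum>u\<in>letters ` ?A. fscalar (Poly_Mapping.lookup x (Word u)) * wd u) + (sum ?f ?B + j)"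
      using x(3) free_expand[of x] by (simp add: ac_simps)
    have g: "set (letters w) \<subseteq> loop_gens M N" if "w \<in> ?K" for w
      using that x(2) by (auto simp: short_def free_superalgebra_def)
    have "sum ?f A \<in> short n" if "A \<subseteq> ?B" "finite A" for A
      using that(2,1)
    proof induction
      case (insert w A)
      then show ?case using g by (auto intro!: short_add short_scalar short_wd)
    qed (simp add: short_zero)
    then have "sum ?f ?B \<in> short n" by simp
    then have z: "sum ?f ?B + j \<in> Rn n" by (intro Rn_add Rn_short Rn_J x(1))
    have "y \<in> Rn n"
      by (rule Rn_descent[OF _ _ z y]) (use g Phil in auto)
    then show ?case by (rule Suc.IH)
  qed
  moreover have "y \<in> short (Suc (Max (insert 0 ((\<lambda>w. length (letters w)) ` Poly_Mapping.keys y))))"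
    using assms(1) by (auto simp: short_def less_Suc_eq_le intro!: Max_ge)
  ultimately show ?thesis using Rn_short by blast
qed

end

section \<open>RTT relations without signs\<close>

text \<open>\<open>w\<close> collects the diagonal entries of the \<open>R\<close>-matrix and
  \<open>m\<close> its transposition entries.\<close>

definition RTTs :: "(nat \<Rightarrow> nat \<Rightarrow> 's) \<Rightarrow> (nat \<Rightarrow> nat \<Rightarrow> 's) \<Rightarrow> nat set \<Rightarrow> (nat \<Rightarrow> nat \<Rightarrow> 's) \<Rightarrow> (nat \<Rightarrow> nat \<Rightarrow> 's::ring_1) \<Rightarrow> bool"
  where "RTTs w m I X Y \<longleftrightarrow> (\<forall>i\<in>I. \<forall>j\<in>I. \<forall>k\<in>I. \<forall>l\<in>I.
    w i k * (X i j * Y k l) + m i k * (X k j * Y i l) = w j l * (Y k l * X i j) + m l j * (Y k j * X i l))"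

text \<open>The relation of the first pair is applied on the left, then that of the second pair on
  the right. This requires the same central weights for both pairs, which is why the loop variable
  is later removed from the \<open>R\<close>-matrix.\<close>

lemma RTTs_coproduct:
  fixes w m :: "nat \<Rightarrow> nat \<Rightarrow> 's::ring_1"
  assumes w: "\<And>i k z. w i k * z = z * w i k" and m: "\<And>i k z. m i k * z = z * m i k"
    and 1: "RTTs w m I X1 Y1" and 2: "RTTs w m I X2 Y2"
    and c: "\<And>i j k l. X2 i j * Y1 k l = Y1 k l * X2 i j" "\<And>i j k l. Y2 i j * X1 k l = X1 k l * Y2 i j"
  shows "RTTs w m I (\<lambda>i j. \<Sum>n\<in>I. X1 i n * X2 n j) (\<lambda>i j. \<Sum>n\<in>I. Y1 i n * Y2 n j)"
  unfolding RTTs_def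
proof (intro ballI)
  fix i j k l assume I: "i \<in> I" "j \<in> I" "k \<in> I" "l \<in> I"
  have P: "(\<Sum>a\<in>I. X1 i' a * X2 a j') * (\<Sum>b\<in>I. Y1 k' b * Y2 b l')
      = (\<Sum>a\<in>I. \<Sum>b\<in>I. X1 i' a * Y1 k' b * (X2 a j' * Y2 b l'))" for i' j' k' l'
  proof -
    have "X1 i' a * X2 a j' * (Y1 k' b * Y2 b l') = X1 i' a * Y1 k' b * (X2 a j' * Y2 b l')" for a b
      by (metis c(1) mult.assoc)
    then show ?thesis by (simp add: sum_product)
  qed
  have Q: "(\<Sum>b\<in>I. Y1 k' b * Y2 b l') * (\<Sum>a\<in>I. X1 i' a * X2 a j')
      = (\<Sum>a\<in>I. \<Sum>b\<in>I. Y1 k' b * X1 i' a * (Y2 b l' * X2 a j'))" for i' j' k' l'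
  proof -
    have "Y1 k' b * Y2 b l' * (X1 i' a * X2 a j') = Y1 k' b * X1 i' a * (Y2 b l' * X2 a j')" for a b
      by (metis c(2) mult.assoc)
    then show ?thesis by (subst sum.swap) (simp add: sum_product)
  qed
  have R1: "w i k * (X1 i a * Y1 k b) + m i k * (X1 k a * Y1 i b)
      = w a b * (Y1 k b * X1 i a) + m b a * (Y1 k a * X1 i b)" if "a \<in> I" "b \<in> I" for a b
    using 1 I that by (auto simp: RTTs_def)
  have R2: "w a b * (X2 a j * Y2 b l) + m a b * (X2 b j * Y2 a l)
      = w j l * (Y2 b l * X2 a j) + m l j * (Y2 b j * X2 a l)" if "a \<in> I" "b \<in> I" for a b
    using 2 I that by (auto simp: RTTs_def)
  have "w i k * (\<Sum>a\<in>I. \<Sum>b\<in>I. X1 i a * Y1 k b * (X2 a j * Y2 b l))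
      + m i k * (\<Sum>a\<in>I. \<Sum>b\<in>I. X1 k a * Y1 i b * (X2 a j * Y2 b l))
    = (\<Sum>a\<in>I. \<Sum>b\<in>I. (w i k * (X1 i a * Y1 k b) + m i k * (X1 k a * Y1 i b)) * (X2 a j * Y2 b l))"
    by (simp add: sum_distrib_left sum.distrib distrib_right mult.assoc)
  also have "\<dots> = (\<Sum>a\<in>I. \<Sum>b\<in>I. (w a b * (Y1 k b * X1 i a) + m b a * (Y1 k a * X1 i b)) * (X2 a j * Y2 b l))"
    by (intro sum.cong refl) (simp add: R1)
  also have "\<dots> = (\<Sum>a\<in>I. \<Sum>b\<in>I. w a b * (Y1 k b * X1 i a) * (X2 a j * Y2 b l))
      + (\<Sum>a\<in>I. \<Sum>b\<in>I. m b a * (Y1 k a * X1 i b) * (X2 a j * Y2 b l))"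
    by (simp add: sum.distrib distrib_right)
  \<comment> \<open>Exchanging the summation indices turns \<open>m b a\<close> into
    \<open>m a b\<close>, the form in which the second relation applies.\<close>
  also have "(\<Sum>a\<in>I. \<Sum>b\<in>I. m b a * (Y1 k a * X1 i b) * (X2 a j * Y2 b l))
      = (\<Sum>a\<in>I. \<Sum>b\<in>I. m a b * (Y1 k b * X1 i a) * (X2 b j * Y2 a l))"
    by (rule sum.swap)
  also have "(\<Sum>a\<in>I. \<Sum>b\<in>I. w a b * (Y1 k b * X1 i a) * (X2 a j * Y2 b l))
      + (\<Sum>a\<in>I. \<Sum>b\<in>I. m a b * (Y1 k b * X1 i a) * (X2 b j * Y2 a l))
    = (\<Sum>a\<in>I. \<Sum>b\<in>I. (Y1 k b * X1 i a) * (w a b * (X2 a j * Y2 b l) + m a b * (X2 b j * Y2 a l)))"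
    by (simp add: sum.distrib distrib_left w[of _ _ "Y1 _ _ * X1 _ _"] m[of _ _ "Y1 _ _ * X1 _ _"] mult.assoc)
  also have "\<dots> = (\<Sum>a\<in>I. \<Sum>b\<in>I. (Y1 k b * X1 i a) * (w j l * (Y2 b l * X2 a j) + m l j * (Y2 b j * X2 a l)))"
    by (intro sum.cong refl) (simp add: R2)
  also have "\<dots> = w j l * (\<Sum>a\<in>I. \<Sum>b\<in>I. Y1 k b * X1 i a * (Y2 b l * X2 a j))
      + m l j * (\<Sum>a\<in>I. \<Sum>b\<in>I. Y1 k b * X1 i a * (Y2 b j * X2 a l))"
  proof -
    have "y * (w j l * z) = w j l * (y * z)" "y * (m l j * z) = m l j * (y * z)" for y z
      by (metis w mult.assoc) (metis m mult.assoc)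
    then show ?thesis by (simp add: sum_distrib_left sum.distrib distrib_left)
  qed
  finally show "w i k * ((\<Sum>n\<in>I. X1 i n * X2 n j) * (\<Sum>n\<in>I. Y1 k n * Y2 n l))
      + m i k * ((\<Sum>n\<in>I. X1 k n * X2 n j) * (\<Sum>n\<in>I. Y1 i n * Y2 n l))
    = w j l * ((\<Sum>n\<in>I. Y1 k n * Y2 n l) * (\<Sum>n\<in>I. X1 i n * X2 n j))
      + m l j * ((\<Sum>n\<in>I. Y1 k n * Y2 n j) * (\<Sum>n\<in>I. X1 i n * X2 n l))"
    unfolding P Q .
qed

text \<open>The Perk--Schultz \<open>R\<close>-matrix, in homogeneous spectral parameters \<open>\<alpha>\<close>, \<open>\<beta>\<close>.\<close>

definition psw :: "nat \<Rightarrow> (nat \<Rightarrow> 'c) \<Rightarrow> (nat \<Rightarrow> 'c) \<Rightarrow> 'c \<Rightarrow> 'c \<Rightarrow> nat \<Rightarrow> nat \<Rightarrow> 'c::comm_ring_1"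
  where "psw M Q Q' \<alpha> \<beta> i k = ksign (ipar M i * ipar M k) * (if i = k then \<alpha> * Q i - \<beta> * Q' i else \<alpha> - \<beta>)"

definition psm :: "'c \<Rightarrow> 'c \<Rightarrow> 'c \<Rightarrow> nat \<Rightarrow> nat \<Rightarrow> 'c::comm_ring_1"
  where "psm \<kappa> \<alpha> \<beta> i k = (if i = k then 0 else if k < i then \<kappa> * \<alpha> else \<kappa> * \<beta>)"

text \<open>The entries of the same \<open>R\<close>-matrix at spectral parameter \<open>Z\<close>,
  divided by \<open>Z - 1\<close>, with \<open>p = 1/(Z - 1)\<close> and
  \<open>p + 1 = Z/(Z - 1)\<close>. On the diagonal the parity operator is split off, which leaves
  \<open>Q i - 1\<close> instead of \<open>Q i\<close>.\<close>

definition psx :: "nat \<Rightarrow> (nat \<Rightarrow> 'c) \<Rightarrow> 'c \<Rightarrow> 'c \<Rightarrow> nat \<Rightarrow> nat \<Rightarrow> 'c::comm_ring_1"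
  where "psx M Q \<kappa> p i j = (if j < i then \<kappa> * (p + 1) else if i < j then \<kappa> * p
    else \<kappa> * p + ksign (ipar M i) * (Q i - 1))"

context
  fixes M :: nat and Q Q' :: "nat \<Rightarrow> 'c::idom" and \<alpha> \<beta> p r \<kappa> :: 'c
  assumes Q: "\<And>i. ksign (ipar M i) * \<kappa> = Q i - Q' i" and QQ: "\<And>i. Q i * Q' i = 1"
begin

private abbreviation "w \<equiv> psw M Q Q' \<alpha> \<beta>"
private abbreviation "m \<equiv> psm \<kappa> \<alpha> \<beta>"
private abbreviation "x \<equiv> psx M Q \<kappa> p"
private abbreviation "y \<equiv> psx M Q \<kappa> r"
private abbreviation "s a b \<equiv> (ksign (ipar M a * ipar M b) :: 'c)"
private abbreviation "D \<equiv> \<alpha> * p * (r + 1) - \<beta> * (p + 1) * r"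

private lemma Q'_eq: "Q' i = Q i - ksign (ipar M i) * \<kappa>"
  using Q[of i] by (simp add: algebra_simps)

private lemma QQ_eq: "Q i * Q i = 1 + ksign (ipar M i) * \<kappa> * Q i"
  "Q i * (Q i * z) = z + ksign (ipar M i) * \<kappa> * Q i * z"
proof -
  show 1: "Q i * Q i = 1 + ksign (ipar M i) * \<kappa> * Q i"
    using QQ[of i] unfolding Q'_eq by (simp add: algebra_simps)
  show "Q i * (Q i * z) = z + ksign (ipar M i) * \<kappa> * Q i * z"
    unfolding mult.assoc[symmetric, of "Q i" "Q i"] 1 by (simp add: distrib_right)
qed

private lemmas defs = psw_def psm_def psx_def

text \<open>All coefficients of the Yang-Baxter relation are multiples of \<open>D\<close>, whose
  vanishing says that \<open>\<alpha>/\<beta>\<close> is the quotient of the two spectral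
  parameters. Keeping \<open>D\<close> as a factor turns every case into a polynomial identity, with
  the quadratic relation for \<open>Q i\<close> as the only side condition.\<close>

lemma psw_psm_coeffs:
  shows "i \<noteq> j \<Longrightarrow> k \<noteq> i \<Longrightarrow>
      w i k * (x i j * y k i) + m i k * (x k j * s i k) - m i j * (y k j * s i k) = s i k * \<kappa> * \<kappa> * D"
    "i \<noteq> k \<Longrightarrow> k \<noteq> l \<Longrightarrow>
      m i k * (y i l * s k l) - w k l * (y k l * x i k) - m l k * (x i l * s k l) = - (s k l * \<kappa> * \<kappa> * D)"
    "i \<noteq> k \<Longrightarrow> k \<noteq> j \<Longrightarrow> m i k * (x k j * y i k) - m k j * (y k j * x i k)
      = (if i < k \<and> j < k then - 1 else if k < i \<and> k < j then 1 else 0) * \<kappa> * \<kappa> * \<kappa> * D"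
    "k \<noteq> i \<Longrightarrow> w i k * (y k i * s i i) - w i i * (y k i * s k i)
        + (w i k * (x i i * y k i) + m i k * (x k i * s i k)) = s i k * \<kappa> * \<kappa> * D"
    "l \<noteq> i \<Longrightarrow> w i i * (y i l * s i l) - w i l * (y i l * s i i)
        - w i l * (y i l * x i i) - m l i * (x i l * s i l) = - (s i l * \<kappa> * \<kappa> * D)"
    "j \<noteq> i \<Longrightarrow> w i i * (x i j * s i i) - w j i * (x i j * s i j) - m i j * (y i j * x i i)
        + (w i i * (x i j * y i i) - m i j * (y i j * s i i)) = s i i * (if i < j then Q i else Q' i) * \<kappa> * \<kappa> * D"
    "j \<noteq> i \<Longrightarrow> w i j * (x i j * s j i) - w j j * (x i j * s j j) + m i j * (x j j * y i j)
        + (m i j * (y i j * s j j) - w j j * (y j j * x i j)) = - (s j j * (if i < j then Q j else Q' j) * \<kappa> * \<kappa> * D)"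
proof -
  have ss: "s a b * s a b = 1" "s a b * (s a b * z) = z" for a b z
    by (cases "ipar M a * ipar M b"; simp)+
  show "w i k * (x i j * y k i) + m i k * (x k j * s i k) - m i j * (y k j * s i k) = s i k * \<kappa> * \<kappa> * D"
    if "i \<noteq> j" "k \<noteq> i"
    using that by (cases "i < k"; cases "i < j"; cases "k < j"; cases "j = k"; simp add: defs algebra_simps)
  show "m i k * (y i l * s k l) - w k l * (y k l * x i k) - m l k * (x i l * s k l) = - (s k l * \<kappa> * \<kappa> * D)"
    if "i \<noteq> k" "k \<noteq> l"
    using that by (cases "i < k"; cases "l < k"; cases "i < l"; cases "i = l"; simp add: defs algebra_simps)
  show "m i k * (x k j * y i k) - m k j * (y k j * x i k)
      = (if i < k \<and> j < k then - 1 else if k < i \<and> k < j then 1 else 0) * \<kappa> * \<kappa> * \<kappa> * D"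
    if "i \<noteq> k" "k \<noteq> j"
    using that by (cases "i < k"; cases "j < k"; simp add: defs algebra_simps)
  show "w i k * (y k i * s i i) - w i i * (y k i * s k i)
        + (w i k * (x i i * y k i) + m i k * (x k i * s i k)) = s i k * \<kappa> * \<kappa> * D"
    if "k \<noteq> i"
    using that by (cases "i < k"; cases "ipar M i"; simp add: defs Q'_eq algebra_simps)
  show "w i i * (y i l * s i l) - w i l * (y i l * s i i)
        - w i l * (y i l * x i i) - m l i * (x i l * s i l) = - (s i l * \<kappa> * \<kappa> * D)"
    if "l \<noteq> i"
    using that by (cases "i < l"; cases "ipar M i"; simp add: defs Q'_eq algebra_simps)
  show "w i i * (x i j * s i i) - w j i * (x i j * s i j) - m i j * (y i j * x i i)
        + (w i i * (x i j * y i i) - m i j * (y i j * s i i)) = s i i * (if i < j then Q i else Q' i) * \<kappa> * \<kappa> * D"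
    if "j \<noteq> i"
    using that by (cases "i < j"; cases "ipar M i"; cases "ipar M j"; simp add: defs Q'_eq algebra_simps QQ_eq)
  show "w i j * (x i j * s j i) - w j j * (x i j * s j j) + m i j * (x j j * y i j)
        + (m i j * (y i j * s j j) - w j j * (y j j * x i j)) = - (s j j * (if i < j then Q j else Q' j) * \<kappa> * \<kappa> * D)"
    if "j \<noteq> i"
    using that by (cases "i < j"; cases "ipar M i"; cases "ipar M j"; simp add: defs Q'_eq algebra_simps QQ_eq)
qed

end

section \<open>The Yang-Baxter relation for the L-operator over abstract matrix units\<close>

locale matrix_units =
  fixes M :: nat and \<iota> :: "'c::idom \<Rightarrow> 's::ring_1" and e :: "nat \<Rightarrow> nat \<Rightarrow> 's" and \<sigma> :: "bit \<Rightarrow> 's"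
  assumes i_add: "\<iota> (a + b) = \<iota> a + \<iota> b" and i_mult: "\<iota> (a * b) = \<iota> a * \<iota> b" and i_one: "\<iota> 1 = 1"
    and i_e: "e i j * \<iota> a = \<iota> a * e i j" and i_s: "\<sigma> p * \<iota> a = \<iota> a * \<sigma> p"
    and ee: "e i j * e k l = (if j = k then e i l else 0)"
    and se: "\<sigma> p * e i j = \<iota> (ksign (p * ipar M i)) * e i j"
    and es: "e i j * \<sigma> p = \<iota> (ksign (p * ipar M j)) * e i j"
    and ss: "\<sigma> p * \<sigma> p' = \<sigma> (p + p')"
begin

lemma i_zero: "\<iota> 0 = 0"
  using i_add[of 0 0] by simp

lemma i_uminus: "\<iota> (- a) = - \<iota> a"
  using i_add[of a "- a"] i_zero by (simp add: eq_neg_iff_add_eq_0 add.commute)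

text \<open>The L-operator with the transposed matrix unit \<open>e j i\<close>, matching the action
  on functions. The map \<open>\<iota>\<close> stays abstract because in use it also inserts powers
  of the loop variable.\<close>

definition X where "X \<xi> i j = (if i = j then \<sigma> (ipar M i) else 0) + \<iota> (\<xi> i j) * e j i"

lemma XX: "X \<xi> i j * X \<upsilon> k l = \<iota> (if i = j \<and> k = l then 1 else 0) * \<sigma> (ipar M i + ipar M k)
    + \<iota> (if i = j then \<upsilon> k l * ksign (ipar M i * ipar M l) else 0) * e l k
    + \<iota> (if k = l then \<xi> i j * ksign (ipar M k * ipar M i) else 0) * e j i
    + \<iota> (if i = l then \<xi> i j * \<upsilon> k l else 0) * e j k"
proof -
  have 1: "\<sigma> p * (\<iota> a * e b c) = \<iota> (a * ksign (p * ipar M b)) * e b c" for p a b c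
    by (simp only: mult.assoc[symmetric] i_s) (simp only: mult.assoc se i_mult)
  have 2: "\<iota> a * e b c * \<sigma> p = \<iota> (a * ksign (p * ipar M c)) * e b c" for p a b c
    by (simp only: mult.assoc es i_mult)
  have 3: "\<iota> a * e b c * (\<iota> d * e f g) = \<iota> (if c = f then a * d else 0) * e b g" for a b c d f g
  proof -
    have "\<iota> a * e b c * (\<iota> d * e f g) = \<iota> (a * d) * (e b c * e f g)"
      by (metis i_e i_mult mult.assoc)
    then show ?thesis by (simp add: ee i_zero)
  qed
  show ?thesis
    unfolding X_def distrib_left distrib_right 3
    by (cases "i = j"; cases "k = l")
      (simp_all only: if_True if_False simp_thms 1 2 ss i_one i_zero mult_zero_left mult_zero_right mult_1_left add_0_left add_0_right add_ac)
qed

lemma yang_baxter: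
  assumes rel: "\<alpha> * p * (r + 1) = \<beta> * (p + 1) * r" and Q: "\<And>i. ksign (ipar M i) * \<kappa> = Q i - Q' i"
    and QQ: "\<And>i. Q i * Q' i = 1"
  shows "RTTs (\<lambda>i k. \<iota> (psw M Q Q' \<alpha> \<beta> i k)) (\<lambda>i k. \<iota> (psm \<kappa> \<alpha> \<beta> i k)) UNIV
    (X (psx M Q \<kappa> p)) (X (psx M Q \<kappa> r))"
  unfolding RTTs_def
proof (intro ballI)
  fix i j k l :: nat
  let ?w = "psw M Q Q' \<alpha> \<beta>" and ?m = "psm \<kappa> \<alpha> \<beta>" and ?x = "psx M Q \<kappa> p" and ?y = "psx M Q \<kappa> r"
  let ?s = "\<lambda>a b. ksign (ipar M a * ipar M b) :: 'c"
  define c0 c0' c1 c2 c3 c4 where c: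
    "c0 = (if i = j \<and> k = l then ?w i k - ?w j l else 0)"
    "c0' = (if k = j \<and> i = l then ?m i k - ?m l j else 0)"
    "c1 = (if i = j then ?w i k * (?y k l * ?s i l) - ?w j l * (?y k l * ?s k i) else 0)"
    "c2 = (if k = l then ?w i k * (?x i j * ?s k i) - ?w j l * (?x i j * ?s k j)
        + ?m i k * (?x k j * ?y i l) - ?m l j * (?y k j * ?x i l) else 0)"
    "c3 = (if i = l then ?w i k * (?x i j * ?y k l) + ?m i k * (?x k j * ?s i k) - ?m l j * (?y k j * ?s i k) else 0)"
    "c4 = (if k = j then ?m i k * (?y i l * ?s k l) - ?w j l * (?y k l * ?x i j) - ?m l j * (?x i l * ?s k l) else 0)"
  have expand: "\<iota> (?w i k) * (X ?x i j * X ?y k l) + \<iota> (?m i k) * (X ?x k j * X ?y i l)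
      - (\<iota> (?w j l) * (X ?y k l * X ?x i j) + \<iota> (?m l j) * (X ?y k j * X ?x i l))
    = \<iota> c0 * \<sigma> (ipar M i + ipar M k) + \<iota> c0' * \<sigma> (ipar M i + ipar M k)
      + \<iota> c1 * e l k + \<iota> c2 * e j i + \<iota> c3 * e j k + \<iota> c4 * e l i"
  proof -
    have ii: "\<iota> a * (\<iota> b * x) = \<iota> (a * b) * x" for a b x by (simp add: i_mult mult.assoc)
    have bitc: "ipar M a * ipar M b = ipar M b * ipar M a" for a b by (rule mult.commute)
    show ?thesis
      unfolding XX distrib_left ii c
      by (cases "i = j"; cases "k = l"; cases "i = l"; cases "k = j")
        (simp_all only: if_True if_False simp_thms mult_zero_right mult_zero_left i_zero add_0_left add_0_right
          i_add i_uminus left_diff_distrib distrib_right diff_conv_add_uminus mult_1_right minus_add_distrib mult_minus_left add_ac minus_zero bitc)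
  qed
  have sc: "?s a b = ?s b a" for a b by (simp only: mult.commute)
  have D: "\<alpha> * p * (r + 1) - \<beta> * (p + 1) * r = 0" using rel by simp
  note co = psw_psm_coeffs[where M = M and Q = Q and Q' = Q' and \<kappa> = \<kappa> and \<alpha> = \<alpha> and \<beta> = \<beta> and p = p and r = r,
      OF Q QQ, unfolded D mult_zero_right neg_equal_0_iff_equal neg_0_equal_iff_equal minus_zero]
  have w: "?w a b = ?s a b * (\<alpha> - \<beta>)" if "a \<noteq> b" for a b using that by (simp add: psw_def)
  have m: "?m a a = 0" for a by (simp add: psm_def)
  have c0: "c0 = 0" "c0' = 0" by (auto simp: c)
  have z: "\<iota> a * u + \<iota> b * u = 0" if "a + b = 0" for a b u
    using that by (metis i_add i_zero distrib_right mult_zero_left)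
  \<comment> \<open>For coinciding indices some of the four matrix units coincide as well, and then
    only the sum of their coefficients vanishes; the cases follow these coincidences.\<close>
  consider (a) "i = j" "k = l" "i \<noteq> k" | (b) "i = j" "k = l" "i = k"
    | (d) "i = j" "k \<noteq> l" "i \<noteq> l" "i \<noteq> k" | (e) "i = j" "i = l" "k \<noteq> i" | (f) "i = j" "i = k" "l \<noteq> i"
    | (g) "k = l" "i \<noteq> j" "k \<noteq> i" "k \<noteq> j" | (h) "k = l" "k = i" "j \<noteq> i" | (i) "k = l" "k = j" "j \<noteq> i"
    | (o) "i \<noteq> j" "k \<noteq> l" by blast
  then have c14: "\<iota> c1 * e l k + \<iota> c2 * e j i + \<iota> c3 * e j k + \<iota> c4 * e l i = 0"
  proof cases
    case a
    have "c1 = 0" "c3 = 0" "c4 = 0" using a by (simp_all add: c w sc)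
    moreover have "c2 = 0" using a co(3)[of i k i] by (simp add: c sc)
    ultimately show ?thesis by (simp add: i_zero)
  next
    case b
    then have "c1 = 0" "c2 = 0" "c3 + c4 = 0" by (simp_all add: c m)
    then show ?thesis using b z[of c3 c4] by (simp add: i_zero)
  next
    case d
    then have "c1 = 0" "c2 = 0" "c3 = 0" "c4 = 0" by (simp_all add: c w sc)
    then show ?thesis by (simp add: i_zero)
  next
    case e
    then have "c2 = 0" "c4 = 0" by (auto simp: c)
    moreover have "c1 + c3 = 0" using e co(4)[of k i] by (simp add: c sc m)
    ultimately show ?thesis using e z[of c1 c3] by (simp add: i_zero)
  next
    case f
    then have "c2 = 0" "c3 = 0" by (auto simp: c)
    moreover have "c1 = ?w i i * (?y i l * ?s i l) - ?w i l * (?y i l * ?s i i)"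
      "c4 = - (?w i l * (?y i l * ?x i i)) - ?m l i * (?x i l * ?s i l)"
      using f by (simp_all add: c m)
    then have "c1 + c4 = 0" using co(5)[OF f(3)]
      by (simp only: diff_conv_add_uminus add.assoc)
    ultimately show ?thesis using f z[of c1 c4] by (simp add: i_zero)
  next
    case g
    then have "c1 = 0" "c3 = 0" "c4 = 0" by (auto simp: c)
    moreover have "c2 = 0" using g co(3)[of i k j] by (simp add: c w sc)
    ultimately show ?thesis by (simp add: i_zero)
  next
    case h
    then have "c1 = 0" "c4 = 0" by (auto simp: c)
    moreover have "c2 + c3 = 0" using h co(6)[of j i] by (simp add: c sc m)
    ultimately show ?thesis using h z[of c2 c3] by (simp add: i_zero)
  next
    case i
    then have "c1 = 0" "c3 = 0" by (auto simp: c)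
    moreover have "c2 + c4 = 0" using i co(7)[of j i] by (simp add: c sc m)
    ultimately show ?thesis using i z[of c2 c4] by (simp add: i_zero)
  next
    case o
    then have "c1 = 0" "c2 = 0" by (auto simp: c)
    moreover have "c3 = 0" using o co(1)[of i j k] by (auto simp: c)
    moreover have "c4 = 0" using o co(2)[of i k l] by (auto simp: c)
    ultimately show ?thesis by (simp add: i_zero)
  qed
  show "\<iota> (?w i k) * (X ?x i j * X ?y k l) + \<iota> (?m i k) * (X ?x k j * X ?y i l)
    = \<iota> (?w j l) * (X ?y k l * X ?x i j) + \<iota> (?m l j) * (X ?y k j * X ?x i l)"
    using expand c14 unfolding c0 by (simp add: i_zero add.assoc)
qed

end

section \<open>Tensor products of vector representations of the quantum loop algebra\<close>

unbundle fps_syntax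

lemma fps_commI:
  fixes f g :: "'a::ring_1 fps"
  assumes "\<And>i j. f $ i * g $ j = g $ j * f $ i"
  shows "f * g = g * f"
proof (rule fps_ext)
  fix n
  have "(f * g) $ n = (\<Sum>i=0..n. g $ (n - i) * f $ i)"
    by (simp add: fps_mult_nth assms)
  also have "\<dots> = (\<Sum>i=0..n. g $ i * f $ (n - i))"
    by (subst sum.atLeastAtMost_rev) simp
  finally show "(f * g) $ n = (g * f) $ n" by (simp add: fps_mult_nth)
qed

text \<open>Series in two variables are series in the second over series in the first:
  \<open>fps_const\<close> embeds those in the first variable and \<open>outer\<close> those in the
  second.\<close>

definition outer :: "'a fps \<Rightarrow> 'a::ring_1 fps fps"
  where "outer F = Abs_fps (\<lambda>s. fps_const (F $ s))"

lemma outer_nth: "outer F $ s = fps_const (F $ s)"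
  by (simp add: outer_def)

lemma fps_const_sum': "fps_const (\<Sum>i\<in>A. f i) = (\<Sum>i\<in>A. fps_const (f i :: 'a::ring_1))"
  by (rule fps_ext) (simp add: fps_sum_nth)

lemma outer_hom:
  "outer (F + H) = outer F + outer H" "outer (F * H) = outer F * outer H" "outer 1 = 1" "outer 0 = 0"
  "outer (- F) = - outer F" "outer (F - H) = outer F - outer H"
  by (rule fps_ext, simp add: outer_nth fps_mult_nth fps_const_sum')+

lemma outer_sum: "outer (\<Sum>i\<in>A. f i) = (\<Sum>i\<in>A. outer (f i))"
  by (induction A rule: infinite_finite_induct) (simp_all add: outer_hom)

lemma const_outer_nth: "(fps_const A * outer B) $ s $ r = A $ r * B $ s" "(outer B * fps_const A) $ s $ r = B $ s * A $ r"
  by (simp_all add: outer_nth)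

lemma psx_hom:
  assumes "\<And>a b. h (a + b) = h a + h b" "\<And>a b. h (a * b) = h a * h b" "h 1 = 1"
  shows "h (psx M Q \<kappa> p i j) = psx M (\<lambda>i. h (Q i)) (h \<kappa>) (h p) i j"
proof -
  have 0: "h 0 = 0" using assms(1)[of 0 0] by simp
  have m: "h (- a) = - h a" for a using assms(1)[of a "- a"] 0 by (simp add: eq_neg_iff_add_eq_0 add.commute)
  have k: "h (ksign p) = ksign p" for p by (cases p; simp add: assms m)
  have d: "h (a - 1) = h a - 1" for a using assms(1)[of a "- 1"] m assms(3) by simp
  show ?thesis by (simp add: psx_def assms k d)
qed

section \<open>Substitution of the loop variable into series in two spectral parameters\<close>

type_synonym bb = "ratfun seqop"

definition zs :: "nat \<Rightarrow> int \<Rightarrow> bb"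
  where "zs n t = slot n (\<lambda>_. 1) (\<lambda>z. (fst z, snd z + t))"

lemma app_zs: "app (zs n t) f s = f (s(n := (fst (s n), snd (s n) + t)))"
  by (simp add: zs_def app_slot)

lemma zs_mult: "zs n a * zs n b = zs n (a + b)"
  by (rule linop_eqI) (simp add: app_simps app_zs add.assoc)

lemma zs_0: "zs n 0 = 1"
  by (rule linop_eqI) (simp add: app_simps app_zs)

lemma zs_mE: "zs n t * mE n a b r = mE n a b (t + r)" "mE n a b r * zs n t = mE n a b (t + r)"
  by (rule linop_eqI; simp add: app_simps app_zs app_mE ac_simps)+

lemma zs_sg: "zs n t * sg M n p = sg M n p * zs n t"
  by (rule linop_eqI) (simp add: app_simps app_zs app_sg)

lemma sc_sum: "sc (\<Sum>i\<in>A. f i) = (\<Sum>i\<in>A. sc (f i))"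
proof (induction A rule: infinite_finite_induct)
  case (insert x F)
  then show ?case by (simp add: sc_add)
qed (simp_all add: linop_eqI app_simps)

lemma sc_uminus: "sc (- c) = - sc c" and sc_0: "sc 0 = 0"
  by (rule linop_eqI; simp add: app_simps)+

lemma sc_left: "A * (sc c * B) = sc c * (A * B)"
  by (metis sc_comm mult.assoc)

text \<open>Multiplies the first series variable by the \<open>d\<close>-th and the second by the
  \<open>e\<close>-th power of the loop variable, which acts through the shift
  \<open>zs n\<close>.\<close>

definition io :: "nat \<Rightarrow> int \<Rightarrow> int \<Rightarrow> ratfun fps fps \<Rightarrow> bb fps fps"
  where "io n d e f = Abs_fps (\<lambda>s. Abs_fps (\<lambda>r. sc (f $ s $ r) * zs n (d * int r + e * int s)))"

lemma io_nth: "io n d e f $ s $ r = sc (f $ s $ r) * zs n (d * int r + e * int s)"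
  by (simp add: io_def)

lemma fps2_ext: "(\<And>s r. f $ s $ r = g $ s $ r) \<Longrightarrow> f = g"
  by (intro fps_ext)

lemma io_add: "io n d e (f + g) = io n d e f + io n d e g"
  by (rule fps2_ext) (simp add: io_nth sc_add distrib_right)

lemma io_one: "io n d e 1 = 1"
proof (rule fps2_ext)
  fix s r
  show "io n d e 1 $ s $ r = 1 $ s $ r"
    by (cases "s = 0"; cases "r = 0"; simp add: io_nth sc_one sc_0 zs_0)
qed

lemma io_mult: "io n d e (f * g) = io n d e f * io n d e g"
proof (rule fps2_ext)
  fix s r
  have "(io n d e f * io n d e g) $ s $ r
      = (\<Sum>a=0..s. \<Sum>b=0..r. sc (f $ a $ b) * zs n (d * int b + e * int a)
          * (sc (g $ (s - a) $ (r - b)) * zs n (d * int (r - b) + e * int (s - a))))"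
    by (simp add: fps_mult_nth fps_sum_nth io_nth)
  also have "\<dots> = (\<Sum>a=0..s. \<Sum>b=0..r. sc (f $ a $ b * g $ (s - a) $ (r - b)) * zs n (d * int r + e * int s))"
  proof (intro sum.cong refl)
    fix a b assume ab: "a \<in> {0..s}" "b \<in> {0..r}"
    have eq: "d * int b + e * int a + (d * int (r - b) + e * int (s - a)) = d * int r + e * int s"
    proof -
      have "int (r - b) = int r - int b" "int (s - a) = int s - int a" using ab by auto
      then show ?thesis by (simp add: algebra_simps)
    qed
    show "sc (f $ a $ b) * zs n (d * int b + e * int a) * (sc (g $ (s - a) $ (r - b)) * zs n (d * int (r - b) + e * int (s - a)))
      = sc (f $ a $ b * g $ (s - a) $ (r - b)) * zs n (d * int r + e * int s)"
      by (simp only: sc_mult mult.assoc sc_left[of "zs _ _"] zs_mult eq)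
  qed
  also have "\<dots> = io n d e (f * g) $ s $ r"
    by (simp add: io_nth fps_mult_nth fps_sum_nth sc_sum sum_distrib_right)
  finally show "io n d e (f * g) $ s $ r = (io n d e f * io n d e g) $ s $ r" by simp
qed

lemma io_uminus: "io n d e (- f) = - io n d e f"
  by (rule fps2_ext) (simp add: io_nth sc_uminus)

lemma io_ksign: "io n d e (ksign p) = ksign p"
  by (cases p) (simp_all add: io_one io_uminus)

lemma io_ksign_const: "ksign p * fps_const (fps_const x) = fps_const (fps_const (ksign p * x :: 'a::ring_1))"
  by (cases p) simp_all

abbreviation cst :: "'a \<Rightarrow> 'a::ring_1 fps fps" where "cst x \<equiv> fps_const (fps_const x)"

lemma matrix_units_slot:
  "matrix_units M (io n d e) (\<lambda>i j. cst (mE n i j 0)) (\<lambda>p. cst (sg M n p))"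
proof
  show "cst (mE n i j 0) * io n d e a = io n d e a * cst (mE n i j 0)" for i j a
    by (intro fps_commI) (simp add: io_nth zs_mE sc_left mult.assoc)
  show "cst (sg M n p) * io n d e a = io n d e a * cst (sg M n p)" for p a
    by (intro fps_commI) (simp add: io_nth zs_sg sc_left mult.assoc)
qed (simp_all add: io_add io_mult io_one mE_mult sg_mE mE_sg sg_sg io_ksign io_ksign_const)

definition Q1 :: "nat \<Rightarrow> nat \<Rightarrow> ratfun fps" where "Q1 M i = fps_const (qi M i)"
definition Q1' :: "nat \<Rightarrow> nat \<Rightarrow> ratfun fps" where "Q1' M i = fps_const (inverse (qi M i))"
definition kap :: "ratfun fps" where "kap = fps_const (qvar - inverse qvar)"

lemma kap_Q: "ksign (ipar M i) * fps_const kap = fps_const (Q1 M i) - fps_const (Q1' M i)"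
  "fps_const (Q1 M i) * fps_const (Q1' M i) = 1"
  using qvar_nz by (auto simp: kap_def Q1_def Q1'_def qi_def ksign_def)

text \<open>
  The sign \<open>\<epsilon>\<close> is \<open>- 1\<close> for the series \<open>T(u)\<close>, in powers of \<open>u\<close>, and \<open>1\<close> for \<open>T\<^sup>~(u)\<close>, in powers of \<open>u\<^sup>-\<^sup>1\<close>.
\<close>

definition pser :: "int \<Rightarrow> ratfun fps"
  where "pser \<epsilon> = Abs_fps (\<lambda>r. if \<epsilon> = - 1 then - 1 else if r = 0 then 0 else 1)"

text \<open>In terms of the series variable \<open>X\<close>, both are expansions of
  \<open>1/(Z - 1)\<close>: with \<open>Z = X\<close> for the sign -1 and with
  \<open>Z = 1/X\<close> for the sign 1.\<close>

lemma pser_rel: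
  "fps_const fps_X * fps_const (pser (- 1)) = fps_const (pser (- 1)) + 1"
  "fps_const fps_X * (fps_const (pser 1) + 1) = fps_const (pser 1)"
  "fps_X * outer (pser (- 1)) = outer (pser (- 1)) + 1"
  "fps_X * (outer (pser 1) + 1) = outer (pser 1)"
proof -
  have 1: "fps_X * pser (- 1) = pser (- 1) + 1" "fps_X * (pser 1 + 1) = pser 1"
    by (rule fps_ext; simp add: pser_def)+
  show "fps_const fps_X * fps_const (pser (- 1)) = fps_const (pser (- 1)) + 1"
    using arg_cong[OF 1(1), of fps_const] by (simp flip: fps_const_add)
  show "fps_const fps_X * (fps_const (pser 1) + 1) = fps_const (pser 1)"
    using arg_cong[OF 1(2), of fps_const] by (simp flip: fps_const_add fps_const_mult)
  have X: "outer fps_X = (fps_X :: ratfun fps fps)"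
    by (rule fps_ext) (simp add: outer_nth fps_X_def)
  show "fps_X * outer (pser (- 1)) = outer (pser (- 1)) + 1"
    using arg_cong[OF 1(1), of outer] by (simp only: outer_hom X)
  show "fps_X * (outer (pser 1) + 1) = outer (pser 1)"
    using arg_cong[OF 1(2), of outer] by (simp only: outer_hom X)
qed

text \<open>The last two entries are proportional to \<open>(u, v)\<close>. Negative powers are
  cleared by the factor \<open>1/(u v)\<close> in the second case and \<open>1/u\<close> in the
  third, since there the series variables are inverse to \<open>u\<close> or
  \<open>v\<close>.\<close>

definition spec_params :: "(int \<times> int \<times> ratfun fps fps \<times> ratfun fps fps) set"
  where "spec_params = {(- 1, - 1, fps_const fps_X, fps_X), (1, 1, fps_X, fps_const fps_X),
    (1, - 1, 1, fps_const fps_X * fps_X)}"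

lemma spec_rel:
  assumes "(\<epsilon>, \<delta>, \<alpha>, \<beta>) \<in> spec_params"
  shows "\<alpha> * fps_const (pser \<epsilon>) * (outer (pser \<delta>) + 1) = \<beta> * (fps_const (pser \<epsilon>) + 1) * outer (pser \<delta>)"
proof -
  have 1: "U * a * (b + 1) = V * (a + 1) * b" if "U * a = a + 1" "V * b = b + 1" for U V a b :: "ratfun fps fps"
    using that by (metis mult.commute mult.left_commute)
  have 2: "V * a * (b + 1) = U * (a + 1) * b" if "U * (a + 1) = a" "V * (b + 1) = b" for U V a b :: "ratfun fps fps"
    using that by (metis mult.commute mult.left_commute)
  have 3: "1 * a * (b + 1) = U * V * (a + 1) * b" if "U * (a + 1) = a" "V * b = b + 1" for U V a b :: "ratfun fps fps"
  proof -
    have "U * V * (a + 1) * b = (U * (a + 1)) * (V * b)" by (simp only: ac_simps)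
    then show ?thesis using that by simp
  qed
  from assms consider "\<epsilon> = - 1" "\<delta> = - 1" "\<alpha> = fps_const fps_X" "\<beta> = fps_X"
    | "\<epsilon> = 1" "\<delta> = 1" "\<alpha> = fps_X" "\<beta> = fps_const fps_X"
    | "\<epsilon> = 1" "\<delta> = - 1" "\<alpha> = 1" "\<beta> = fps_const fps_X * fps_X"
    by (auto simp: spec_params_def)
  then show ?thesis
    by cases (simp_all only: 1[OF pser_rel(1,3)] 2[OF pser_rel(2,4)] 3[OF pser_rel(2,3)])
qed

text \<open>Both signs expand the same L-operator at \<open>u/x\<close>, with \<open>x\<close> the
  loop variable: around 0 for the sign -1 and around infinity for the sign 1.\<close>

definition Lf :: "nat \<Rightarrow> int \<Rightarrow> nat \<Rightarrow> nat \<Rightarrow> nat \<Rightarrow> bb fps"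
  where "Lf M \<epsilon> n i j = Abs_fps (\<lambda>r. (if i = j \<and> r = 0 then sg M n (ipar M i) else 0)
    + sc (psx M (Q1 M) kap (pser \<epsilon>) i j $ r) * mE n j i (\<epsilon> * int r))"

abbreviation Rw where "Rw M n d e \<alpha> \<beta> i k \<equiv> io n d e (psw M (\<lambda>i. fps_const (Q1 M i)) (\<lambda>i. fps_const (Q1' M i)) \<alpha> \<beta> i k)"
abbreviation Rm where "Rm n d e \<alpha> \<beta> i k \<equiv> io n d e (psm (fps_const kap) \<alpha> \<beta> i k)"

lemma outer_const: "outer (fps_const c) = fps_const (fps_const c)"
  by (rule fps_ext) (simp add: outer_nth)

lemma RTTs_Lf:
  assumes "(\<epsilon>, \<delta>, \<alpha>, \<beta>) \<in> spec_params"
  shows "RTTs (Rw M n \<epsilon> \<delta> \<alpha> \<beta>) (Rm n \<epsilon> \<delta> \<alpha> \<beta>) I (\<lambda>i j. fps_const (Lf M \<epsilon> n i j)) (\<lambda>i j. outer (Lf M \<delta> n i j))"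
proof -
  interpret matrix_units M "io n \<epsilon> \<delta>" "\<lambda>i j. cst (mE n i j 0)" "\<lambda>p. cst (sg M n p)"
    by (rule matrix_units_slot)
  let ?Q = "\<lambda>i. fps_const (Q1 M i)"
  have h1: "psx M ?Q (fps_const kap) (fps_const (pser \<epsilon>)) i j = fps_const (psx M (Q1 M) kap (pser \<epsilon>) i j)" for i j
    by (rule psx_hom[symmetric]) simp_all
  have h2: "psx M ?Q (fps_const kap) (outer (pser \<delta>)) i j = outer (psx M (Q1 M) kap (pser \<delta>) i j)" for i j
    using psx_hom[of outer M "Q1 M" kap "pser \<delta>" i j]
    by (simp add: outer_hom Q1_def kap_def outer_const)
  have 1: "X (psx M ?Q (fps_const kap) (fps_const (pser \<epsilon>))) i j = fps_const (Lf M \<epsilon> n i j)" for i j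
    unfolding X_def h1 by (rule fps2_ext) (auto simp: Lf_def io_nth mult.assoc zs_mE sc_0 split: if_splits)
  have 2: "X (psx M ?Q (fps_const kap) (outer (pser \<delta>))) i j = outer (Lf M \<delta> n i j)" for i j
    unfolding X_def h2 by (rule fps2_ext) (auto simp: Lf_def io_nth outer_nth mult.assoc zs_mE sc_0 split: if_splits)
  have "RTTs (Rw M n \<epsilon> \<delta> \<alpha> \<beta>) (Rm n \<epsilon> \<delta> \<alpha> \<beta>) UNIV
      (X (psx M ?Q (fps_const kap) (fps_const (pser \<epsilon>)))) (X (psx M ?Q (fps_const kap) (outer (pser \<delta>))))"
    by (rule yang_baxter[OF spec_rel[OF assms] kap_Q])
  then show ?thesis unfolding RTTs_def 1 2 by blast
qed

text \<open>Homogeneity of weight \<open>t\<close> when the two series variables have weights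
  \<open>d\<close> and \<open>e\<close>.\<close>

definition hw :: "int \<Rightarrow> int \<Rightarrow> int \<Rightarrow> ratfun fps fps \<Rightarrow> bool"
  where "hw d e t f \<longleftrightarrow> (\<forall>s r. f $ s $ r \<noteq> 0 \<longrightarrow> d * int r + e * int s = t)"

lemma hw_diff: "hw d e t f \<Longrightarrow> hw d e t g \<Longrightarrow> hw d e t (f - g)"
  unfolding hw_def by (metis diff_zero fps_sub_nth)

lemma hw_cst: "hw d e t f \<Longrightarrow> hw d e t (cst c * f)" "hw d e t f \<Longrightarrow> hw d e t (f * cst c)"
  by (auto simp: hw_def)

lemma hw_ksign: "hw d e t f \<Longrightarrow> hw d e t (ksign p * f)"
  by (cases p) (auto simp: hw_def)

lemma hw_0: "hw d e t 0"
  by (simp add: hw_def)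

lemma hw_spec:
  assumes "(\<epsilon>, \<delta>, \<alpha>, \<beta>) \<in> spec_params"
  obtains t where "hw \<epsilon> \<delta> t \<alpha>" "hw \<epsilon> \<delta> t \<beta>"
proof -
  have "hw (- 1) (- 1) (- 1) (fps_const fps_X)" "hw (- 1) (- 1) (- 1) fps_X"
    "hw 1 1 1 (fps_const fps_X)" "hw 1 1 1 fps_X" "hw 1 (- 1) 0 1" "hw 1 (- 1) 0 (fps_const fps_X * fps_X)"
    by (auto simp: hw_def fps_X_def split: if_splits)
  then show ?thesis using assms that by (auto simp: spec_params_def)
qed

lemma io_hw: "hw d e t f \<Longrightarrow> cst (zs n (- t)) * io n d e f = io n 0 0 f"
proof (rule fps2_ext)
  fix s r assume f: "hw d e t f"
  show "(cst (zs n (- t)) * io n d e f) $ s $ r = io n 0 0 f $ s $ r"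
  proof (cases "f $ s $ r = 0")
    case False
    then have "d * int r + e * int s = t" using f unfolding hw_def by blast
    then show ?thesis by (simp add: io_nth zs_mult sc_left zs_0)
  qed (simp add: io_nth sc_0)
qed

definition cc :: "ratfun fps fps \<Rightarrow> bb fps fps"
  where "cc f = Abs_fps (\<lambda>s. Abs_fps (\<lambda>r. sc (f $ s $ r)))"

lemma io_00: "io n 0 0 f = cc f"
  by (rule fps2_ext) (simp add: io_nth cc_def zs_0)

lemma cc_central: "cc f * z = z * cc f"
  by (intro fps_commI) (simp add: cc_def sc_comm)

lemma RTTs_scale:
  assumes "RTTs w m I X Y" shows "RTTs (\<lambda>i k. z * w i k) (\<lambda>i k. z * m i k) I X Y"
proof -
  have "z * a * b + z * c * d = z * (a * b + c * d)" for a b c d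
    by (simp add: distrib_left mult.assoc)
  then show ?thesis using assms by (simp add: RTTs_def)
qed

abbreviation Cw where "Cw M \<alpha> \<beta> i k \<equiv> cc (psw M (\<lambda>i. fps_const (Q1 M i)) (\<lambda>i. fps_const (Q1' M i)) \<alpha> \<beta> i k)"
abbreviation Cm where "Cm \<alpha> \<beta> i k \<equiv> cc (psm (fps_const kap) \<alpha> \<beta> i k)"

text \<open>The \<open>R\<close>-matrix is homogeneous in the spectral parameters, so the loop
  variable factors out of it as one invertible power. What remains is the same central matrix for
  every tensor slot, as \<open>RTTs_coproduct\<close> demands.\<close>

lemma RTTs_Lf':
  assumes "(\<epsilon>, \<delta>, \<alpha>, \<beta>) \<in> spec_params"
  shows "RTTs (Cw M \<alpha> \<beta>) (Cm \<alpha> \<beta>) I (\<lambda>i j. fps_const (Lf M \<epsilon> n i j)) (\<lambda>i j. outer (Lf M \<delta> n i j))"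
proof -
  obtain t where t: "hw \<epsilon> \<delta> t \<alpha>" "hw \<epsilon> \<delta> t \<beta>" using hw_spec[OF assms] .
  have "hw \<epsilon> \<delta> t (psw M (\<lambda>i. fps_const (Q1 M i)) (\<lambda>i. fps_const (Q1' M i)) \<alpha> \<beta> i k)" for i k
    unfolding psw_def Q1_def Q1'_def using t by (auto intro!: hw_ksign hw_diff hw_cst)
  then have 1: "cst (zs n (- t)) * Rw M n \<epsilon> \<delta> \<alpha> \<beta> i k = Cw M \<alpha> \<beta> i k" for i k
    using io_hw io_00 by metis
  have "hw \<epsilon> \<delta> t (psm (fps_const kap) \<alpha> \<beta> i k)" for i k
    unfolding psm_def kap_def using t by (auto intro!: hw_cst hw_0)
  then have 2: "cst (zs n (- t)) * Rm n \<epsilon> \<delta> \<alpha> \<beta> i k = Cm \<alpha> \<beta> i k" for i k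
    using io_hw io_00 by metis
  show ?thesis using RTTs_scale[OF RTTs_Lf[OF assms, where M = M and n = n and I = I], of "cst (zs n (- t))"] unfolding 1 2 .
qed

section \<open>Iterated coproducts of the L-operator\<close>

primrec Tm :: "nat \<Rightarrow> nat \<Rightarrow> int \<Rightarrow> nat \<Rightarrow> nat \<Rightarrow> nat \<Rightarrow> bb fps"
  where "Tm M N \<epsilon> 0 = (\<lambda>i j. if i = j then 1 else 0)"
  | "Tm M N \<epsilon> (Suc n) = (\<lambda>i j. \<Sum>m\<in>idx M N. Tm M N \<epsilon> n i m * Lf M \<epsilon> n m j)"

lemma slot_Tm: "n \<le> m \<Longrightarrow> slot m c \<tau> * Tm M N \<epsilon> n i j $ r = Tm M N \<epsilon> n i j $ r * slot m c \<tau>"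
proof (induction n arbitrary: i j r)
  case (Suc n)
  have L: "slot m c \<tau> * Lf M \<epsilon> n a b $ d = Lf M \<epsilon> n a b $ d * slot m c \<tau>" for a b d
  proof -
    have "slot m c \<tau> * sg M n p = sg M n p * slot m c \<tau>" for p
      unfolding sg_def by (rule slot_comm) (use Suc in simp)
    moreover have "slot m c \<tau> * mE n a b t = mE n a b t * slot m c \<tau>" for a b t
      unfolding mE_def by (rule slot_comm) (use Suc in simp)
    ultimately show ?thesis by (simp add: Lf_def distrib_left distrib_right sc_left mult.assoc)
  qed
  have "slot m c \<tau> * (Tm M N \<epsilon> n i a $ b * Lf M \<epsilon> n a j $ d) = Tm M N \<epsilon> n i a $ b * Lf M \<epsilon> n a j $ d * slot m c \<tau>" for a b d
    unfolding mult.assoc[symmetric] Suc.IH[OF Suc_leD[OF Suc.prems]] unfolding mult.assoc L ..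
  then show ?case by (simp add: fps_sum_nth fps_mult_nth sum_distrib_left sum_distrib_right)
qed simp

lemma Lf_Tm: "Lf M \<epsilon> n a b $ d * Tm M N \<delta> n i j $ r = Tm M N \<delta> n i j $ r * Lf M \<epsilon> n a b $ d"
proof -
  have "sg M n p * Tm M N \<delta> n i j $ r = Tm M N \<delta> n i j $ r * sg M n p" for p
    unfolding sg_def by (rule slot_Tm) simp
  moreover have "mE n a b t * Tm M N \<delta> n i j $ r = Tm M N \<delta> n i j $ r * mE n a b t" for a b t
    unfolding mE_def by (rule slot_Tm) simp
  ultimately show ?thesis by (simp add: Lf_def distrib_left distrib_right sc_left mult.assoc)
qed

lemma RTTs_one: "RTTs w m I (\<lambda>i j. if i = j then 1 else 0) (\<lambda>i j. if i = j then 1 else 0)"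
  by (auto simp: RTTs_def)

theorem RTTs_Tm:
  assumes "(\<epsilon>, \<delta>, \<alpha>, \<beta>) \<in> spec_params"
  shows "RTTs (Cw M \<alpha> \<beta>) (Cm \<alpha> \<beta>) (idx M N) (\<lambda>i j. fps_const (Tm M N \<epsilon> n i j)) (\<lambda>i j. outer (Tm M N \<delta> n i j))"
proof (induction n)
  case 0
  have "fps_const (if i = j then 1 else 0 :: bb fps) = (if i = j then 1 else 0)"
    "outer (if i = j then 1 else 0 :: bb fps) = (if i = j then 1 else 0)" for i j :: nat
    by (simp_all add: outer_hom)
  then show ?case by (simp only: Tm.simps RTTs_one)
next
  case (Suc n)
  have "fps_const (Tm M N \<epsilon> (Suc n) i j) = (\<Sum>m\<in>idx M N. fps_const (Tm M N \<epsilon> n i m) * fps_const (Lf M \<epsilon> n m j))"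
    "outer (Tm M N \<delta> (Suc n) i j) = (\<Sum>m\<in>idx M N. outer (Tm M N \<delta> n i m) * outer (Lf M \<delta> n m j))" for i j
    by (simp_all add: fps_const_sum' outer_sum outer_hom)
  moreover have "RTTs (Cw M \<alpha> \<beta>) (Cm \<alpha> \<beta>) (idx M N)
      (\<lambda>i j. \<Sum>m\<in>idx M N. fps_const (Tm M N \<epsilon> n i m) * fps_const (Lf M \<epsilon> n m j))
      (\<lambda>i j. \<Sum>m\<in>idx M N. outer (Tm M N \<delta> n i m) * outer (Lf M \<delta> n m j))"
    by (rule RTTs_coproduct[OF cc_central cc_central Suc RTTs_Lf'[OF assms]])
      (rule fps2_ext; simp add: const_outer_nth Lf_Tm del: fps_mult_left_const_nth fps_mult_right_const_nth)+
  ultimately show ?case by (simp only:)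
qed

section \<open>Total parity operators on the first \<open>n\<close> factors\<close>

primrec Sig :: "nat \<Rightarrow> nat \<Rightarrow> bit \<Rightarrow> 'k::comm_ring_1 seqop"
  where "Sig M 0 p = 1" | "Sig M (Suc n) p = Sig M n p * sg M n p"

lemma slot_Sig: "n \<le> m \<Longrightarrow> slot m c \<tau> * Sig M n p = Sig M n p * slot m c \<tau>"
proof (induction n)
  case (Suc n)
  have 1: "slot m c \<tau> * sg M n p = sg M n p * slot m c \<tau>"
    unfolding sg_def by (rule slot_comm) (use Suc in simp)
  have 2: "slot m c \<tau> * Sig M n p = Sig M n p * slot m c \<tau>"
    using Suc by simp
  show ?case unfolding Sig.simps mult.assoc[symmetric] 2 unfolding mult.assoc 1 ..
qed simp

lemma sg_Sig: "sg M n q * Sig M n p = Sig M n p * sg M n q"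
  unfolding sg_def by (rule slot_Sig) simp

lemma mE_Sig: "mE n a b t * Sig M n p = Sig M n p * mE n a b t"
  unfolding mE_def by (rule slot_Sig) simp

lemma Sig_Sig: "Sig M n p * Sig M n q = (Sig M n (p + q) :: 'k::comm_ring_1 seqop)"
proof (induction n)
  case (Suc n)
  have "Sig M (Suc n) p * Sig M (Suc n) q = Sig M n p * (sg M n p * Sig M n q) * (sg M n q :: 'k seqop)"
    by (simp add: mult.assoc)
  also have "\<dots> = (Sig M n p * Sig M n q) * (sg M n p * sg M n q)"
    by (simp only: sg_Sig mult.assoc)
  finally show ?case by (simp only: Suc sg_sg Sig.simps)
qed simp

lemma ksign_left: "A * (ksign p * B) = ksign p * (A * B :: 'b::ring_1)"
  by (cases p) simp_all

lemma sg_Lf: "sg M n p * Lf M \<epsilon> n i j $ r = ksign (p * (ipar M i + ipar M j)) * (Lf M \<epsilon> n i j $ r * sg M n p)"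
proof -
  have "sg M n p * mE n j i t = ksign (p * (ipar M i + ipar M j)) * (mE n j i t * sg M n p)" for t
    by (cases p; cases "ipar M i"; cases "ipar M j") (simp_all add: sg_mE mE_sg)
  note e = this
  let ?A = "if i = j \<and> r = 0 then sg M n (ipar M i) else 0 :: bb" and ?k = "ksign (p * (ipar M i + ipar M j)) :: bb"
  have "sg M n p * sg M n (ipar M i) = sg M n (ipar M i) * sg M n p"
    unfolding sg_sg by (simp only: add.commute)
  then have A: "sg M n p * ?A = ?k * (?A * sg M n p)"
    by (cases "i = j \<and> r = 0") (auto simp only: if_True if_False mult_zero_left mult_zero_right, simp)
  show ?thesis
    unfolding Lf_def fps_nth_Abs_fps distrib_left[of "sg M n p"] A sc_left[of "sg M n p"] e ksign_left[of "sc _"]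
    unfolding distrib_right distrib_left mult.assoc ..
qed

lemma Sig_Lf: "Sig M n p * Lf M \<epsilon> n i j $ r = Lf M \<epsilon> n i j $ r * Sig M n p"
proof -
  have "Sig M n p * (sc c * mE n j i t) = sc c * mE n j i t * (Sig M n p :: bb)" for c t
    by (simp add: sc_left mE_Sig mult.assoc)
  then show ?thesis by (simp add: Lf_def distrib_left distrib_right sg_Sig)
qed

lemma Sig_Tm: "Sig M n p * Tm M N \<epsilon> n i j $ r = ksign (p * (ipar M i + ipar M j)) * (Tm M N \<epsilon> n i j $ r * Sig M n p)"
proof (induction n arbitrary: i j r)
  case 0
  show ?case by (cases "i = j"; cases "ipar M j"; cases p; simp)
next
  case (Suc n)
  have sT: "sg M n p * Tm M N \<epsilon> n i a $ b = Tm M N \<epsilon> n i a $ b * sg M n p" for a b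
    unfolding sg_def by (rule slot_Tm) simp
  have "Sig M (Suc n) p * (Tm M N \<epsilon> n i a $ b * Lf M \<epsilon> n a j $ d)
      = ksign (p * (ipar M i + ipar M j)) * (Tm M N \<epsilon> n i a $ b * Lf M \<epsilon> n a j $ d * Sig M (Suc n) p)" for a b d
  proof -
    let ?T = "Tm M N \<epsilon> n i a $ b" and ?L = "Lf M \<epsilon> n a j $ d"
    have "Sig M (Suc n) p * (?T * ?L) = (Sig M n p * ?T) * (sg M n p * ?L)"
      unfolding Sig.simps mult.assoc unfolding mult.assoc[of "sg M n p" ?T ?L, symmetric] sT mult.assoc ..
    also have "\<dots> = ksign (p * (ipar M i + ipar M a)) * (?T * (Sig M n p * (ksign (p * (ipar M a + ipar M j)) * (?L * sg M n p))))"
      unfolding Suc.IH sg_Lf mult.assoc ..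
    also have "\<dots> = (ksign (p * (ipar M i + ipar M a)) * ksign (p * (ipar M a + ipar M j))) * (?T * (Sig M n p * ?L * sg M n p))"
      by (simp only: ksign_left[of ?T] ksign_left[of "Sig M n p"] mult.assoc)
    also have "ksign (p * (ipar M i + ipar M a)) * ksign (p * (ipar M a + ipar M j)) = (ksign (p * (ipar M i + ipar M j)) :: bb)"
      by (cases p; cases "ipar M i"; cases "ipar M a"; cases "ipar M j"; simp)
    finally show ?thesis by (simp only: Sig_Lf Sig.simps mult.assoc)
  qed
  then have "Sig M (Suc n) p * Tm M N \<epsilon> (Suc n) i j $ r
    = (\<Sum>a\<in>idx M N. \<Sum>b=0..r. ksign (p * (ipar M i + ipar M j)) * (Tm M N \<epsilon> n i a $ b * Lf M \<epsilon> n a j $ (r - b) * Sig M (Suc n) p))"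
    by (simp only: Tm.simps fps_sum_nth fps_mult_nth sum_distrib_left)
  then show ?case
    by (simp only: Tm.simps fps_sum_nth fps_mult_nth sum_distrib_left sum_distrib_right)
qed

subsection \<open>The RTT relations\<close>

definition gx :: "bb fps \<Rightarrow> int \<Rightarrow> bb" where "gx A x = (if x < 0 then 0 else A $ nat x)"

definition ext :: "bb fps fps \<Rightarrow> int \<Rightarrow> int \<Rightarrow> bb"
  where "ext P x y = (if x < 0 \<or> y < 0 then 0 else P $ nat y $ nat x)"

lemma ext_lin: "ext (P + P') x y = ext P x y + ext P' x y" "ext (P - P') x y = ext P x y - ext P' x y"
  "ext (cst c * P) x y = c * ext P x y" "ext (ksign p * P) x y = ksign p * ext P x y" "ext 0 x y = 0"
  by (cases p; simp add: ext_def)+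

lemma ext_prod: "ext (fps_const A * outer B) x y = gx A x * gx B y" "ext (outer B * fps_const A) x y = gx B y * gx A x"
  by (auto simp: ext_def gx_def const_outer_nth simp del: fps_mult_left_const_nth fps_mult_right_const_nth)

lemma ext_X: "ext (fps_const fps_X * P) x y = ext P (x - 1) y" "ext (fps_X * P) x y = ext P x (y - 1)"
  by (auto simp: ext_def nat_diff_distrib)

lemma cc_hom: "cc (f + g) = cc f + cc g" "cc (f * g) = cc f * cc g" "cc 1 = 1" "cc (- f) = - cc f"
  "cc (f - g) = cc f - cc g" "cc (ksign p) = ksign p"
proof -
  have 1: "cc (f + g) = cc f + cc g" "cc (f * g) = cc f * cc g" "cc 1 = 1" "cc (- f) = - cc f" "cc (ksign p) = ksign p"
    for f g :: "ratfun fps fps"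
    unfolding io_00[of 0, symmetric] by (rule io_add io_mult io_one io_uminus io_ksign)+
  show "cc (f + g) = cc f + cc g" "cc (f * g) = cc f * cc g" "cc 1 = 1" "cc (- f) = - cc f" "cc (ksign p) = ksign p"
    by (rule 1)+
  show "cc (f - g) = cc f - cc g" using 1(1)[of f "- g"] 1(4)[of g] by simp
qed

lemma cc_cst: "cc (cst c) = cst (sc c)"
  by (rule fps2_ext) (simp add: cc_def sc_0)

lemma cc_X: "cc fps_X = fps_X" "cc (fps_const fps_X) = fps_const fps_X"
  by (rule fps2_ext; simp add: cc_def fps_X_def sc_0 sc_one)+

lemma ext_spec:
  assumes "(\<epsilon>, \<delta>, \<alpha>, \<beta>) \<in> spec_params"
  obtains x y where "\<And>P. ext (cc \<alpha> * P) x y = ext P (- \<epsilon> * (a - 1)) (- \<delta> * b)"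
    "\<And>P. ext (cc \<beta> * P) x y = ext P (- \<epsilon> * a) (- \<delta> * (b - 1))"
proof -
  \<comment> \<open>For a series in an inverse variable the relation was multiplied by that inverse,
    so the coefficient sits at \<open>1 - a\<close> instead of \<open>- a\<close>.\<close>
  have "\<exists>x y. (\<forall>P. ext (cc \<alpha> * P) x y = ext P (- \<epsilon> * (a - 1)) (- \<delta> * b))
    \<and> (\<forall>P. ext (cc \<beta> * P) x y = ext P (- \<epsilon> * a) (- \<delta> * (b - 1)))"
    by (rule exI[of _ "if \<epsilon> = - 1 then a else 1 - a"], rule exI[of _ "if \<delta> = - 1 then b else 1 - b"])
      (use assms in \<open>auto simp: spec_params_def cc_X cc_hom ext_X mult.assoc\<close>)
  then show ?thesis using that by blast
qed

lemma ext_psw: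
  assumes "\<And>P. ext (cc \<alpha> * P) x y = ext P x1 y1" "\<And>P. ext (cc \<beta> * P) x y = ext P x2 y2"
  shows "ext (Cw M \<alpha> \<beta> i k * P) x y = ksign (ipar M i * ipar M k) *
      (sc (if i = k then qi M i else 1) * ext P x1 y1 - sc (if i = k then inverse (qi M i) else 1) * ext P x2 y2)"
    "ext (Cm \<alpha> \<beta> i k * P) x y = (if i = k then 0 else sc (qvar - inverse qvar) * (if k < i then ext P x1 y1 else ext P x2 y2))"
proof -
  have c: "cc \<alpha> * cst (sc c) = cst (sc c) * cc \<alpha>" for \<alpha> c by (rule cc_central)
  show "ext (Cw M \<alpha> \<beta> i k * P) x y = ksign (ipar M i * ipar M k) *
      (sc (if i = k then qi M i else 1) * ext P x1 y1 - sc (if i = k then inverse (qi M i) else 1) * ext P x2 y2)"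
    by (cases "i = k")
      (simp_all add: psw_def Q1_def Q1'_def cc_hom cc_cst c ext_lin assms mult.assoc left_diff_distrib sc_one)
  show "ext (Cm \<alpha> \<beta> i k * P) x y = (if i = k then 0 else sc (qvar - inverse qvar) * (if k < i then ext P x1 y1 else ext P x2 y2))"
    using cc_hom(5)[of 0 0] by (simp add: psm_def kap_def cc_hom cc_cst ext_lin assms mult.assoc)
qed

text \<open>The parity operator is raised to the parity of the row index \<open>i\<close> only;
  moving it past another entry produces the sign rule of the superalgebra.\<close>

definition TT :: "nat \<Rightarrow> nat \<Rightarrow> int \<Rightarrow> nat \<Rightarrow> nat \<Rightarrow> nat \<Rightarrow> int \<Rightarrow> bb"
  where "TT M N \<epsilon> n i j a = gx (Tm M N \<epsilon> n i j) (- \<epsilon> * a) * Sig M n (ipar M i)"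

text \<open>Every product of two entries ends in the same operator \<open>Sig\<close> for
  \<open>|i| + |k|\<close>. Once it is pulled out to the right, the super relation is the sign-free
  one up to a common sign.\<close>

lemma RTT_TT:
  assumes s: "(\<epsilon>, \<delta>, \<alpha>, \<beta>) \<in> spec_params"
    and idx: "i \<in> idx M N" "j \<in> idx M N" "k \<in> idx M N" "l \<in> idx M N"
  shows "RTT M sc (TT M N \<epsilon> n) (TT M N \<delta> n) i j k l a b = 0"
proof -
  obtain x y where xy: "\<And>P. ext (cc \<alpha> * P) x y = ext P (- \<epsilon> * (a - 1)) (- \<delta> * b)"
    "\<And>P. ext (cc \<beta> * P) x y = ext P (- \<epsilon> * a) (- \<delta> * (b - 1))"
    using ext_spec[OF s, of a b] by blast
  let ?X = "\<lambda>i j a. gx (Tm M N \<epsilon> n i j) (- \<epsilon> * a)" and ?Y = "\<lambda>i j a. gx (Tm M N \<delta> n i j) (- \<delta> * a)"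
  let ?S = "Sig M n (ipar M i + ipar M k) :: bb"
  let ?p = "\<lambda>i. ipar M i"
  let ?k = "sc (qvar - inverse qvar) :: bb"
  have "ext (Cw M \<alpha> \<beta> i k * (fps_const (Tm M N \<epsilon> n i j) * outer (Tm M N \<delta> n k l))
      + Cm \<alpha> \<beta> i k * (fps_const (Tm M N \<epsilon> n k j) * outer (Tm M N \<delta> n i l))) x y
    = ext (Cw M \<alpha> \<beta> j l * (outer (Tm M N \<delta> n k l) * fps_const (Tm M N \<epsilon> n i j))
      + Cm \<alpha> \<beta> l j * (outer (Tm M N \<delta> n k j) * fps_const (Tm M N \<epsilon> n i l))) x y"
    using RTTs_Tm[OF s, of M N n] idx unfolding RTTs_def by metis
  then have rel: "ksign (?p i * ?p k) * (sc (if i = k then qi M i else 1) * (?X i j (a - 1) * ?Y k l b)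
        - sc (if i = k then inverse (qi M i) else 1) * (?X i j a * ?Y k l (b - 1)))
      + (if i = k then 0 else ?k * (if k < i then ?X k j (a - 1) * ?Y i l b else ?X k j a * ?Y i l (b - 1)))
    = ksign (?p j * ?p l) * (sc (if j = l then qi M j else 1) * (?Y k l b * ?X i j (a - 1))
        - sc (if j = l then inverse (qi M j) else 1) * (?Y k l (b - 1) * ?X i j a))
      + (if l = j then 0 else ?k * (if j < l then ?Y k j b * ?X i l (a - 1) else ?Y k j (b - 1) * ?X i l a))"
    unfolding ext_lin(1) ext_psw[OF xy] ext_prod .
  have prod: "TT M N \<epsilon>' n i' j' a' * TT M N \<delta>' n k' l' b'
      = ksign (?p i' * (?p k' + ?p l')) * (gx (Tm M N \<epsilon>' n i' j') (- \<epsilon>' * a') * gx (Tm M N \<delta>' n k' l') (- \<delta>' * b')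
        * Sig M n (?p i' + ?p k'))" for \<epsilon>' \<delta>' i' j' k' l' a' b'
  proof -
    have "Sig M n p * gx (Tm M N \<delta>' n k' l') t = ksign (p * (?p k' + ?p l')) * (gx (Tm M N \<delta>' n k' l') t * Sig M n p)" for p t
      by (simp add: gx_def Sig_Tm)
    then have "gx (Tm M N \<epsilon>' n i' j') (- \<epsilon>' * a') * (Sig M n (?p i') * gx (Tm M N \<delta>' n k' l') (- \<delta>' * b')) * Sig M n (?p k')
      = gx (Tm M N \<epsilon>' n i' j') (- \<epsilon>' * a') * (ksign (?p i' * (?p k' + ?p l')) * (gx (Tm M N \<delta>' n k' l') (- \<delta>' * b') * Sig M n (?p i'))) * Sig M n (?p k')"
      by (simp only:)
    then show ?thesis unfolding TT_def by (simp only: ksign_left mult.assoc Sig_Sig)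
  qed
  have S: "Sig M n (?p k + ?p i) = ?S" by (simp only: add.commute)
  have q: "sc (qc M c) = ksign (?p c) * ?k" for c
    by (cases "?p c") (simp_all add: qc_def qi_def sc_uminus flip: sc_uminus)
  have "RTT M sc (TT M N \<epsilon> n) (TT M N \<delta> n) i j k l a b
    = ksign (?p j * ?p k + ?p j * ?p l + ?p i * ?p k) * ((ksign (?p i * ?p k) * (sc (if i = k then qi M i else 1) * (?X i j (a - 1) * ?Y k l b)
        - sc (if i = k then inverse (qi M i) else 1) * (?X i j a * ?Y k l (b - 1)))
      + (if i = k then 0 else ?k * (if k < i then ?X k j (a - 1) * ?Y i l b else ?X k j a * ?Y i l (b - 1)))
    - (ksign (?p j * ?p l) * (sc (if j = l then qi M j else 1) * (?Y k l b * ?X i j (a - 1))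
        - sc (if j = l then inverse (qi M j) else 1) * (?Y k l (b - 1) * ?X i j a))
      + (if l = j then 0 else ?k * (if j < l then ?Y k j b * ?X i l (a - 1) else ?Y k j (b - 1) * ?X i l a)))) * ?S)"
  proof -
    \<comment> \<open>The sign comparison as an identity in free variables; the sixteen parity
      patterns are checked separately.\<close>
    have sgn: "ksign ((u + v) * (w + z)) * (A * (ksign (u * (w + z)) * (X1 * S)) - B * (ksign (u * (w + z)) * (X2 * S)))
      + (if c then 0 else ksign ((w + v) * (w + z)) * ((ksign w * K) * (if d then ksign (w * (u + z)) * (X3 * S) else ksign (w * (u + z)) * (X4 * S))))
      - (A' * (ksign (w * (u + v)) * (X5 * S)) - B' * (ksign (w * (u + v)) * (X6 * S)))
      - (if e then 0 else ksign ((z + v) * (w + v)) * ((ksign v * K) * (if g then ksign (w * (u + z)) * (X7 * S) else ksign (w * (u + z)) * (X8 * S))))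
      = ksign (v * w + v * z + u * w) * ((ksign (u * w) * (A * X1 - B * X2) + (if c then 0 else K * (if d then X3 else X4))
        - (ksign (v * z) * (A' * X5 - B' * X6) + (if e then 0 else K * (if g then X7 else X8)))) * S)"
      for u v w z :: bit and A B A' B' K S X1 X2 X3 X4 X5 X6 X7 X8 :: bb and c d e g
      by (cases u; cases v; cases w; cases z; simp add: algebra_simps)
    have le: "(j = l) = (l = j)" by auto
    show ?thesis
      unfolding RTT_def prod q S sgn[symmetric] unfolding le ..
  qed
  then show ?thesis unfolding rel by simp
qed

section \<open>Constant terms and the representation of the quantum loop algebra\<close>

lemma psx_0:
  "j < i \<Longrightarrow> psx M (Q1 M) kap (pser (- 1)) i j $ 0 = 0"
  "i < j \<Longrightarrow> psx M (Q1 M) kap (pser 1) i j $ 0 = 0"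
  by (simp_all add: psx_def kap_def pser_def)

lemma Lf_0: "j < i \<Longrightarrow> Lf M (- 1) n i j $ 0 = 0" "i < j \<Longrightarrow> Lf M 1 n i j $ 0 = 0"
  by (simp_all add: Lf_def psx_0 sc_0)

lemma Tm_0: "j < i \<Longrightarrow> Tm M N (- 1) n i j $ 0 = 0" "i < j \<Longrightarrow> Tm M N 1 n i j $ 0 = 0"
proof (induction n arbitrary: i j)
  case (Suc n)
  {
    case 1
    have "Tm M N (- 1) n i m $ 0 * Lf M (- 1) n m j $ 0 = 0" for m
    proof (cases "m < i")
      case True
      then show ?thesis by (simp add: Suc.IH)
    next
      case False
      then show ?thesis using 1 by (simp add: Lf_0)
    qed
    then show ?case by (simp add: fps_sum_nth)
  next
    case 2
    have "Tm M N 1 n i m $ 0 * Lf M 1 n m j $ 0 = 0" for m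
    proof (cases "i < m")
      case True
      then show ?thesis by (simp add: Suc.IH)
    next
      case False
      then show ?thesis using 2 by (simp add: Lf_0)
    qed
    then show ?case by (simp add: fps_sum_nth)
  }
qed simp_all

text \<open>A product of matrices that are triangular on the same side has the product of the
  diagonal entries on its diagonal.\<close>

lemma Tm_diag:
  assumes i: "i \<in> idx M N" and e: "\<epsilon> = - 1 \<or> \<epsilon> = 1"
  shows "Tm M N \<epsilon> (Suc n) i i $ 0 = Tm M N \<epsilon> n i i $ 0 * Lf M \<epsilon> n i i $ 0"
proof -
  have 0: "Tm M N \<epsilon> n i m $ 0 * Lf M \<epsilon> n m i $ 0 = 0" if "m \<noteq> i" for m
  proof -
    have "m < i \<or> i < m" using that by linarith
    then show ?thesis using e Tm_0[of m i M N n] Tm_0[of i m M N n] Lf_0[of i m M n] Lf_0[of m i M n] by auto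
  qed
  have "Tm M N \<epsilon> (Suc n) i i $ 0 = (\<Sum>m\<in>idx M N. Tm M N \<epsilon> n i m $ 0 * Lf M \<epsilon> n m i $ 0)"
    by (simp add: fps_sum_nth)
  also have "\<dots> = (\<Sum>m\<in>{i}. Tm M N \<epsilon> n i m $ 0 * Lf M \<epsilon> n m i $ 0)"
    by (rule sum.mono_neutral_right) (use i 0 in \<open>auto simp: idx_def\<close>)
  finally show ?thesis by simp
qed

lemma Lf_inverse: "Lf M (- 1) n i i $ 0 * Lf M 1 n i i $ 0 = 1" "Lf M 1 n i i $ 0 * Lf M (- 1) n i i $ 0 = 1"
proof -
  let ?s = "sg M n (ipar M i) :: bb" and ?e = "mE n i i 0 :: bb"
  let ?k = "ksign (ipar M i) :: ratfun"
  \<comment> \<open>At the letter \<open>i\<close> the diagonal entries act by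
    \<open>(-1)\<^sup>|\<^sup>i\<^sup>|\<close> times \<open>1/q\<^sub>i\<close> and
    \<open>q\<^sub>i\<close>; \<open>c\<close> and \<open>c'\<close> are the deviations from the
    bare sign, which \<open>sg\<close> already contributes.\<close>
  define c where "c = ?k * inverse (qi M i) - ?k"
  define c' where "c' = ?k * qi M i - ?k"
  have q: "qi M i \<noteq> 0" using qvar_nz by (simp add: qi_def)
  have kq: "qvar - inverse qvar = ?k * (qi M i - inverse (qi M i))"
    by (cases "ipar M i") (simp_all add: qi_def)
  have kk: "?k * ?k = 1" "?k * (?k * z) = z" for z by (cases "ipar M i"; simp)+
  have "psx M (Q1 M) kap (pser (- 1)) i i $ 0 = - (qvar - inverse qvar) + ?k * (qi M i - 1)"
    by (cases "ipar M i") (simp_all add: psx_def kap_def pser_def Q1_def)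
  also have "\<dots> = c" unfolding kq c_def by (simp add: algebra_simps)
  finally have p1: "psx M (Q1 M) kap (pser (- 1)) i i $ 0 = c" .
  have "psx M (Q1 M) kap (pser 1) i i $ 0 = ?k * (qi M i - 1)"
    by (cases "ipar M i") (simp_all add: psx_def kap_def pser_def Q1_def)
  also have "\<dots> = c'" unfolding c'_def by (simp add: algebra_simps)
  finally have p2: "psx M (Q1 M) kap (pser 1) i i $ 0 = c'" .
  have L: "Lf M (- 1) n i i $ 0 = ?s + sc c * ?e" "Lf M 1 n i i $ 0 = ?s + sc c' * ?e"
    by (simp_all add: Lf_def p1 p2)
  have kc: "ksign p * x = sc (ksign p) * x" for p and x :: bb
    by (cases p) (simp_all add: sc_one sc_uminus)
  have se: "?s * ?e = sc ?k * ?e" "?e * ?s = sc ?k * ?e"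
    unfolding sg_mE mE_sg kc by simp_all
  have ee: "?e * ?e = ?e" by (simp add: mE_mult)
  have ss: "?s * ?s = 1" unfolding sg_sg by (simp add: sg_0)
  have *: "(?s + sc a * ?e) * (?s + sc b * ?e) = 1" if "?k * a + ?k * b + a * b = 0" for a b
  proof -
    have "(?s + sc a * ?e) * (?s + sc b * ?e) = ?s * ?s + ?s * (sc b * ?e) + sc a * (?e * ?s) + sc a * (?e * (sc b * ?e))"
      by (simp only: distrib_left distrib_right mult.assoc add_ac)
    also have "\<dots> = 1 + sc (b * ?k) * ?e + sc (a * ?k) * ?e + sc (a * b) * ?e"
      unfolding sc_left[of ?s] sc_left[of ?e] se ee ss sc_mult by (simp only: mult.assoc)
    also have "\<dots> = 1 + sc (?k * a + ?k * b + a * b) * ?e"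
      by (simp only: sc_add distrib_right add_ac mult.commute[of _ ?k])
    finally show ?thesis by (simp add: that sc_0)
  qed
  have z: "?k * c + ?k * c' + c * c' = 0" "?k * c' + ?k * c + c' * c = 0"
    unfolding c_def c'_def using q by (cases "ipar M i"; simp add: field_simps)+
  show "Lf M (- 1) n i i $ 0 * Lf M 1 n i i $ 0 = 1" "Lf M 1 n i i $ 0 * Lf M (- 1) n i i $ 0 = 1"
    unfolding L by (rule *[OF z(1)], rule *[OF z(2)])
qed

lemma Tm_inverse:
  assumes i: "i \<in> idx M N"
  shows "Tm M N (- 1) n i i $ 0 * Tm M N 1 n i i $ 0 = 1" "Tm M N 1 n i i $ 0 * Tm M N (- 1) n i i $ 0 = 1"
proof (induction n)
  case (Suc n)
  have comb: "A * L * (A' * L') = 1" if "A * A' = 1" "L * L' = 1" "L * A' = A' * L" for A L A' L' :: bb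
  proof -
    have "A * L * (A' * L') = A * (L * A') * L'" by (simp only: mult.assoc)
    also have "\<dots> = (A * A') * (L * L')" unfolding that(3) by (simp only: mult.assoc)
    finally show ?thesis using that by simp
  qed
  {
    case 1
    show ?case unfolding Tm_diag[OF i disjI1[OF refl]] Tm_diag[OF i disjI2[OF refl]]
      by (rule comb[OF Suc(1) Lf_inverse(1) Lf_Tm])
  next
    case 2
    show ?case unfolding Tm_diag[OF i disjI1[OF refl]] Tm_diag[OF i disjI2[OF refl]]
      by (rule comb[OF Suc(2) Lf_inverse(2) Lf_Tm])
  }
qed simp_all

fun phi :: "nat \<Rightarrow> nat \<Rightarrow> nat \<Rightarrow> qloop_gen \<Rightarrow> bb"
  where "phi M N n (QT i j r) = Tm M N (- 1) n i j $ r * Sig M n (ipar M i)"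
  | "phi M N n (QTt i j r) = Tm M N 1 n i j $ r * Sig M n (ipar M i)"

interpretation sc: central_scalars "sc :: ratfun \<Rightarrow> bb"
  by (rule central_scalars_sc)

lemma feval_RTT:
  fixes \<phi> :: "'g \<Rightarrow> bb"
  shows "feval sc \<phi> (RTT M fscalar X Y i j k l a b)
    = RTT M sc (\<lambda>i j a. feval sc \<phi> (X i j a)) (\<lambda>i j a. feval sc \<phi> (Y i j a)) i j k l a (b :: int)"
proof -
  have k: "feval sc \<phi> (ksign p) = ksign p" for p
    by (cases p) (simp_all add: sc.feval_uminus sc.feval_one)
  have i: "feval sc \<phi> (if c then z else w) = (if c then feval sc \<phi> z else feval sc \<phi> w)" for c z w
    by simp
  show ?thesis
    unfolding RTT_def by (simp only: sc.feval_add sc.feval_diff sc.feval_mult sc.feval_fscalar sc.feval_zero k i)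
qed

lemma feval_series:
  "feval sc (phi M N n) (T_series i j a) = TT M N (- 1) n i j a"
  "feval sc (phi M N n) (Tt_series i j a) = TT M N 1 n i j a"
  by (auto simp: T_series_def Tt_series_def TT_def gx_def sc.feval_fgen)

lemma phi_J:
  assumes "x \<in> rel_ideal (qloop_gens M N) (qloop_par M) (qloop_rels M N)"
  shows "feval sc (phi M N n) x = 0"
proof (rule presentation.J_kernel[OF presentation.intro[OF qloop_rels_carrier] central_scalars_sc _ assms])
  fix x assume "x \<in> qloop_rels M N"
  then consider i j where "x = fgen (QT j i 0)" "i \<in> idx M N" "j \<in> idx M N" "i < j"
    | i j where "x = fgen (QTt i j 0)" "i \<in> idx M N" "j \<in> idx M N" "i < j"
    | i where "x = fgen (QT i i 0) * fgen (QTt i i 0) - 1" "i \<in> idx M N"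
    | i where "x = fgen (QTt i i 0) * fgen (QT i i 0) - 1" "i \<in> idx M N"
    | X Y i j k l a b where "x = RTT M fscalar X Y i j k l a b"
      "(X, Y) \<in> {(T_series, T_series), (Tt_series, Tt_series), (Tt_series, T_series)}"
      "i \<in> idx M N" "j \<in> idx M N" "k \<in> idx M N" "l \<in> idx M N"
    unfolding qloop_rels_eq by blast
  note cases = this
  have cancel: "A * S * (B * S) = A * B" if "S * B = B * S" "S * S = 1" for A B S :: bb
  proof -
    have "A * S * (B * S) = A * (S * B) * S" by (simp only: mult.assoc)
    also have "\<dots> = A * B * (S * S)" unfolding that(1) by (simp only: mult.assoc)
    finally show ?thesis unfolding that(2) by simp
  qed
  have comm: "Sig M n p * Tm M N \<epsilon> n i i $ 0 = Tm M N \<epsilon> n i i $ 0 * Sig M n p" for p \<epsilon> i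
    unfolding Sig_Tm by (cases p; cases "ipar M i"; simp)
  have SS: "Sig M n p * Sig M n p = (1 :: bb)" for p
  proof -
    have "Sig M n 0 = (1 :: bb)" by (induction n) (simp_all add: sg_0)
    then show ?thesis unfolding Sig_Sig by simp
  qed
  from cases show "feval sc (phi M N n) x = 0"
  proof cases
    case 1
    then show ?thesis by (simp add: sc.feval_fgen Tm_0)
  next
    case 2
    then show ?thesis by (simp add: sc.feval_fgen Tm_0)
  next
    case 3
    show ?thesis
      unfolding 3(1) sc.feval_diff sc.feval_mult sc.feval_fgen sc.feval_one phi.simps
        cancel[OF comm SS] Tm_inverse(1)[OF 3(2)] by simp
  next
    case 4
    show ?thesis
      unfolding 4(1) sc.feval_diff sc.feval_mult sc.feval_fgen sc.feval_one phi.simps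
        cancel[OF comm SS] Tm_inverse(2)[OF 4(2)] by simp
  next
    case 5
    then consider (a) "X = T_series" "Y = T_series" | (b) "X = Tt_series" "Y = Tt_series"
      | (d) "X = Tt_series" "Y = T_series" by auto
    then show ?thesis
    proof cases
      case a
      show ?thesis unfolding 5(1) feval_RTT a feval_series
        by (rule RTT_TT[where \<alpha> = "fps_const fps_X" and \<beta> = fps_X, OF _ 5(3-6)]) (simp add: spec_params_def)
    next
      case b
      show ?thesis unfolding 5(1) feval_RTT b feval_series
        by (rule RTT_TT[where \<alpha> = fps_X and \<beta> = "fps_const fps_X", OF _ 5(3-6)]) (simp add: spec_params_def)
    next
      case d
      show ?thesis unfolding 5(1) feval_RTT d feval_series
        by (rule RTT_TT[where \<alpha> = 1 and \<beta> = "fps_const fps_X * fps_X", OF _ 5(3-6)]) (simp add: spec_params_def)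
    qed
  qed
qed

section \<open>Specialization at \<open>q = 1\<close>\<close>

text \<open>\<open>p\<close> is the value of \<open>P\<close> at \<open>q = 1\<close>. This is a
  relation since an operator that does not preserve the \<open>A\<close>-valued functions has no
  such value.\<close>

definition red :: "bb \<Rightarrow> complex seqop \<Rightarrow> bool"
  where "red P p \<longleftrightarrow> (\<forall>f. (\<forall>s. f s \<in> A_loc) \<longrightarrow>
    (\<forall>s. app P f s \<in> A_loc \<and> evq (app P f s) = app p (\<lambda>s. evq (f s)) s))"

lemma red_add: "red P p \<Longrightarrow> red P' p' \<Longrightarrow> red (P + P') (p + p')"
  by (simp add: red_def app_simps evq_add)

lemma red_uminus: "red P p \<Longrightarrow> red (- P) (- p)"
  by (simp add: red_def app_simps evq_uminus)

lemma red_mult: "red P p \<Longrightarrow> red P' p' \<Longrightarrow> red (P * P') (p * p')"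
proof -
  assume r: "red P p" "red P' p'"
  have "app (P * P') f s \<in> A_loc \<and> evq (app (P * P') f s) = app (p * p') (\<lambda>s. evq (f s)) s" if "\<forall>s. f s \<in> A_loc" for f s
  proof -
    have 1: "\<forall>s. app P' f s \<in> A_loc" "(\<lambda>s. evq (app P' f s)) = app p' (\<lambda>s. evq (f s))"
      using r(2) that unfolding red_def by (blast, intro ext) (use r(2) that red_def in blast)
    show ?thesis unfolding app_simps 1(2)[symmetric] using r(1) 1(1) unfolding red_def by blast
  qed
  then show ?thesis unfolding red_def by blast
qed

lemma red_zero: "red 0 0"
  by (simp add: red_def app_simps evq_basic)

lemma red_one: "red 1 1"
  by (simp add: red_def app_simps)

lemma red_ksign: "red P p \<Longrightarrow> red (ksign t * P) (ksign t * p)"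
  by (cases t) (simp_all add: red_uminus)

lemma red_sc: "c \<in> A_loc \<Longrightarrow> red P p \<Longrightarrow> red (sc c * P) (sc (evq c) * p)"
  by (simp add: red_def app_simps evq_mult)

lemma red_sum: "(\<And>i. i \<in> I \<Longrightarrow> red (P i) (p i)) \<Longrightarrow> red (\<Sum>i\<in>I. P i) (\<Sum>i\<in>I. p i)"
  by (induction I rule: infinite_finite_induct) (simp_all add: red_zero red_add)

lemma red_mE: "red (mE n a b t) (mE n a b t)"
  by (simp add: red_def app_mE evq_basic)

lemma red_sg: "red (sg M n p) (sg M n p)"
  by (simp add: red_def app_sg evq_mult evq_ksign)

lemma red_Sig: "red (Sig M n p) (Sig M n p)"
  by (induction n) (simp_all add: red_one red_mult red_sg)

section \<open>First-order terms of the quantum action\<close>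

definition hlim :: "int \<Rightarrow> nat \<Rightarrow> nat \<Rightarrow> nat \<Rightarrow> int"
  where "hlim \<epsilon> i j r = - \<epsilon> * (if i = j \<and> r = 0 then 1
    else if r > 0 \<or> (if \<epsilon> = - 1 then i < j else j < i) then 2 else 0)"

text \<open>Every coefficient contains a factor \<open>q - 1/q\<close>, \<open>q\<^sub>i - 1\<close>
  or \<open>1/q\<^sub>i - 1\<close>, hence a factor \<open>q - 1\<close>. \<open>hlim\<close> unites
  \<open>hT\<close> and \<open>hTt\<close>, indexed by the absolute value of the exponent.\<close>

lemma psx_lim:
  assumes "\<epsilon> = - 1 \<or> \<epsilon> = 1"
  obtains c where "c \<in> A_loc" "psx M (Q1 M) kap (pser \<epsilon>) i j $ r = eps * c" "evq c = of_int (- hlim \<epsilon> i j r)"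
proof -
  have k: "qvar - inverse qvar = eps * eta" by (rule q_minus)
  have "\<exists>c\<in>A_loc. psx M (Q1 M) kap (pser \<epsilon>) i j $ r = eps * c \<and> evq c = of_int (- hlim \<epsilon> i j r)"
  proof (cases "i = j \<and> r = 0")
    case True
    let ?k = "ksign (ipar M i) :: ratfun"
    have kk: "ksign (ipar M i) * ksign (ipar M i) = (1 :: complex)" by (cases "ipar M i"; simp)
    have kq: "qvar - inverse qvar = ?k * (qi M i - inverse (qi M i))"
      by (cases "ipar M i") (simp_all add: qi_def)
    show ?thesis
    proof (cases "\<epsilon> = 1")
      case e: True
      have "psx M (Q1 M) kap (pser \<epsilon>) i j $ 0 = ?k * (qi M i - 1)"
        using True e by (cases "ipar M i") (simp_all add: psx_def kap_def pser_def Q1_def)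
      then have "psx M (Q1 M) kap (pser \<epsilon>) i j $ r = eps * (?k * qx M i)"
        using True by (simp add: qi_split(1))
      moreover have "?k * qx M i \<in> A_loc" "evq (?k * qx M i) = 1"
        using evq_mult[OF evq_ksign(1) evq_qxy(1), of "ipar M i" M i] by (simp_all add: evq_ksign evq_qxy kk)
      ultimately show ?thesis using True e by (intro bexI[of _ "?k * qx M i"]) (simp_all add: hlim_def)
    next
      case e: False
      have "psx M (Q1 M) kap (pser \<epsilon>) i j $ 0 = - (qvar - inverse qvar) + ?k * (qi M i - 1)"
        using True e assms by (cases "ipar M i") (simp_all add: psx_def kap_def pser_def Q1_def)
      also have "\<dots> = ?k * (inverse (qi M i) - 1)"
        unfolding kq by (simp add: algebra_simps)
      finally have "psx M (Q1 M) kap (pser \<epsilon>) i j $ r = eps * (?k * qy M i)"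
        using True by (simp add: qi_split(2))
      moreover have "?k * qy M i \<in> A_loc" "evq (?k * qy M i) = - 1"
        using evq_mult[OF evq_ksign(1) evq_qxy(3), of "ipar M i" M i] by (simp_all add: evq_ksign evq_qxy kk)
      ultimately show ?thesis using True e assms by (intro bexI[of _ "?k * qy M i"]) (simp_all add: hlim_def)
    qed
  next
    case False
    let ?b = "r > 0 \<or> (if \<epsilon> = - 1 then i < j else j < i)"
    let ?c = "if ?b then (if \<epsilon> = 1 then eta else - eta) else 0"
    have "psx M (Q1 M) kap (pser \<epsilon>) i j $ r = eps * ?c"
    proof -
      have g: "(1 :: ratfun fps) $ r = (if r = 0 then 1 else 0)" by simp
      have kn: "(ksign t * (fps_const c - 1) :: ratfun fps) $ r = (if r = 0 then ksign t * (c - 1) else 0)" for t c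
        by (cases t) auto
      consider "j < i" | "i < j" | "i = j" "r > 0" using False by linarith
      then show ?thesis
        by cases (use assms in \<open>auto simp: psx_def kap_def pser_def k Q1_def kn\<close>)
    qed
    moreover have "?c \<in> A_loc" "evq ?c = of_int (- hlim \<epsilon> i j r)"
      using False assms evq_uminus[OF evq_eta(1)] by (auto simp: hlim_def evq_eta evq_basic)
    ultimately show ?thesis by blast
  qed
  then show ?thesis using that by blast
qed

lemma Lf_lim:
  assumes "\<epsilon> = - 1 \<or> \<epsilon> = 1"
  obtains l where "Lf M \<epsilon> n i j $ r = (if i = j \<and> r = 0 then sg M n (ipar M i) else 0) + sc eps * l"
    "red l (- (sc (of_int (hlim \<epsilon> i j r)) * mE n j i (\<epsilon> * int r)))"
proof -
  obtain c where c: "c \<in> A_loc" "psx M (Q1 M) kap (pser \<epsilon>) i j $ r = eps * c" "evq c = of_int (- hlim \<epsilon> i j r)"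
    using psx_lim[OF assms] by metis
  have "red (sc c * mE n j i (\<epsilon> * int r)) (sc (evq c) * mE n j i (\<epsilon> * int r))"
    by (rule red_sc[OF c(1) red_mE])
  moreover have "sc (of_int (- h)) * A = - (sc (of_int h) * A)" for h and A :: "complex seqop"
    by (rule linop_eqI) (simp add: app_simps)
  ultimately have "red (sc c * mE n j i (\<epsilon> * int r)) (- (sc (of_int (hlim \<epsilon> i j r)) * mE n j i (\<epsilon> * int r)))"
    unfolding c(3) by (simp only:)
  moreover have "Lf M \<epsilon> n i j $ r = (if i = j \<and> r = 0 then sg M n (ipar M i) else 0) + sc eps * (sc c * mE n j i (\<epsilon> * int r))"
    by (simp only: Lf_def fps_nth_Abs_fps c(2) sc_mult mult.assoc)
  ultimately show ?thesis using that by blast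
qed

definition glim :: "nat \<Rightarrow> int \<Rightarrow> nat \<Rightarrow> nat \<Rightarrow> nat \<Rightarrow> nat \<Rightarrow> complex seqop"
  where "glim M \<epsilon> n i j r = sc (of_int (hlim \<epsilon> i j r)) * (ksign (ipar M i * ipar M j) * gop M n (LE i j (\<epsilon> * int r)))"

text \<open>To first order the matrix product with one more L-operator becomes the recursion of
  \<open>gop\<close>: the new letter acts either on the last factor or on the earlier ones. The
  total parity operators account for the change of sign conventions.\<close>

lemma glim_Suc: "Sig M n (ipar M i) * (- (sc (of_int (hlim \<epsilon> i j r)) * mE n j i (\<epsilon> * int r)))
    + glim M \<epsilon> n i j r * Sig M n (ipar M i) * sg M n (ipar M j)
  = glim M \<epsilon> (Suc n) i j r * Sig M (Suc n) (ipar M i)"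
proof -
  let ?h = "sc (of_int (hlim \<epsilon> i j r)) :: complex seqop" and ?S = "Sig M n (ipar M i) :: complex seqop"
  let ?g = "gop M n (LE i j (\<epsilon> * int r)) :: complex seqop" and ?e = "mE n j i (\<epsilon> * int r) :: complex seqop"
  let ?k = "ksign (ipar M i * ipar M j) :: complex seqop"
  have 1: "?S * (- (?h * ?e)) = ?h * (- (?S * ?e))"
    by (simp add: sc_left)
  have "?g * sg M n (ipar M i + ipar M j) * (?S * sg M n (ipar M i)) = ?g * ?S * sg M n (ipar M j)"
  proof -
    have "?g * sg M n (ipar M i + ipar M j) * (?S * sg M n (ipar M i)) = ?g * (sg M n (ipar M i + ipar M j) * ?S) * sg M n (ipar M i)"
      by (simp only: mult.assoc)
    also have "\<dots> = ?g * ?S * (sg M n (ipar M i + ipar M j) * sg M n (ipar M i))"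
      unfolding sg_Sig by (simp only: mult.assoc)
    also have "sg M n (ipar M i + ipar M j) * sg M n (ipar M i) = (sg M n (ipar M j) :: complex seqop)"
      unfolding sg_sg by (cases "ipar M i"; cases "ipar M j"; simp)
    finally show ?thesis .
  qed
  note 2 = this
  have "- (ksign (ipar M i * ipar M j + ipar M i) * ?e) * (?S * sg M n (ipar M i)) = - (?k * (?S * ?e))"
  proof -
    have "?e * (?S * sg M n (ipar M i)) = ksign (ipar M i * ipar M i) * (?S * ?e)"
      unfolding mult.assoc[symmetric] mE_Sig unfolding mult.assoc mE_sg ksign_left ..
    then show ?thesis by (cases "ipar M i"; cases "ipar M j"; simp add: mult.assoc)
  qed
  note 3 = this
  have kk: "?k * (?k * z) = z" for z by (cases "ipar M i * ipar M j"; simp)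
  have "glim M \<epsilon> (Suc n) i j r * Sig M (Suc n) (ipar M i)
    = ?h * (?k * (?g * sg M n (ipar M i + ipar M j) * (?S * sg M n (ipar M i))
        + - (ksign (ipar M i * ipar M j + ipar M i) * ?e) * (?S * sg M n (ipar M i))))"
    by (simp only: glim_def gop.simps lop.simps loop_par.simps Sig.simps mult.assoc distrib_right)
  also have "\<dots> = ?h * (?k * (?g * ?S * sg M n (ipar M j))) + ?h * (- (?S * ?e))"
    unfolding 2 3 by (simp only: distrib_left mult_minus_right kk)
  finally show ?thesis unfolding 1 by (simp only: glim_def mult.assoc add.commute)
qed

text \<open>The Leibniz rule at \<open>q = 1\<close>: one factor contributes its first-order term,
  the other its parity operator.\<close>

lemma Tm_lim:
  assumes e: "\<epsilon> = - 1 \<or> \<epsilon> = 1"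
  shows "i \<in> idx M N \<Longrightarrow> j \<in> idx M N \<Longrightarrow> \<exists>g. Tm M N \<epsilon> n i j $ r = (if i = j \<and> r = 0 then Sig M n (ipar M i) else 0) + sc eps * g
    \<and> red g (glim M \<epsilon> n i j r * Sig M n (ipar M i))"
proof (induction n arbitrary: j r)
  case 0
  show ?case
  proof (rule exI[of _ 0], intro conjI)
    show "red 0 (glim M \<epsilon> 0 i j r * Sig M 0 (ipar M i))" by (simp add: glim_def red_zero)
  qed (auto simp: fps_one_nth)
next
  case (Suc n)
  have "\<forall>m b. \<exists>g. m \<in> idx M N \<longrightarrow> Tm M N \<epsilon> n i m $ b = (if i = m \<and> b = 0 then Sig M n (ipar M i) else 0) + sc eps * g
      \<and> red g (glim M \<epsilon> n i m b * Sig M n (ipar M i))"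
    using Suc.IH Suc.prems(1) by blast
  then obtain g where g: "\<And>m b. m \<in> idx M N \<Longrightarrow> Tm M N \<epsilon> n i m $ b = (if i = m \<and> b = 0 then Sig M n (ipar M i) else 0) + sc eps * g m b"
    "\<And>m b. m \<in> idx M N \<Longrightarrow> red (g m b) (glim M \<epsilon> n i m b * Sig M n (ipar M i))"
    by metis
  have "\<forall>m b. \<exists>l. Lf M \<epsilon> n m j $ b = (if m = j \<and> b = 0 then sg M n (ipar M m) else 0) + sc eps * l
      \<and> red l (- (sc (of_int (hlim \<epsilon> m j b)) * mE n j m (\<epsilon> * int b)))"
    using Lf_lim[OF e] by metis
  then obtain l where l: "\<And>m b. Lf M \<epsilon> n m j $ b = (if m = j \<and> b = 0 then sg M n (ipar M m) else 0) + sc eps * l m b"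
    "\<And>m b. red (l m b) (- (sc (of_int (hlim \<epsilon> m j b)) * mE n j m (\<epsilon> * int b)))"
    by metis
  let ?S = "Sig M n (ipar M i) :: bb" and ?s = "sg M n (ipar M j) :: bb"
  let ?D = "\<lambda>m b. if i = m \<and> b = 0 then ?S else 0" and ?D' = "\<lambda>m b. if m = j \<and> b = 0 then sg M n (ipar M m) else 0 :: bb"
  let ?G = "?S * l i r + g j r * ?s + sc eps * (\<Sum>m\<in>idx M N. \<Sum>b=0..r. g m b * l m (r - b))"
  have fin: "finite (idx M N)" by (simp add: idx_def)
  have s1: "(\<Sum>m\<in>idx M N. \<Sum>b=0..r. ?D m b * z m (r - b)) = ?S * z i r" for z :: "nat \<Rightarrow> nat \<Rightarrow> bb"
  proof -
    have "(\<Sum>b=0..r. ?D m b * z m (r - b)) = (if i = m then ?S * z i r else 0)" for m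
    proof (cases "i = m")
      case True
      have "(\<Sum>b=0..r. ?D m b * z m (r - b)) = (\<Sum>b=0..r. if b = 0 then ?S * z i r else 0)"
        by (rule sum.cong) (use True in auto)
      then show ?thesis using True by (simp add: sum.delta)
    qed simp
    then show ?thesis using Suc.prems(1) fin by (simp add: sum.delta')
  qed
  have s2: "(\<Sum>m\<in>idx M N. \<Sum>b=0..r. z m b * ?D' m (r - b)) = z j r * ?s" for z :: "nat \<Rightarrow> nat \<Rightarrow> bb"
  proof -
    have "(\<Sum>b=0..r. z m b * ?D' m (r - b)) = (if m = j then z j r * ?s else 0)" for m
    proof (cases "m = j")
      case True
      have "(\<Sum>b=0..r. z m b * ?D' m (r - b)) = (\<Sum>b=0..r. if b = r then z j r * ?s else 0)"
        by (rule sum.cong) (use True in auto)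
      then show ?thesis using True by (simp add: sum.delta)
    qed simp
    then show ?thesis using Suc.prems(2) fin by (simp add: sum.delta)
  qed
  have "Tm M N \<epsilon> (Suc n) i j $ r = (\<Sum>m\<in>idx M N. \<Sum>b=0..r. (?D m b + sc eps * g m b) * (?D' m (r - b) + sc eps * l m (r - b)))"
    by (simp only: Tm.simps fps_sum_nth fps_mult_nth) (intro sum.cong refl, simp only: g(1) l(1))
  also have "\<dots> = (\<Sum>m\<in>idx M N. \<Sum>b=0..r. ?D m b * ?D' m (r - b) + sc eps * (?D m b * l m (r - b))
      + (sc eps * (g m b * ?D' m (r - b)) + sc eps * (sc eps * (g m b * l m (r - b)))))"
    by (intro sum.cong refl) (simp only: distrib_left distrib_right mult.assoc sc_left[of "g _ _"] sc_left[of "if _ then _ else _"] add_ac)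
  also have "\<dots> = ?D j r * ?s + sc eps * (?S * l i r) + (sc eps * (g j r * ?s) + sc eps * (sc eps * (\<Sum>m\<in>idx M N. \<Sum>b=0..r. g m b * l m (r - b))))"
    by (simp only: sum.distrib s1 s2 flip: sum_distrib_left)
  also have "?D j r * ?s = (if i = j \<and> r = 0 then Sig M (Suc n) (ipar M i) else 0)" by auto
  finally have T: "Tm M N \<epsilon> (Suc n) i j $ r = (if i = j \<and> r = 0 then Sig M (Suc n) (ipar M i) else 0) + sc eps * ?G"
    by (simp only: distrib_left add.assoc)
  \<comment> \<open>The product of two first-order terms keeps a factor \<open>q - 1\<close>, so its
    value at \<open>q = 1\<close> is zero.\<close>
  have "red (sc eps * (\<Sum>m\<in>idx M N. \<Sum>b=0..r. g m b * l m (r - b)))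
    (sc (evq eps) * (\<Sum>m\<in>idx M N. \<Sum>b=0..r. (glim M \<epsilon> n i m b * Sig M n (ipar M i)) * (- (sc (of_int (hlim \<epsilon> m j (r - b))) * mE n j m (\<epsilon> * int (r - b))))))"
    by (intro red_sc evq_eps(1) red_sum red_mult g(2) l(2))
  then have "red (sc eps * (\<Sum>m\<in>idx M N. \<Sum>b=0..r. g m b * l m (r - b))) 0"
    unfolding evq_eps(2) sc_0 mult_zero_left .
  then have "red ?G (Sig M n (ipar M i) * (- (sc (of_int (hlim \<epsilon> i j r)) * mE n j i (\<epsilon> * int r)))
    + glim M \<epsilon> n i j r * Sig M n (ipar M i) * sg M n (ipar M j) + 0)"
    by (intro red_add red_mult red_Sig red_sg g(2) l(2) Suc.prems)
  then have "red ?G (glim M \<epsilon> (Suc n) i j r * Sig M (Suc n) (ipar M i))"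
    unfolding add_0_right glim_Suc .
  then show ?case using T by blast
qed

lemma phi_lim:
  assumes "\<epsilon> = - 1 \<or> \<epsilon> = 1" "i \<in> idx M N" "j \<in> idx M N"
  obtains g where "Tm M N \<epsilon> n i j $ r * Sig M n (ipar M i) = (if i = j \<and> r = 0 then 1 else 0) + sc eps * g"
    "red g (glim M \<epsilon> n i j r)"
proof -
  obtain g where g: "Tm M N \<epsilon> n i j $ r = (if i = j \<and> r = 0 then Sig M n (ipar M i) else 0) + sc eps * g"
    "red g (glim M \<epsilon> n i j r * Sig M n (ipar M i))"
    using Tm_lim[OF assms] by blast
  have S: "Sig M n p * Sig M n p = (1 :: 'k::comm_ring_1 seqop)" for p
  proof -
    have "Sig M n 0 = (1 :: 'k seqop)" by (induction n) (simp_all add: sg_0)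
    then show ?thesis unfolding Sig_Sig by simp
  qed
  have "Tm M N \<epsilon> n i j $ r * Sig M n (ipar M i) = (if i = j \<and> r = 0 then 1 else 0) + sc eps * (g * Sig M n (ipar M i))"
    unfolding g(1) by (simp add: distrib_right mult.assoc S)
  moreover have "red (g * Sig M n (ipar M i)) (glim M \<epsilon> n i j r)"
    using red_mult[OF g(2) red_Sig[of M n "ipar M i"]] by (simp only: mult.assoc S mult_1_right)
  ultimately show ?thesis using that by blast
qed

section \<open>The isomorphism\<close>

interpretation scc: central_scalars "sc :: complex \<Rightarrow> complex seqop"
  by (rule central_scalars_sc)

text \<open>Every complex function is the reduction of the function with the corresponding constant
  values in \<open>A_loc\<close>, so the reductions of \<open>A\<close>-valued functions determine
  the operator.\<close>

lemma red_unique: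
  assumes "red P p" "red P p'" shows "p = p'"
proof (rule linop_eqI)
  fix f :: "(nat \<Rightarrow> letter) \<Rightarrow> complex" and s
  have f: "\<forall>s. to_fract [:f s:] \<in> A_loc" "(\<lambda>s. evq (to_fract [:f s:])) = f" by (simp_all add: evq_const)
  show "app p f s = app p' f s"
    using assms[unfolded red_def, rule_format, of "\<lambda>s. to_fract [:f s:]" s] f by metis
qed

context qloop_limit
begin

abbreviation ph where "ph n \<equiv> feval sc (phi M N n)"

text \<open>The factor \<open>1 / 2\<close> is \<open>1 / eta\<close> at \<open>q = 1\<close>, from
  the normalisation of generators other than the diagonal ones in degree 0.\<close>

lemma gam_red:
  assumes "i \<in> idx M N" "j \<in> idx M N"
  shows "red (ph n (gam i j r)) (sc (if i = j \<and> r = 0 then 1 else 1 / 2) * glim M (- 1) n i j r)"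
    "red (ph n (gamt i j r)) (sc (if i = j \<and> r = 0 then 1 else 1 / 2) * glim M 1 n i j r)"
proof -
  have m: "sc a * (sc b * g) = sc (a * b) * g" for a b and g :: bb
    by (simp only: sc_mult mult.assoc)
  have "inverse eps * eps = 1" "inverse (eps * eta) * eps = inverse eta"
    using eps_nz by (simp_all add: field_simps)
  then have inv: "sc (inverse eps) * (sc eps * g) = g" "sc (inverse (eps * eta)) * (sc eps * g) = sc (inverse eta) * g" for g :: bb
    unfolding m by (simp_all only: sc_one mult_1_left)
  have main: "red (if i = j \<and> r = 0 then sc (inverse eps) * (t - 1) else sc (inverse (eps * eta)) * t)
      (sc (if i = j \<and> r = 0 then 1 else 1 / 2) * u)"
    if "t = (if i = j \<and> r = 0 then 1 else 0) + sc eps * g" "red g u" for t g u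
  proof (cases "i = j \<and> r = 0")
    case True
    then show ?thesis using that by (simp add: inv sc_one)
  next
    case False
    have "red (sc (inverse eta) * g) (sc (1 / 2) * u)"
      using red_sc[OF evq_eta(3) that(2)] by (simp only: evq_eta)
    then show ?thesis using False that(1) by (simp only: if_False add_0_left inv)
  qed
  obtain g where g: "phi M N n (QT i j r) = (if i = j \<and> r = 0 then 1 else 0) + sc eps * g" "red g (glim M (- 1) n i j r)"
    using phi_lim[OF _ assms, of "- 1" n r] by auto
  obtain g' where g': "phi M N n (QTt i j r) = (if i = j \<and> r = 0 then 1 else 0) + sc eps * g'" "red g' (glim M 1 n i j r)"
    using phi_lim[OF _ assms, of 1 n r] by auto
  have i: "ph n (if c then z else w) = (if c then ph n z else ph n w)" for c z w by simp
  have "ph n (gam i j r) = (if i = j \<and> r = 0 then sc (inverse eps) * (phi M N n (QT i j r) - 1) else sc (inverse (eps * eta)) * phi M N n (QT i j r))"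
    unfolding gam_def i sc.feval_mult sc.feval_diff sc.feval_fscalar sc.feval_one sc.feval_fgen
    by (cases "i = j \<and> r = 0") (auto simp del: phi.simps)
  then show "red (ph n (gam i j r)) (sc (if i = j \<and> r = 0 then 1 else 1 / 2) * glim M (- 1) n i j r)"
    using main[OF g] by (simp only:)
  have "ph n (gamt i j r) = (if i = j \<and> r = 0 then sc (inverse eps) * (phi M N n (QTt i j r) - 1) else sc (inverse (eps * eta)) * phi M N n (QTt i j r))"
    unfolding gamt_def i sc.feval_mult sc.feval_diff sc.feval_fscalar sc.feval_one sc.feval_fgen
    by (cases "i = j \<and> r = 0") (auto simp del: phi.simps)
  then show "red (ph n (gamt i j r)) (sc (if i = j \<and> r = 0 then 1 else 1 / 2) * glim M 1 n i j r)"
    using main[OF g'] by (simp only:)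
qed

text \<open>Existence of a value at \<open>q = 1\<close> is all that matters here: multiplied by
  \<open>q - 1\<close>, whatever the value is, it becomes zero.\<close>

lemma lat_red:
  assumes "x \<in> lat" shows "\<exists>p. red (ph n x) p"
  using assms
proof (induction rule: lat_induct)
  case (ideal x y)
  then show ?case by (simp add: sc.feval_add phi_J)
next
  case one
  show ?case using red_one by (auto simp: sc.feval_one)
next
  case (gam i j r)
  then show ?case using gam_red(1) by blast
next
  case (gamt i j r)
  then show ?case using gam_red(2) by blast
next
  case (add x y)
  then show ?case unfolding sc.feval_add by (blast intro: red_add)
next
  case (mult x y)
  then show ?case unfolding sc.feval_mult by (blast intro: red_mult)
next
  case (smult c x)
  then show ?case unfolding sc.feval_mult sc.feval_fscalar by (blast intro: red_sc)
qed

text \<open>The normalisation 1 or \<open>1 / 2\<close> cancels the factor \<open>hlim\<close> up to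
  sign, and the signs in \<open>lgen\<close> cancel the rest, so the classical operator appears
  exactly.\<close>

lemma lgen_red:
  assumes "g \<in> loop_gens M N"
  shows "red (ph n (lgen g)) (gop M n g)"
proof (cases g)
  case (LE i j r)
  then have ij: "i \<in> idx M N" "j \<in> idx M N" using assms by simp_all
  have kk: "ksign t * (sc c * (sc d * (ksign t * z))) = z" if "c * d = 1" for t c d and z :: "complex seqop"
  proof -
    have "sc c * (sc d * w) = w" for w :: "complex seqop"
      using that by (simp add: sc_one flip: mult.assoc sc_mult)
    then show ?thesis by (cases t) simp_all
  qed
  have kn: "- (ksign t * (sc c * (sc d * (ksign t * z)))) = z" if "c * d = - 1" for t c d and z :: "complex seqop"
  proof -
    have "sc c * (sc d * w) = - w" for w :: "complex seqop"
    proof (rule linop_eqI)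
      fix f s
      have "c * (d * app w f s) = - app w f s"
        using that by (simp flip: mult.assoc)
      then show "app (sc c * (sc d * w)) f s = app (- w) f s" by (simp add: app_simps)
    qed
    then show ?thesis by (cases t) simp_all
  qed
  have k: "ph n (ksign t * z) = ksign t * ph n z" for t z
    by (cases t) (simp_all add: sc.feval_uminus)
  show ?thesis
  proof (cases "r < 0 \<or> r = 0 \<and> i \<le> j")
    case True
    have "red (ph n (lgen g)) (ksign (ipar M i * ipar M j) * (sc (if i = j \<and> nat (- r) = 0 then 1 else 1 / 2) * glim M (- 1) n i j (nat (- r))))"
      unfolding LE lgen.simps if_P[OF True] k by (rule red_ksign[OF gam_red(1)[OF ij]])
    moreover have "ksign (ipar M i * ipar M j) * (sc (if i = j \<and> nat (- r) = 0 then 1 else 1 / 2) * glim M (- 1) n i j (nat (- r))) = gop M n g"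
    proof -
      have "- 1 * int (nat (- r)) = r" using True by auto
      moreover have "(if i = j \<and> nat (- r) = 0 then 1 else 1 / 2) * of_int (hlim (- 1) i j (nat (- r))) = (1 :: complex)"
        using True by (auto simp: hlim_def)
      ultimately show ?thesis unfolding glim_def LE by (simp only: kk)
    qed
    ultimately show ?thesis by (simp only:)
  next
    case False
    have "red (ph n (lgen g)) (- (ksign (ipar M i * ipar M j) * (sc (if i = j \<and> nat r = 0 then 1 else 1 / 2) * glim M 1 n i j (nat r))))"
      unfolding LE lgen.simps if_not_P[OF False] sc.feval_uminus k by (rule red_uminus[OF red_ksign[OF gam_red(2)[OF ij]]])
    moreover have "- (ksign (ipar M i * ipar M j) * (sc (if i = j \<and> nat r = 0 then 1 else 1 / 2) * glim M 1 n i j (nat r))) = gop M n g"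
    proof -
      have "1 * int (nat r) = r" using False by auto
      moreover have "(if i = j \<and> nat r = 0 then 1 else 1 / 2) * of_int (hlim 1 i j (nat r)) = (- 1 :: complex)"
        using False by (auto simp: hlim_def)
      ultimately show ?thesis unfolding glim_def LE by (simp only: kn)
    qed
    ultimately show ?thesis by (simp only:)
  qed
qed

lemma lift_red:
  assumes "x \<in> carrier L.F"
  shows "red (ph n (lift x)) (feval sc (gop M n) x)"
  using assms
proof (induction x rule: carrier_free_induct)
  case (scalar c)
  show ?case
    using red_sc[OF evq_const(1) red_one, of c]
    by (simp add: lift_simps sc.feval_fscalar scc.feval_fscalar evq_const)
qed (auto simp: lift_simps sc.feval_zero scc.feval_zero sc.feval_one scc.feval_one red_zero red_one
    sc.feval_add scc.feval_add sc.feval_mult scc.feval_mult scc.feval_fgen red_add red_mult lgen_red simp del: lgen.simps)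

lemma lift_faithful:
  assumes x: "x \<in> carrier L.F" "lift x \<in> latI"
  shows "x \<in> L.J"
proof -
  interpret LA: loopalg M N .
  obtain y where y: "y \<in> lat" "lift x - fscalar eps * y \<in> J" using x(2) by (auto simp: latI_def)
  have "LA.rep n x = 0" for n
  proof -
    have "ph n (lift x - fscalar eps * y) = 0" by (rule phi_J[OF y(2)])
    then have "ph n (lift x) = sc eps * ph n y"
      by (simp add: sc.feval_diff sc.feval_mult sc.feval_fscalar)
    moreover obtain p where "red (ph n y) p" using lat_red[OF y(1)] by blast
    \<comment> \<open>The operator of \<open>lift x\<close> now has two values at
      \<open>q = 1\<close>, namely 0 and the classical action of \<open>x\<close>; uniqueness
      identifies them.\<close>
    ultimately have "red (ph n (lift x)) 0"
      using red_sc[OF evq_eps(1), of "ph n y" p] by (simp add: evq_eps sc_0)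
    then show ?thesis unfolding LA.rep_def by (rule red_unique[OF lift_red[OF x(1)]])
  qed
  then show ?thesis by (rule LA.rep_faithful[OF x(1)])
qed

end

theorem theorem2p14:
  fixes M N :: nat
  shows "\<exists>\<psi> \<in> superalgebra_iso (U_loop M N) (U_spec M N).
    (\<forall>i\<in>idx M N. \<forall>j\<in>idx M N. i \<le> j \<longrightarrow>
       \<psi> (loop_E M N i j 0)
         = ksign (ipar M i * ipar M j) \<odot>\<^bsub>U_spec M N\<^esub> spec_class M N (gamma M N i j 0) \<and>
       \<psi> (loop_E M N j i 0)
         = (- ksign (ipar M i * ipar M j)) \<odot>\<^bsub>U_spec M N\<^esub> spec_class M N (gammat M N j i 0)) \<and>
    (\<forall>i\<in>idx M N. \<forall>j\<in>idx M N. \<forall>r::nat. r > 0 \<longrightarrow>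
       \<psi> (loop_E M N i j (- int r))
         = ksign (ipar M i * ipar M j) \<odot>\<^bsub>U_spec M N\<^esub> spec_class M N (gamma M N i j r) \<and>
       \<psi> (loop_E M N i j (int r))
         = (- ksign (ipar M i * ipar M j)) \<odot>\<^bsub>U_spec M N\<^esub> spec_class M N (gammat M N i j r))"
proof -
  interpret qloop_limit M N .
  show ?thesis
    by (rule bexI[OF _ psi_iso[OF lift_faithful]])
      (auto simp only: psi_formulas)
qed

end
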